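(* Let $S_0$ be the open unit disk, the complex plane or the Riemann sphere, let $f:S_0\to S_0$ be a holomorphic branched covering of degree $d$ with $1<d<\infty$, and let $S_\infty$ be its plaque inverse limit. A point $x\in S_\infty$ is regular if and only if $sign(x,c)=\{[0,0,0,\dots]\}$ for every critical point $c$ of $f$.
   Context: Put $S_1=S_2=\dots=S_0$ and $f_i=f:S_{i+1}\to S_i$. The plaque inverse limit $S_\infty$ is the set of all sequences $x=(x_1,x_2,\dots)$ with $x_i\in S_i$ and $f(x_{i+1})=x_i$ for all $i$, with the topology generated by the sets given by sequences $U=(U_1,U_2,\dots)$ of open sets $U_i\subset S_i$ with $f(U_{i+1})=U_i$ for all $i$ (such a $U$ being identified with the set of $x\in S_\infty$ with $x_i\in U_i$ for all $i$). A plaque is such an open set $U$ in which each $U_i$ is conformally equivalent to the unit disk and each $f|_{U_{i+1}}:U_{i+1}\to U_i$ is conformally equivalent to a self-map $z\mapsto z^t$ of the unit disk, $1\le t\le d$. Plaques containing $x$ form a local base at $x$, and open neighborhoods of points of $S_\infty$ are always assumed to be plaques. A point $x\in S_\infty$ is regular if there are an open neighborhood $U$ of $x$ and a positive integer $n$ such that $f:U_{i+1}\to U_i$ is a bijection for all $i\ge n$; otherwise $x$ is irregular. Let $I$ be the Boolean algebra of binary sequences modulo almost equality (differing in only finitely many places), with coordinatewise operations and order; $[a_1,a_2,\dots]$ denotes the class of $(a_1,a_2,\dots)$. For $a\in I$ let $\alpha(a)=\{b\in I: b\le a\}$. For an open neighborhood $U\subset S_\infty$ and a critical point $c\in S_0$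 of $f$, $ind(U,c)\in I$ is the class of the binary sequence with $1$ in the $n$-th place if and only if $c\in U_n$. A sequence $(U(1),U(2),\dots)$ of open neighborhoods of $x$ shrinks to $x$ if $U(i+1)\subset U(i)$ for all $i$ and every open neighborhood of $x$ contains some $U(m)$. The signature of $x$ with respect to $c$ is $sign(x,c)=\bigcap_{j=1}^\infty\alpha(ind(U(j),c))$ for any sequence $(U(1),U(2),\dots)$ of open neighborhoods of $x$ shrinking to $x$ (it does not depend on the choice). *)

theory Defs
  imports "HOL-Analysis.Analysis"
begin

section \<open>The Riemann sphere and its holomorphic maps\<close>

text \<open>
  The Riemann sphere is the one-point compactification of the complex plane; \<open>None\<close> is the
  point at infinity. The unit disk and the plane are the open subsets \<open>Some ` ball 0 1\<close> and
  \<open>range Some\<close>, so that all three surfaces are subsets of one type and carry the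
  structure induced from the sphere.
\<close>

type_synonym rsphere = "complex option"

definition rsphere_top :: "rsphere topology" where
  "rsphere_top = Alexandroff_compactification euclidean"

abbreviation unit_disk :: "rsphere set" where
  "unit_disk \<equiv> Some ` ball 0 1"

text \<open>The parametrization \<open>w \<mapsto> 1/w\<close> of the neighbourhood of infinity.\<close>

definition at_inf :: "complex \<Rightarrow> rsphere" where
  "at_inf w = (if w = 0 then None else Some (inverse w))"

text \<open>
  The inverses of these two injective maps are the standard holomorphic atlas of the sphere.
\<close>

definition parametrizations :: "(complex \<Rightarrow> rsphere) set" where
  "parametrizations = {Some, at_inf}"

lemma inj_parametrization: "\<phi> \<in> parametrizations \<Longrightarrow> inj \<phi>"
  by (auto simp: parametrizations_def at_inf_def inj_def split: if_splits)

text \<open>Used only for open \<open>U\<close>; continuity makes the sets below open in the plane.\<close>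

definition holo_on :: "(rsphere \<Rightarrow> rsphere) \<Rightarrow> rsphere set \<Rightarrow> bool" where
  "holo_on f U \<longleftrightarrow>
     continuous_map (subtopology rsphere_top U) rsphere_top f \<and>
     (\<forall>\<phi>\<in>parametrizations. \<forall>\<psi>\<in>parametrizations.
        (\<lambda>z. inv \<psi> (f (\<phi> z))) holomorphic_on {z. \<phi> z \<in> U \<and> f (\<phi> z) \<in> range \<psi>})"

definition conformal_iso :: "(rsphere \<Rightarrow> rsphere) \<Rightarrow> rsphere set \<Rightarrow> rsphere set \<Rightarrow> bool" where
  "conformal_iso h U V \<longleftrightarrow>
     bij_betw h U V \<and> holo_on h U \<and> holo_on (the_inv_into U h) V"

definition critical_point :: "(rsphere \<Rightarrow> rsphere) \<Rightarrow> rsphere \<Rightarrow> bool" where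
  "critical_point f c \<longleftrightarrow>
     (\<exists>\<phi>\<in>parametrizations. \<exists>\<psi>\<in>parametrizations. \<exists>z.
        \<phi> z = c \<and> f c \<in> range \<psi> \<and> deriv (\<lambda>w. inv \<psi> (f (\<phi> w))) z = 0)"

section \<open>Branched coverings\<close>

text \<open>
  In the coordinates \<open>\<phi>\<close> on \<open>W\<close> and \<open>\<psi>\<close> on \<open>V\<close>, the map
  \<open>f : W \<rightarrow> V\<close> is the self-map \<open>z \<mapsto> z ^ t\<close> of the unit disk.
\<close>

definition power_model ::
  "(rsphere \<Rightarrow> rsphere) \<Rightarrow> nat \<Rightarrow> (rsphere \<Rightarrow> rsphere) \<Rightarrow> rsphere set \<Rightarrow>
     (rsphere \<Rightarrow> rsphere) \<Rightarrow> rsphere set \<Rightarrow> bool" where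
  "power_model f t \<phi> W \<psi> V \<longleftrightarrow>
     conformal_iso \<phi> unit_disk W \<and> conformal_iso \<psi> unit_disk V \<and>
     (\<forall>z\<in>ball 0 1. f (\<phi> (Some z)) = \<psi> (Some (z ^ t)))"

text \<open>
  Every \<open>y\<close> has a disk neighbourhood \<open>V\<close>, centred at \<open>y\<close>, whose preimage is a finite
  disjoint union of open sets on which \<open>f\<close> is a power map, the exponents adding up to the
  degree. For \<open>d > 0\<close> this includes surjectivity.
\<close>

definition holo_branched_covering :: "rsphere set \<Rightarrow> (rsphere \<Rightarrow> rsphere) \<Rightarrow> nat \<Rightarrow> bool" where
  "holo_branched_covering S f d \<longleftrightarrow>
     holo_on f S \<and> f ` S \<subseteq> S \<and>
     (\<forall>y\<in>S. \<exists>V \<psi> \<W> t.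
        openin rsphere_top V \<and> V \<subseteq> S \<and> \<psi> (Some 0) = y \<and>
        finite \<W> \<and> disjoint \<W> \<and> \<Union>\<W> = {p \<in> S. f p \<in> V} \<and>
        (\<forall>W\<in>\<W>. openin rsphere_top W \<and> 1 \<le> t W \<and> (\<exists>\<phi>. power_model f (t W) \<phi> W \<psi> V)) \<and>
        (\<Sum>W\<in>\<W>. t W) = d)"

section \<open>The plaque inverse limit\<close>

text \<open>
  Sequences are indexed from 0 here, so \<open>x i\<close> stands for the \<open>(i+1)\<close>-st coordinate; all
  index sequences below are shifted in the same way.
\<close>

definition plaque_limit :: "rsphere set \<Rightarrow> (rsphere \<Rightarrow> rsphere) \<Rightarrow> (nat \<Rightarrow> rsphere) set" where
  "plaque_limit S f = {x. \<forall>i. x i \<in> S \<and> f (x (Suc i)) = x i}"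

definition open_seq :: "rsphere set \<Rightarrow> (rsphere \<Rightarrow> rsphere) \<Rightarrow> (nat \<Rightarrow> rsphere set) \<Rightarrow> bool" where
  "open_seq S f U \<longleftrightarrow>
     (\<forall>i. openin rsphere_top (U i) \<and> U i \<subseteq> S \<and> f ` U (Suc i) = U i)"

text \<open>The subset of the limit with which a sequence of open sets is identified.\<close>

definition seq_points ::
  "rsphere set \<Rightarrow> (rsphere \<Rightarrow> rsphere) \<Rightarrow> (nat \<Rightarrow> rsphere set) \<Rightarrow> (nat \<Rightarrow> rsphere) set" where
  "seq_points S f U = {x \<in> plaque_limit S f. \<forall>i. x i \<in> U i}"

definition plaque_limit_top ::
  "rsphere set \<Rightarrow> (rsphere \<Rightarrow> rsphere) \<Rightarrow> (nat \<Rightarrow> rsphere) topology" where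
  "plaque_limit_top S f = topology_generated_by (seq_points S f ` {U. open_seq S f U})"

definition plaque ::
  "rsphere set \<Rightarrow> (rsphere \<Rightarrow> rsphere) \<Rightarrow> nat \<Rightarrow> (nat \<Rightarrow> rsphere set) \<Rightarrow> bool" where
  "plaque S f d U \<longleftrightarrow>
     open_seq S f U \<and>
     (\<forall>i. \<exists>h. conformal_iso h unit_disk (U i)) \<and>
     (\<forall>i. \<exists>t \<phi> \<psi>. 1 \<le> t \<and> t \<le> d \<and> power_model f t \<phi> (U (Suc i)) \<psi> (U i))"

lemma plaque_open: "plaque S f d U \<Longrightarrow> openin (plaque_limit_top S f) (seq_points S f U)"
  by (auto simp: plaque_def plaque_limit_top_def intro: topology_generated_by_Basis)

text \<open>Open neighbourhoods of points of the limit are understood to be plaques.\<close>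

definition nhd ::
  "rsphere set \<Rightarrow> (rsphere \<Rightarrow> rsphere) \<Rightarrow> nat \<Rightarrow> (nat \<Rightarrow> rsphere) \<Rightarrow> (nat \<Rightarrow> rsphere set) \<Rightarrow> bool" where
  "nhd S f d x U \<longleftrightarrow> plaque S f d U \<and> x \<in> seq_points S f U"

definition regular_point ::
  "rsphere set \<Rightarrow> (rsphere \<Rightarrow> rsphere) \<Rightarrow> nat \<Rightarrow> (nat \<Rightarrow> rsphere) \<Rightarrow> bool" where
  "regular_point S f d x \<longleftrightarrow>
     (\<exists>U n. nhd S f d x U \<and> (\<forall>i\<ge>n. bij_betw f (U (Suc i)) (U i)))"

section \<open>Binary sequences modulo almost equality\<close>

quotient_type binclass = "nat \<Rightarrow> bool" / "\<lambda>a b. \<forall>\<^sub>\<infinity>n. a n = b n"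
  morphisms rep_binclass binclass
proof (rule equivpI)
  show "reflp (\<lambda>a b. \<forall>\<^sub>\<infinity>n. a n = (b n :: bool))"
    by (simp add: reflp_def)
  show "symp (\<lambda>a b. \<forall>\<^sub>\<infinity>n. a n = (b n :: bool))"
    by (auto simp: symp_def eq_commute)
  show "transp (\<lambda>a b. \<forall>\<^sub>\<infinity>n. a n = (b n :: bool))"
    by (auto simp: transp_def elim: eventually_elim2)
qed

instantiation binclass :: boolean_algebra
begin

lift_definition bot_binclass :: binclass is "\<lambda>_. False" .
lift_definition top_binclass :: binclass is "\<lambda>_. True" .
lift_definition inf_binclass :: "binclass \<Rightarrow> binclass \<Rightarrow> binclass" is "\<lambda>a b n. a n \<and> b n"
  by (auto elim: eventually_elim2)
lift_definition sup_binclass :: "binclass \<Rightarrow> binclass \<Rightarrow> binclass" is "\<lambda>a b n. a n \<or> b n"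
  by (auto elim: eventually_elim2)
lift_definition uminus_binclass :: "binclass \<Rightarrow> binclass" is "\<lambda>a n. \<not> a n"
  by (auto elim: eventually_mono)
lift_definition minus_binclass :: "binclass \<Rightarrow> binclass \<Rightarrow> binclass" is "\<lambda>a b n. a n \<and> \<not> b n"
  by (auto elim: eventually_elim2)
lift_definition less_eq_binclass :: "binclass \<Rightarrow> binclass \<Rightarrow> bool"
  is "\<lambda>a b. \<forall>\<^sub>\<infinity>n. a n \<longrightarrow> b n"
proof -
  fix a b c d :: "nat \<Rightarrow> bool"
  assume "\<forall>\<^sub>\<infinity>n. a n = b n" "\<forall>\<^sub>\<infinity>n. c n = d n"
  then have "\<forall>\<^sub>\<infinity>n. (a n \<longrightarrow> c n) = (b n \<longrightarrow> d n)"
    by (rule eventually_elim2) auto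
  then show "(\<forall>\<^sub>\<infinity>n. a n \<longrightarrow> c n) = (\<forall>\<^sub>\<infinity>n. b n \<longrightarrow> d n)"
    by (rule eventually_subst)
qed

definition less_binclass :: "binclass \<Rightarrow> binclass \<Rightarrow> bool" where
  "less_binclass a b \<longleftrightarrow> a \<le> b \<and> \<not> b \<le> a"

instance
proof
  fix x y z :: binclass
  show "(x < y) = (x \<le> y \<and> \<not> y \<le> x)" by (rule less_binclass_def)
  show "x \<le> x" by transfer simp
  show "x \<le> y \<Longrightarrow> y \<le> z \<Longrightarrow> x \<le> z" by transfer (auto elim: eventually_elim2)
  show "x \<le> y \<Longrightarrow> y \<le> x \<Longrightarrow> x = y" by transfer (auto elim: eventually_elim2)
  show "inf x y \<le> x" by transfer simp
  show "inf x y \<le> y" by transfer simp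
  show "x \<le> sup x y" by transfer simp
  show "y \<le> sup x y" by transfer simp
  show "x \<le> y \<Longrightarrow> x \<le> z \<Longrightarrow> x \<le> inf y z" by transfer (auto elim: eventually_elim2)
  show "y \<le> x \<Longrightarrow> z \<le> x \<Longrightarrow> sup y z \<le> x" by transfer (auto elim: eventually_elim2)
  show "bot \<le> x" by transfer simp
  show "x \<le> top" by transfer simp
  show "sup x (inf y z) = inf (sup x y) (sup x z)" by transfer (auto intro!: always_eventually)
  show "inf x (- x) = bot" by transfer simp
  show "sup x (- x) = top" by transfer simp
  show "x - y = inf x (- y)" by transfer simp
qed

end

definition lower :: "binclass \<Rightarrow> binclass set" where
  "lower a = {b. b \<le> a}"

section \<open>Signatures\<close>

definition ind :: "(nat \<Rightarrow> rsphere set) \<Rightarrow> rsphere \<Rightarrow> binclass" where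
  "ind U c = binclass (\<lambda>n. c \<in> U n)"

definition shrinks_to ::
  "rsphere set \<Rightarrow> (rsphere \<Rightarrow> rsphere) \<Rightarrow> nat \<Rightarrow> (nat \<Rightarrow> nat \<Rightarrow> rsphere set) \<Rightarrow>
     (nat \<Rightarrow> rsphere) \<Rightarrow> bool" where
  "shrinks_to S f d U x \<longleftrightarrow>
     (\<forall>j. nhd S f d x (U j)) \<and>
     (\<forall>j. seq_points S f (U (Suc j)) \<subseteq> seq_points S f (U j)) \<and>
     (\<forall>V. nhd S f d x V \<longrightarrow> (\<exists>m. seq_points S f (U m) \<subseteq> seq_points S f V))"

text \<open>
  All shrinking sequences give the same value (\<open>signature_eq\<close> below); intersecting over all of
  them expresses this without choosing one.
\<close>

definition signature ::
  "rsphere set \<Rightarrow> (rsphere \<Rightarrow> rsphere) \<Rightarrow> nat \<Rightarrow> (nat \<Rightarrow> rsphere) \<Rightarrow> rsphere \<Rightarrow> binclass set" where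
  "signature S f d x c = (\<Inter>U\<in>{U. shrinks_to S f d U x}. \<Inter>j. lower (ind (U j) c))"

lemma open_seq_point:
  assumes "open_seq S f U" "p \<in> U n"
  shows "\<exists>x\<in>seq_points S f U. x n = p"
proof -
  have sub: "U i \<subseteq> S" and im: "f ` U (Suc i) = U i" for i
    using assms(1) by (auto simp: open_seq_def)
  have "\<exists>g. \<forall>k. (g k \<in> U (n + k) \<and> (k = 0 \<longrightarrow> g k = p)) \<and> f (g (Suc k)) = g k"
  proof (rule dependent_nat_choice[of "\<lambda>k y. y \<in> U (n + k) \<and> (k = 0 \<longrightarrow> y = p)" "\<lambda>_ y z. f z = y"])
    show "\<exists>y. y \<in> U (n + 0) \<and> ((0::nat) = 0 \<longrightarrow> y = p)" using assms(2) by auto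
    fix y k assume "y \<in> U (n + k) \<and> (k = 0 \<longrightarrow> y = p)"
    then have "y \<in> f ` U (Suc (n + k))" using im by simp
    then show "\<exists>z. (z \<in> U (n + Suc k) \<and> (Suc k = 0 \<longrightarrow> z = p)) \<and> f z = y" by auto
  qed
  then obtain g where g: "\<And>k. g k \<in> U (n + k)" "g 0 = p" "\<And>k. f (g (Suc k)) = g k" by blast
  define x where "x i = (if i < n then (f ^^ (n - i)) p else g (i - n))" for i
  have down: "k \<le> n \<Longrightarrow> (f ^^ k) p \<in> U (n - k)" for k
  proof (induction k)
    case (Suc k)
    then have "n - k = Suc (n - Suc k)" by simp
    with Suc im[of "n - Suc k"] show ?case by auto
  qed (use assms(2) in simp)
  have "x i \<in> U i" for i
    using down[of "n - i"] g(1)[of "i - n"] by (auto simp: x_def)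
  moreover have "f (x (Suc i)) = x i" for i
  proof -
    consider "Suc i < n" | "Suc i = n" | "n \<le> i" by linarith
    then show ?thesis
    proof cases
      case 1
      then have "n - i = Suc (n - Suc i)" by simp
      with 1 show ?thesis by (simp add: x_def)
    next
      case 2
      then show ?thesis using g(2) by (auto simp: x_def)
    next
      case 3
      then show ?thesis using g(3) by (simp add: x_def Suc_diff_le)
    qed
  qed
  ultimately have "x \<in> seq_points S f U"
    using sub by (auto simp: seq_points_def plaque_limit_def)
  moreover have "x n = p" using g(2) by (simp add: x_def)
  ultimately show ?thesis by blast
qed

lemma ind_mono:
  assumes "open_seq S f U" "seq_points S f U \<subseteq> seq_points S f V"
  shows "ind U c \<le> ind V c"
proof -
  have "U n \<subseteq> V n" for n
    using open_seq_point[OF assms(1)] assms(2) by (fastforce simp: seq_points_def)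
  then show ?thesis
    unfolding ind_def by transfer (auto intro!: always_eventually)
qed

lemma signature_eq:
  assumes "shrinks_to S f d U x"
  shows "signature S f d x c = (\<Inter>j. lower (ind (U j) c))"
proof -
  have "b \<le> ind (V k) c" if V: "shrinks_to S f d V x" and b: "\<forall>j. b \<le> ind (U j) c" for V k b
  proof -
    have "nhd S f d x (V k)" using V by (simp add: shrinks_to_def)
    then obtain m where "seq_points S f (U m) \<subseteq> seq_points S f (V k)"
      using assms by (auto simp: shrinks_to_def)
    moreover have "open_seq S f (U m)"
      using assms by (auto simp: shrinks_to_def nhd_def plaque_def)
    ultimately show ?thesis using ind_mono b order_trans by blast
  qed
  then show ?thesis
    using assms unfolding signature_def lower_def by blast
qed

end

theory Submission
  imports Defs "HOL-Complex_Analysis.Complex_Analysis"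
begin

text \<open>
  A map that is not bijective between consecutive levels of a plaque has a critical point in the upper level.
  As there are only finitely many critical points, an irregular point has one critical point lying in
  infinitely many levels of every neighbourhood, and a diagonal choice of levels gives a nonzero element of
  its signature; conversely injective maps have no critical points.

  A point need not have arbitrarily small plaque neighbourhoods, and without a shrinking sequence the signature
  is the whole algebra. At a regular point shrinking sequences exist because a small disk lifts through
  finitely many power maps to disks, and then through bijections for ever. If there are none, every critical
  point has the wrong signature, and there is one because an unbranched covering of degree greater than one
  of a simply connected surface cannot be connected.
  Finiteness of the critical set follows from compactness on the sphere, and from \<open>f\<close> being a
  polynomial on the plane and a finite Blaschke product on the disk.
\<close>

section \<open>Coordinates on the sphere\<close>

text \<open>Neighbourhoods in the limit are compared as sets of threads, whereas power models and
  critical points live on single levels. \<open>open_seq_point\<close> passes from threads to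
  levels. Conversely, containment of plaque neighbourhoods of \<open>x\<close> is decided on the
  bottom level: power maps are proper, so a connected set that maps into one level of a plaque and
  meets the next level lies in the latter. Shrinking plaques to \<open>x\<close> thus amounts to
  shrinking their bottom levels to \<open>x 0\<close>.

  Critical points are defined by derivatives in the two standard charts, while branching is given in
  arbitrary disk coordinates. Failure of local injectivity mentions no coordinates and links the
  two.

  The definition of a branched covering bounds the number of critical points only locally over the
  target. On the disk and the plane they could a priori accumulate at the frontier; properness of
  \<open>f\<close> excludes this by making \<open>f\<close> a quotient of polynomials there. On the
  sphere the covering argument needs planar coordinates on source and target, so one value is
  removed from the target, chosen such that infinity disappears from the source.\<close>

lemma topspace_rsphere [simp]: "topspace rsphere_top = UNIV"
  using UNIV_option_conv by (auto simp: rsphere_top_def)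

lemma Hausdorff_rsphere: "Hausdorff_space rsphere_top"
  using locally_compact_space_euclidean
  by (auto simp: rsphere_top_def Hausdorff_space_Alexandroff_compactification)

lemma compact_rsphere: "compact_space rsphere_top"
  by (simp add: rsphere_top_def)

lemma inj_at_inf: "inj at_inf"
  using inj_parametrization by (auto simp: parametrizations_def)

lemma at_inf_vimage_Some: "at_inf -` (Some ` A) = {w. w \<noteq> 0 \<and> inverse w \<in> A}"
  by (auto simp: at_inf_def split: if_splits)

lemma Some_vimage_at_inf: "Some -` (at_inf ` A) = {w. w \<noteq> 0 \<and> inverse w \<in> A}"
proof -
  have "Some w \<in> at_inf ` A" if "w \<noteq> 0" "inverse w \<in> A" for w
    by (rule image_eqI[of _ _ "inverse w"]) (use that in \<open>auto simp: at_inf_def\<close>)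
  moreover have "w \<noteq> 0 \<and> inverse w \<in> A" if "Some w \<in> at_inf ` A" for w
    using that by (auto simp: at_inf_def split: if_splits)
  ultimately show ?thesis by blast
qed

lemma open_inverse_vimage:
  assumes "open (A :: complex set)"
  shows "open {w. w \<noteq> 0 \<and> inverse w \<in> A}"
proof -
  have "open ((- {0}) \<inter> inverse -` A)"
    by (intro continuous_open_preimage continuous_intros assms) auto
  then show ?thesis by (simp add: Int_def vimage_def)
qed

text \<open>Inversion exchanges complements of bounded sets with neighbourhoods of \<open>0\<close>,
  so the neighbourhoods of \<open>None\<close> in the compactification, which are complements of
  compact sets, can be recognised in the second chart.\<close>

lemma openin_rsphere:
  "openin rsphere_top X \<longleftrightarrow> open (Some -` X) \<and> open (at_inf -` X)" (is "?L \<longleftrightarrow> ?R")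
proof
  assume ?L
  then consider U where "open U" "X = Some ` U"
    | C where "compact C" "X = insert None (Some ` (- C))"
    by (auto simp: rsphere_top_def openin_Alexandroff_compactification Compl_eq_Diff_UNIV)
  then show ?R
  proof cases
    case 1
    then show ?thesis
      using open_inverse_vimage[of U] by (simp add: at_inf_vimage_Some inj_vimage_image_eq)
  next
    case 2
    have e: "at_inf -` X = insert 0 {w. w \<noteq> 0 \<and> inverse w \<in> - C}"
      using 2 by (auto simp: at_inf_def split: if_splits)
    obtain B where B: "B > 0" "\<And>z. z \<in> C \<Longrightarrow> norm z \<le> B"
      using 2(1) by (meson bounded_pos compact_imp_bounded)
    have "ball 0 (inverse B) \<subseteq> at_inf -` X"
    proof
      fix w :: complex assume w: "w \<in> ball 0 (inverse B)"
      show "w \<in> at_inf -` X"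
      proof (cases "w = 0")
        case False
        with w have "norm (inverse w) > B"
          by (metis B(1) dist_0_norm less_imp_inverse_less mem_ball norm_inverse
              positive_imp_inverse_positive inverse_inverse_eq zero_less_norm_iff)
        then have "inverse w \<notin> C" using B(2) by force
        then show ?thesis using False e by simp
      qed (use e in simp)
    qed
    then have "at_inf -` X = ball 0 (inverse B) \<union> {w. w \<noteq> 0 \<and> inverse w \<in> - C}"
      using e B(1) by auto
    then have "open (at_inf -` X)"
      using open_inverse_vimage[of "- C"] 2(1) by (simp add: compact_imp_closed open_Compl open_Un)
    moreover have "Some -` X = - C" using 2 by auto
    ultimately show ?thesis using 2(1) by (simp add: compact_imp_closed open_Compl)
  qed
next
  assume R: ?R
  show ?L
  proof (cases "None \<in> X")
    case False
    then have "X = Some ` (Some -` X)" by (auto simp: image_iff) (metis not_None_eq)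
    then show ?thesis
      using R unfolding rsphere_top_def
      by (metis openin_Alexandroff_compactification_image_Some open_openin)
  next
    case True
    have c: "closed (- (Some -` X))" using R by (simp add: closed_Compl)
    have "0 \<in> at_inf -` X" using True by (simp add: at_inf_def)
    then obtain e where e: "e > 0" "ball 0 e \<subseteq> at_inf -` X"
      using R by (meson openE)
    have "norm z \<le> inverse e" if "Some z \<notin> X" for z
    proof (rule ccontr)
      assume n: "\<not> norm z \<le> inverse e"
      then have "z \<noteq> 0" using e(1) by auto
      moreover have "inverse z \<in> ball 0 e"
        using n e(1) \<open>z \<noteq> 0\<close> by (simp add: norm_inverse) (metis inverse_less_imp_less inverse_inverse_eq
            not_le zero_less_norm_iff less_imp_inverse_less positive_imp_inverse_positive)
      ultimately have "Some z \<in> X" using e(2) by (auto simp: at_inf_def)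
      with that show False by simp
    qed
    then have "compact (- (Some -` X))"
      using c by (auto simp: compact_eq_bounded_closed bounded_iff)
    moreover have "X = insert None (Some ` (UNIV - (- (Some -` X))))"
      using True by (auto simp: image_iff)
    ultimately show ?thesis
      unfolding rsphere_top_def openin_Alexandroff_compactification using c by fastforce
  qed
qed

lemma open_param_vimage: "\<phi> \<in> parametrizations \<Longrightarrow> openin rsphere_top X \<Longrightarrow> open (\<phi> -` X)"
  by (auto simp: parametrizations_def openin_rsphere)

lemma openin_param_image: "\<phi> \<in> parametrizations \<Longrightarrow> open A \<Longrightarrow> openin rsphere_top (\<phi> ` A)"
  by (auto simp: parametrizations_def openin_rsphere at_inf_vimage_Some Some_vimage_at_inf
      inj_vimage_image_eq inj_at_inf open_inverse_vimage)

lemma param_cover: obtains \<phi> z where "\<phi> \<in> parametrizations" "\<phi> z = p"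
proof (cases p)
  case None
  then have "at_inf 0 = p" by (simp add: at_inf_def)
  then show ?thesis using that by (auto simp: parametrizations_def)
next
  case (Some a)
  then show ?thesis using that by (auto simp: parametrizations_def)
qed

lemma Some_param: "Some \<in> parametrizations"
  by (simp add: parametrizations_def)

lemma inv_param [simp]: "\<phi> \<in> parametrizations \<Longrightarrow> inv \<phi> (\<phi> z) = z"
  by (simp add: inj_parametrization)

lemma transition_analytic:
  assumes "\<phi> \<in> parametrizations" "\<psi> \<in> parametrizations" "\<psi> w \<in> range \<phi>"
  shows "(\<lambda>u. inv \<phi> (\<psi> u)) analytic_on {w}"
proof (cases "\<phi> = \<psi>")
  case True
  then show ?thesis using assms by (simp add: analytic_on_id)
next
  case False
  \<comment> \<open>Inversion is its own inverse, so both orders of the two distinct charts give the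
    same formula.\<close>
  have 1: "\<psi> u = \<phi> (inverse u)" if "u \<noteq> 0" for u
    using assms False that by (auto simp: parametrizations_def at_inf_def)
  then have "inv \<phi> (\<psi> u) = inverse u" if "u \<noteq> 0" for u
    using assms(1) that by simp
  moreover have w: "w \<noteq> 0"
    using assms False by (auto simp: parametrizations_def at_inf_def split: if_splits)
  moreover have "inverse analytic_on {w}"
    using w by (intro analytic_on_inverse analytic_on_id) auto
  moreover have "eventually (\<lambda>u. u \<noteq> 0) (nhds w)"
    using w by (intro t1_space_nhds)
  ultimately show ?thesis
    by (subst analytic_at_cong[of _ inverse w w]) (auto elim: eventually_mono)
qed

section \<open>Holomorphy at a point\<close>

definition cont_at :: "(rsphere \<Rightarrow> rsphere) \<Rightarrow> rsphere \<Rightarrow> bool" where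
  "cont_at f p \<longleftrightarrow> (\<forall>V. openin rsphere_top V \<and> f p \<in> V \<longrightarrow>
     (\<exists>N. openin rsphere_top N \<and> p \<in> N \<and> f ` N \<subseteq> V))"

text \<open>A pointwise form of \<open>holo_on\<close>: composition and local modification of maps
  then need no tracking of domains. Analyticity on a singleton means holomorphy on some
  neighbourhood of the point.\<close>

definition hol_at :: "(rsphere \<Rightarrow> rsphere) \<Rightarrow> rsphere \<Rightarrow> bool" where
  "hol_at f p \<longleftrightarrow> cont_at f p \<and>
     (\<forall>\<phi>\<in>parametrizations. \<forall>\<psi>\<in>parametrizations. \<forall>z. \<phi> z = p \<longrightarrow> f p \<in> range \<psi> \<longrightarrow>
        (\<lambda>w. inv \<psi> (f (\<phi> w))) analytic_on {z})"

lemma cont_atD: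
  assumes "cont_at f p" "openin rsphere_top V" "f p \<in> V"
  obtains N where "openin rsphere_top N" "p \<in> N" "f ` N \<subseteq> V"
  using assms unfolding cont_at_def by blast

lemma cont_at_compose: "cont_at f p \<Longrightarrow> cont_at g (f p) \<Longrightarrow> cont_at (\<lambda>x. g (f x)) p"
  unfolding cont_at_def by (metis image_image image_mono order_trans image_subset_iff)

lemma cont_at_eventually_chart:
  assumes "cont_at f (\<phi> z)" "\<phi> \<in> parametrizations" "openin rsphere_top V" "f (\<phi> z) \<in> V"
  shows "eventually (\<lambda>w. f (\<phi> w) \<in> V) (nhds z)"
proof -
  obtain N where "openin rsphere_top N" "\<phi> z \<in> N" "f ` N \<subseteq> V"
    using cont_atD assms by metis
  then show ?thesis
    using open_param_vimage[OF assms(2), of N]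
    by (intro eventually_nhds_in_open[THEN eventually_mono, of "\<phi> -` N"]) auto
qed

lemma openin_range_param: "\<phi> \<in> parametrizations \<Longrightarrow> openin rsphere_top (range \<phi>)"
  by (rule openin_param_image) auto

lemma cont_at_iff:
  assumes "openin rsphere_top U"
  shows "continuous_map (subtopology rsphere_top U) rsphere_top f \<longleftrightarrow> (\<forall>p\<in>U. cont_at f p)"
    (is "?L \<longleftrightarrow> ?R")
proof
  assume L: ?L
  show ?R unfolding cont_at_def
  proof (intro ballI allI impI)
    fix p V assume "p \<in> U" "openin rsphere_top V \<and> f p \<in> V"
    then have "openin (subtopology rsphere_top U) {x \<in> U. f x \<in> V}"
      using L by (auto simp: continuous_map_def)
    then have "openin rsphere_top {x \<in> U. f x \<in> V}"
      using assms by (simp add: openin_open_subtopology)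
    then show "\<exists>N. openin rsphere_top N \<and> p \<in> N \<and> f ` N \<subseteq> V"
      by (rule_tac x="{x \<in> U. f x \<in> V}" in exI)
        (use \<open>p \<in> U\<close> \<open>openin rsphere_top V \<and> f p \<in> V\<close> in auto)
  qed
next
  assume R: ?R
  have "openin rsphere_top {x \<in> U. f x \<in> V}" if V: "openin rsphere_top V" for V
  proof (subst openin_subopen, intro ballI)
    fix p assume p: "p \<in> {x \<in> U. f x \<in> V}"
    then obtain N where "openin rsphere_top N" "p \<in> N" "f ` N \<subseteq> V"
      using R V cont_atD by (metis (lifting) mem_Collect_eq)
    then show "\<exists>T. openin rsphere_top T \<and> p \<in> T \<and> T \<subseteq> {x \<in> U. f x \<in> V}"
      using assms p by (intro exI[of _ "N \<inter> U"]) auto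
  qed
  then show ?L
    using assms by (auto simp: continuous_map_def openin_open_subtopology)
qed

lemma openin_cont_vimage:
  assumes "openin rsphere_top U" "\<And>p. p \<in> U \<Longrightarrow> cont_at f p" "openin rsphere_top V"
  shows "openin rsphere_top {p \<in> U. f p \<in> V}"
proof -
  have "continuous_map (subtopology rsphere_top U) rsphere_top f"
    using assms cont_at_iff by blast
  then show ?thesis
    using assms by (auto simp: continuous_map_def openin_open_subtopology)
qed

text \<open>Continuity makes the chart domains open, and on open sets holomorphy is analyticity at
  each point.\<close>

lemma holo_on_iff:
  assumes "openin rsphere_top U"
  shows "holo_on f U \<longleftrightarrow> (\<forall>p\<in>U. hol_at f p)"
proof -
  have "(\<lambda>z. inv \<psi> (f (\<phi> z))) holomorphic_on {z. \<phi> z \<in> U \<and> f (\<phi> z) \<in> range \<psi>} \<longleftrightarrow>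
      (\<forall>p\<in>U. \<forall>z. \<phi> z = p \<longrightarrow> f p \<in> range \<psi> \<longrightarrow> (\<lambda>w. inv \<psi> (f (\<phi> w))) analytic_on {z})"
    if *: "\<forall>p\<in>U. cont_at f p" and \<phi>: "\<phi> \<in> parametrizations" and \<psi>: "\<psi> \<in> parametrizations" for \<phi> \<psi>
  proof -
    have "openin rsphere_top {p \<in> U. f p \<in> range \<psi>}"
      by (intro openin_cont_vimage assms openin_range_param \<psi>) (use * in auto)
    then have "open (\<phi> -` {p \<in> U. f p \<in> range \<psi>})"
      using \<phi> open_param_vimage by blast
    then have "open {z. \<phi> z \<in> U \<and> f (\<phi> z) \<in> range \<psi>}" by (simp add: vimage_def)
    then show ?thesis
      by (subst analytic_on_open[symmetric]) (auto simp: analytic_on_def)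
  qed
  then show ?thesis
    unfolding holo_on_def hol_at_def cont_at_iff[OF assms] by blast
qed

lemma hol_at_imp_cont_at: "hol_at f p \<Longrightarrow> cont_at f p"
  by (simp add: hol_at_def)

lemma hol_at_chart:
  assumes "hol_at f (\<phi> z)" "\<phi> \<in> parametrizations" "\<psi> \<in> parametrizations" "f (\<phi> z) \<in> range \<psi>"
  shows "(\<lambda>w. inv \<psi> (f (\<phi> w))) analytic_on {z}"
  using assms unfolding hol_at_def by blast

lemma hol_at_compose:
  assumes "hol_at f p" "hol_at g (f p)"
  shows "hol_at (\<lambda>x. g (f x)) p"
  unfolding hol_at_def
proof (intro conjI ballI allI impI)
  show "cont_at (\<lambda>x. g (f x)) p"
    using assms by (simp add: cont_at_compose hol_at_def)
  fix \<phi> \<psi> z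
  assume *: "\<phi> \<in> parametrizations" "\<psi> \<in> parametrizations" "\<phi> z = p" "g (f p) \<in> range \<psi>"
  obtain \<theta> y where \<theta>: "\<theta> \<in> parametrizations" "\<theta> y = f p" by (rule param_cover)
  have f: "(\<lambda>w. inv \<theta> (f (\<phi> w))) analytic_on {z}"
    using hol_at_chart[of f \<phi> z \<theta>] * assms \<theta> by (metis rangeI)
  have iv: "inv \<theta> (f (\<phi> z)) = y" using * \<theta> by (metis inv_param)
  have g: "(\<lambda>w. inv \<psi> (g (\<theta> w))) analytic_on {y}"
    using hol_at_chart[of g \<theta> y \<psi>] * assms \<theta> by metis
  have "(\<lambda>w. inv \<psi> (g (\<theta> w))) \<circ> (\<lambda>w. inv \<theta> (f (\<phi> w))) analytic_on {z}"
    by (rule analytic_on_compose) (use f g iv in auto)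
  \<comment> \<open>Continuity keeps the values of \<open>f\<close> near \<open>p\<close> inside the
    intermediate chart, where \<open>\<theta>\<close> cancels against its inverse.\<close>
  moreover have "eventually (\<lambda>w. f (\<phi> w) \<in> range \<theta>) (nhds z)"
    by (rule cont_at_eventually_chart)
      (use * \<theta> assms hol_at_imp_cont_at in \<open>auto simp: openin_range_param\<close>, metis rangeI)
  ultimately show "(\<lambda>w. inv \<psi> (g (f (\<phi> w)))) analytic_on {z}"
    by (subst analytic_at_cong[OF _ refl])
      (auto elim!: eventually_mono simp: f_inv_into_f)
qed

lemma hol_at_cong:
  assumes "hol_at f p" "openin rsphere_top N" "p \<in> N" "\<And>x. x \<in> N \<Longrightarrow> f x = g x"
  shows "hol_at g p"
proof -
  have "cont_at g p"
    unfolding cont_at_def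
  proof (intro allI impI)
    fix V assume "openin rsphere_top V \<and> g p \<in> V"
    then obtain M where "openin rsphere_top M" "p \<in> M" "f ` M \<subseteq> V"
      using assms cont_atD[of f p V] by (metis hol_at_imp_cont_at)
    then show "\<exists>N. openin rsphere_top N \<and> p \<in> N \<and> g ` N \<subseteq> V"
      using assms by (intro exI[of _ "M \<inter> N"]) force
  qed
  moreover have "(\<lambda>w. inv \<psi> (g (\<phi> w))) analytic_on {z}"
    if *: "\<phi> \<in> parametrizations" "\<psi> \<in> parametrizations" "\<phi> z = p" "g p \<in> range \<psi>" for \<phi> \<psi> z
  proof -
    have "(\<lambda>w. inv \<psi> (f (\<phi> w))) analytic_on {z}"
      using hol_at_chart[of f \<phi> z \<psi>] * assms by metis
    moreover have "eventually (\<lambda>w. w \<in> \<phi> -` N) (nhds z)"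
      using assms * by (intro eventually_nhds_in_open open_param_vimage) auto
    ultimately show ?thesis
      by (subst analytic_at_cong[OF _ refl, of _ "\<lambda>w. inv \<psi> (f (\<phi> w))"])
        (auto elim!: eventually_mono simp: assms(4))
  qed
  ultimately show ?thesis unfolding hol_at_def by blast
qed

text \<open>The supply of holomorphic maps on the sphere: every planar analytic function, read
  between any two of the charts.\<close>

lemma hol_at_param:
  assumes h: "h analytic_on {z}" and \<phi>: "\<phi> \<in> parametrizations" and \<theta>: "\<theta> \<in> parametrizations"
  shows "hol_at (\<lambda>p. \<phi> (h (inv \<theta> p))) (\<theta> z)"
  unfolding hol_at_def
proof (intro conjI ballI allI impI)
  show "cont_at (\<lambda>p. \<phi> (h (inv \<theta> p))) (\<theta> z)"
    unfolding cont_at_def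
  proof (intro allI impI)
    fix V assume V: "openin rsphere_top V \<and> \<phi> (h (inv \<theta> (\<theta> z))) \<in> V"
    obtain A where A: "open A" "z \<in> A" "h holomorphic_on A"
      using h analytic_at by auto
    then have "open (A \<inter> h -` (\<phi> -` V))"
      using V \<phi> by (intro continuous_open_preimage holomorphic_on_imp_continuous_on open_param_vimage) auto
    then show "\<exists>N. openin rsphere_top N \<and> \<theta> z \<in> N \<and> (\<lambda>p. \<phi> (h (inv \<theta> p))) ` N \<subseteq> V"
      using V \<theta> A by (intro exI[of _ "\<theta> ` (A \<inter> h -` (\<phi> -` V))"]) (auto intro: openin_param_image)
  qed
  fix \<phi>' \<psi> z'
  assume *: "\<phi>' \<in> parametrizations" "\<psi> \<in> parametrizations" "\<phi>' z' = \<theta> z"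
    "\<phi> (h (inv \<theta> (\<theta> z))) \<in> range \<psi>"
  have 1: "(\<lambda>u. inv \<theta> (\<phi>' u)) analytic_on {z'}"
    using * \<theta> by (intro transition_analytic) auto
  have 2: "(\<lambda>u. inv \<psi> (\<phi> u)) analytic_on {h z}"
    using * \<theta> \<phi> by (intro transition_analytic) auto
  have "h \<circ> (\<lambda>u. inv \<theta> (\<phi>' u)) analytic_on {z'}"
    by (rule analytic_on_compose) (use 1 h * \<theta> in auto)
  then have "(\<lambda>u. inv \<psi> (\<phi> u)) \<circ> (h \<circ> (\<lambda>u. inv \<theta> (\<phi>' u))) analytic_on {z'}"
    by (rule analytic_on_compose) (use 2 * \<theta> in auto)
  then show "(\<lambda>w. inv \<psi> (\<phi> (h (inv \<theta> (\<phi>' w))))) analytic_on {z'}"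
    by (simp add: o_def)
qed

lemma hol_at_charts_obtain:
  assumes U: "openin rsphere_top U" and f: "\<And>p. p \<in> U \<Longrightarrow> hol_at f p" and p: "p \<in> U"
  obtains \<phi> \<psi> z A where "\<phi> \<in> parametrizations" "\<psi> \<in> parametrizations" "\<phi> z = p" "z \<in> A" "open A"
    "\<phi> ` A \<subseteq> U" "\<And>w. w \<in> A \<Longrightarrow> f (\<phi> w) = \<psi> (inv \<psi> (f (\<phi> w)))"
    "(\<lambda>w. inv \<psi> (f (\<phi> w))) holomorphic_on A"
proof -
  obtain \<phi> z where \<phi>: "\<phi> \<in> parametrizations" "\<phi> z = p" by (rule param_cover)
  obtain \<psi> y where \<psi>: "\<psi> \<in> parametrizations" "\<psi> y = f p" by (rule param_cover)
  define A where "A = \<phi> -` {p \<in> U. f p \<in> range \<psi>}"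
  have "open A"
    unfolding A_def
    by (intro open_param_vimage openin_cont_vimage U openin_range_param \<phi> \<psi>) (use f hol_at_def in auto)
  moreover have "z \<in> A" using \<phi> p \<psi>(2)[symmetric] by (simp add: A_def)
  moreover have "(\<lambda>w. inv \<psi> (f (\<phi> w))) analytic_on {w}" if "w \<in> A" for w
    by (rule hol_at_chart) (use that \<phi> \<psi> f in \<open>auto simp: A_def\<close>)
  then have "(\<lambda>w. inv \<psi> (f (\<phi> w))) holomorphic_on A"
    using \<open>open A\<close> by (metis analytic_on_analytic_at analytic_on_open)
  ultimately show ?thesis
    using \<phi> \<psi> by (intro that[of \<phi> \<psi> z A]) (auto simp: A_def f_inv_into_f)
qed

text \<open>In charts this is the planar fact that an injective holomorphic map is open with
  holomorphic inverse. Injectivity on all of \<open>U\<close> makes the local inverse agree with the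
  global one.\<close>

lemma inj_hol_local_inverse:
  assumes U: "openin rsphere_top U" and f: "\<And>p. p \<in> U \<Longrightarrow> hol_at f p" and inj: "inj_on f U" and p: "p \<in> U"
  obtains B where "openin rsphere_top B" "f p \<in> B" "B \<subseteq> f ` U" "hol_at (the_inv_into U f) (f p)"
proof -
  obtain \<phi> \<psi> z A where A: "\<phi> \<in> parametrizations" "\<psi> \<in> parametrizations" "\<phi> z = p" "z \<in> A" "open A"
    "\<phi> ` A \<subseteq> U" "\<And>w. w \<in> A \<Longrightarrow> f (\<phi> w) = \<psi> (inv \<psi> (f (\<phi> w)))"
    "(\<lambda>w. inv \<psi> (f (\<phi> w))) holomorphic_on A"
    using hol_at_charts_obtain[OF U f p] by metis
  define h where "h = (\<lambda>w. inv \<psi> (f (\<phi> w)))"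
  have fh: "f (\<phi> w) = \<psi> (h w)" if "w \<in> A" for w using A that by (simp add: h_def)
  have hA: "h holomorphic_on A" using A by (simp add: h_def)
  have injh: "inj_on h A"
  proof (rule inj_onI)
    fix u v assume uv: "u \<in> A" "v \<in> A" "h u = h v"
    then have "f (\<phi> u) = f (\<phi> v)" by (simp add: fh)
    then have "\<phi> u = \<phi> v" using inj_onD[OF inj] uv A(6) by blast
    then show "u = v" using A(1) inj_parametrization by (metis injD)
  qed
  obtain g where g: "g holomorphic_on (h ` A)" "\<And>w. w \<in> A \<Longrightarrow> g (h w) = w"
    using holomorphic_has_inverse[OF hA \<open>open A\<close> injh] by metis
  have op: "open (h ` A)" using open_mapping_thm3[OF hA \<open>open A\<close> injh] .
  define B where "B = \<psi> ` (h ` A)"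
  have oB: "openin rsphere_top B" using openin_param_image[OF A(2) op] by (simp add: B_def)
  have pB: "f p \<in> B" using fh[OF A(4)] A(3,4) by (auto simp: B_def)
  have "hol_at (\<lambda>q. \<phi> (g (inv \<psi> q))) (\<psi> (h z))"
    by (rule hol_at_param)
      (use A g op in \<open>auto simp: analytic_on_open intro: analytic_on_subset[of _ "h ` A"]\<close>)
  then have "hol_at (the_inv_into U f) (f p)"
    unfolding fh[OF A(4), unfolded A(3), symmetric]
  proof (rule hol_at_cong[OF _ oB pB])
    fix x assume "x \<in> B"
    then obtain w where w: "w \<in> A" "x = \<psi> (h w)" by (auto simp: B_def)
    then have "the_inv_into U f x = \<phi> w"
      by (metis A(6) fh image_subset_iff inj the_inv_into_f_f)
    then show "\<phi> (g (inv \<psi> x)) = the_inv_into U f x" using w A g by simp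
  qed
  moreover have "B \<subseteq> f ` U" using fh A(6) by (force simp: B_def)
  ultimately show ?thesis using that oB pB by blast
qed

lemma inj_hol_open_image:
  assumes "openin rsphere_top U" "\<And>p. p \<in> U \<Longrightarrow> hol_at f p" "inj_on f U"
  shows "openin rsphere_top (f ` U)"
proof (subst openin_subopen, intro ballI)
  fix y assume "y \<in> f ` U"
  then obtain p where "p \<in> U" "y = f p" by blast
  with inj_hol_local_inverse[OF assms this(1)] show "\<exists>T. openin rsphere_top T \<and> y \<in> T \<and> T \<subseteq> f ` U"
    by metis
qed

text \<open>All disks below are constructed through this lemma: holomorphy and injectivity suffice,
  the holomorphic inverse comes for free.\<close>

lemma conformal_iso_image:
  assumes "openin rsphere_top U" "\<And>p. p \<in> U \<Longrightarrow> hol_at f p" "inj_on f U"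
  shows "conformal_iso f U (f ` U)"
proof -
  have "hol_at (the_inv_into U f) y" if "y \<in> f ` U" for y
    using that inj_hol_local_inverse[OF assms] by blast
  then show ?thesis
    using assms inj_hol_open_image[OF assms]
    by (auto simp: conformal_iso_def bij_betw_def holo_on_iff)
qed

lemma openin_unit_disk: "openin rsphere_top unit_disk"
  by (intro openin_param_image Some_param) auto

lemma conformal_isoD:
  assumes "conformal_iso f U V" "openin rsphere_top U"
  shows "inj_on f U" "f ` U = V" "openin rsphere_top V" "\<And>p. p \<in> U \<Longrightarrow> hol_at f p"
    "\<And>q. q \<in> V \<Longrightarrow> hol_at (the_inv_into U f) q"
proof -
  show *: "inj_on f U" "f ` U = V" using assms by (auto simp: conformal_iso_def bij_betw_def)
  show **: "\<And>p. p \<in> U \<Longrightarrow> hol_at f p" using assms holo_on_iff by (auto simp: conformal_iso_def)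
  show o: "openin rsphere_top V" using inj_hol_open_image[OF assms(2) ** *(1)] *(2) by simp
  show "\<And>q. q \<in> V \<Longrightarrow> hol_at (the_inv_into U f) q"
    using assms holo_on_iff[OF o] by (auto simp: conformal_iso_def)
qed

section \<open>Power maps of the disk\<close>

lemma power_image_disc:
  assumes "1 \<le> t"
  shows "(\<lambda>z::complex. z ^ t) ` ball 0 1 = ball 0 1"
proof
  show "(\<lambda>z::complex. z ^ t) ` ball 0 1 \<subseteq> ball 0 1"
    using assms by (auto simp: norm_power power_less_one_iff)
  show "ball 0 1 \<subseteq> (\<lambda>z::complex. z ^ t) ` ball 0 1"
  proof
    fix w :: complex assume w: "w \<in> ball 0 1"
    obtain z where z: "z ^ t = w"
      using assms exists_complex_root[of t w] by (metis not_one_le_zero)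
    then have "norm z < 1"
      using w assms by (metis dist_0_norm mem_ball norm_power not_less one_le_power)
    then show "w \<in> (\<lambda>z. z ^ t) ` ball 0 1" using z by auto
  qed
qed

lemma power_not_inj_near_0:
  assumes "2 \<le> t" "0 < r"
  obtains u v :: complex where "u \<in> ball 0 r" "v \<in> ball 0 r" "u \<noteq> v" "u ^ t = v ^ t"
proof -
  have c: "card {z::complex. z ^ t = 1} = t" using assms by (intro card_roots_unity_eq) auto
  have "\<not> {z::complex. z ^ t = 1} \<subseteq> {1}"
  proof
    assume "{z::complex. z ^ t = 1} \<subseteq> {1}"
    then have "card {z::complex. z ^ t = 1} \<le> card {1::complex}" by (intro card_mono) auto
    then show False using c assms by simp
  qed
  \<comment> \<open>Multiplication by a nontrivial \<open>t\<close>-th root of unity preserves both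
    the norm and the \<open>t\<close>-th power; \<open>r/2\<close> below is just some nonzero point
    of the ball to rotate.\<close>
  then obtain \<zeta> :: complex where z: "\<zeta> ^ t = 1" "\<zeta> \<noteq> 1" by auto
  then have n: "norm \<zeta> = 1" using assms by (metis norm_one norm_power power_eq_1_iff norm_ge_zero
        abs_of_nonneg not_numeral_le_zero)
  show ?thesis
  proof (rule that)
    define c :: complex where "c = of_real (r/2)"
    have "norm c = r/2" using assms by (simp add: c_def)
    then show "c \<in> ball 0 r" "\<zeta> * c \<in> ball 0 r" "c \<noteq> \<zeta> * c" "c ^ t = (\<zeta> * c) ^ t"
      using z n assms by (auto simp: norm_mult power_mult_distrib)
  qed
qed

lemma power_locally_inj:
  assumes "q \<noteq> (0::complex)" "1 \<le> t" "open A" "q \<in> A"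
  obtains r where "0 < r" "ball q r \<subseteq> A" "inj_on (\<lambda>z. z ^ t) (ball q r)"
proof (rule has_complex_derivative_locally_injective[of "\<lambda>z::complex. z ^ t" A q])
  have "((\<lambda>z. z ^ t) has_field_derivative of_nat t * q ^ (t - 1)) (at q)"
    by (auto intro!: derivative_eq_intros)
  then have "deriv (\<lambda>z. z ^ t) q = of_nat t * q ^ (t - 1)" by (rule DERIV_imp_deriv)
  then show "deriv (\<lambda>z. z ^ t) q \<noteq> 0" using assms by simp
qed (use assms that in \<open>auto intro: holomorphic_intros\<close>)

text \<open>
  At the branch point, the lift of \<open>h\<close> through \<open>z \<mapsto> z ^ t\<close> is \<open>k z = z * (h (z ^ t) / z ^ t) powr (1 / t)\<close>;
  elsewhere it is a branch of the \<open>t\<close>-th root of \<open>h\<close>.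
\<close>

lemma power_lift:
  fixes q :: complex
  assumes q: "q \<in> A" and t: "1 \<le> t" and A: "open A"
  obtains B where "open B" "q ^ t \<in> B"
    "\<And>h. h holomorphic_on ball 0 1 \<Longrightarrow> inj_on h (ball 0 1) \<Longrightarrow> h 0 = q ^ t \<Longrightarrow> h ` ball 0 1 \<subseteq> B \<Longrightarrow>
      \<exists>k s. k holomorphic_on ball 0 1 \<and> inj_on k (ball 0 1) \<and> k 0 = q \<and> k ` ball 0 1 \<subseteq> A \<and>
        1 \<le> s \<and> s \<le> t \<and> (\<forall>z\<in>ball 0 1. k z ^ t = h (z ^ s))"
proof (cases "q = 0")
  case True
  obtain r where r: "r > 0" "ball 0 r \<subseteq> A" using A q True by (meson openE)
  show ?thesis
  \<comment> \<open>All \<open>t\<close>-th roots of points in this ball lie in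
    \<open>ball 0 r\<close>, which keeps the lift inside \<open>A\<close>.\<close>
  proof (rule that[of "ball 0 (r ^ t)"])
    show "q ^ t \<in> ball 0 (r ^ t)" using r t True by (simp add: power_0_left)
    fix h assume h: "h holomorphic_on ball 0 1" "inj_on h (ball 0 1)" "h 0 = q ^ t"
      "h ` ball 0 1 \<subseteq> ball 0 (r ^ t)"
    have h0: "h 0 = 0" using h True t by (simp add: power_0_left)
    \<comment> \<open>The quotient \<open>h z / z\<close> with its singularity at \<open>0\<close>
      removed. Injectivity of \<open>h\<close> makes it free of zeros, including at
      \<open>0\<close>, where its value is \<open>deriv h 0\<close>; hence it has a logarithm on the
      disk.\<close>
    define m where "m z = (if z = 0 then deriv h 0 else h z / z)" for z
    have hm: "h z = z * m z" for z using h0 by (simp add: m_def)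
    have m: "m holomorphic_on ball 0 1"
      by (rule pole_theorem_open_0[of h _ 0]) (use h h0 in \<open>auto simp: m_def\<close>)
    have "m z \<noteq> 0" if "z \<in> ball 0 1" for z
    proof (cases "z = 0")
      case True
      then show ?thesis
        using holomorphic_injective_imp_regular[OF h(1) _ h(2), of 0] by (simp add: m_def)
    next
      case False
      then have "h z \<noteq> h 0" using inj_onD[OF h(2)] that by auto
      then show ?thesis using False h0 by (simp add: m_def)
    qed
    then obtain l where l: "l holomorphic_on ball 0 1" "\<And>z. z \<in> ball 0 1 \<Longrightarrow> m z = exp (l z)"
      using contractible_imp_holomorphic_log[OF m] convex_imp_contractible[of "ball 0 1"] by auto
    define k where "k z = z * exp (l (z ^ t) / of_nat t)" for z
    have pw: "z ^ t \<in> ball 0 1" if "z \<in> ball 0 1" for z :: complex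
      using that power_image_disc[OF t] by blast
    have kt: "k z ^ t = h (z ^ t)" if "z \<in> ball 0 1" for z
    proof -
      have "exp (l (z ^ t) / of_nat t) ^ t = exp (l (z ^ t))"
        using t by (simp add: exp_of_nat_mult[symmetric])
      then show ?thesis
        using l(2)[OF pw[OF that]] by (simp add: k_def power_mult_distrib hm[of "z ^ t"])
    qed
    have "l \<circ> (\<lambda>z. z ^ t) holomorphic_on ball 0 1"
      by (rule holomorphic_on_compose_gen[OF _ l(1)]) (use pw in \<open>auto intro: holomorphic_intros\<close>)
    then have "k holomorphic_on ball 0 1"
      unfolding k_def o_def by (intro holomorphic_intros) (use t in auto)
    moreover have "inj_on k (ball 0 1)"
    proof (rule inj_onI)
      fix z w assume zw: "z \<in> ball 0 1" "w \<in> ball 0 1" "k z = k w"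
      then have "h (z ^ t) = h (w ^ t)" using kt by metis
      then have "z ^ t = w ^ t" using inj_onD[OF h(2)] zw pw by blast
      \<comment> \<open>The exponential factor of \<open>k\<close> depends only on
        \<open>z ^ t\<close>, so it is the same for both points and cancels.\<close>
      then show "z = w" using zw(3) by (simp add: k_def)
    qed
    moreover have "k ` ball 0 1 \<subseteq> ball 0 r"
    proof
      fix y assume "y \<in> k ` ball 0 1"
      then obtain z where z: "z \<in> ball 0 1" "y = k z" by blast
      then have "h (z ^ t) \<in> ball 0 (r ^ t)" using h(4) pw by blast
      then have "norm (k z) ^ t < r ^ t" using kt[OF z(1)] by (simp add: norm_power[symmetric])
      then show "y \<in> ball 0 r" using z r by (simp add: power_less_imp_less_base)
    qed
    moreover have "k 0 = q" using True by (simp add: k_def)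
    ultimately show "\<exists>k s. k holomorphic_on ball 0 1 \<and> inj_on k (ball 0 1) \<and> k 0 = q \<and> k ` ball 0 1 \<subseteq> A \<and>
        1 \<le> s \<and> s \<le> t \<and> (\<forall>z\<in>ball 0 1. k z ^ t = h (z ^ s))"
      using kt t r(2) by (intro exI[of _ k] exI[of _ t]) auto
  qed simp
next
  case False
  then obtain r where r: "0 < r" "ball q r \<subseteq> A" "inj_on (\<lambda>z. z ^ t) (ball q r)"
    using power_locally_inj[OF False t A q] by blast
  have p: "(\<lambda>z. z ^ t) holomorphic_on ball q r" by (intro holomorphic_intros)
  obtain g where g: "g holomorphic_on (\<lambda>z. z ^ t) ` ball q r" "\<And>z. z \<in> ball q r \<Longrightarrow> g (z ^ t) = z"
    using holomorphic_has_inverse[OF p open_ball r(3)] by metis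
  show ?thesis
  proof (rule that[of "(\<lambda>z. z ^ t) ` ball q r"])
    show "open ((\<lambda>z. z ^ t) ` ball q r)" by (rule open_mapping_thm3[OF p open_ball r(3)])
    show "q ^ t \<in> (\<lambda>z. z ^ t) ` ball q r" using r by auto
    fix h assume h: "h holomorphic_on ball 0 1" "inj_on h (ball 0 1)" "h 0 = q ^ t"
      "h ` ball 0 1 \<subseteq> (\<lambda>z. z ^ t) ` ball q r"
    have gk: "g (h z) \<in> ball q r \<and> g (h z) ^ t = h z" if "z \<in> ball 0 1" for z
    proof -
      have "h z \<in> (\<lambda>z. z ^ t) ` ball q r" using h(4) that by blast
      then obtain u where "u \<in> ball q r" "h z = u ^ t" by blast
      then show ?thesis using g(2)[of u] by simp
    qed
    have "g \<circ> h holomorphic_on ball 0 1"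
      by (rule holomorphic_on_compose_gen[OF h(1) g(1)]) (use h(4) in auto)
    moreover have "inj_on (g \<circ> h) (ball 0 1)"
      using gk h(2) unfolding inj_on_def o_def by metis
    moreover have "(g \<circ> h) 0 = q" using g(2)[of q] r h(3) by simp
    moreover have "(g \<circ> h) ` ball 0 1 \<subseteq> A" using gk r by auto
    ultimately show "\<exists>k s. k holomorphic_on ball 0 1 \<and> inj_on k (ball 0 1) \<and> k 0 = q \<and> k ` ball 0 1 \<subseteq> A \<and>
        1 \<le> s \<and> s \<le> t \<and> (\<forall>z\<in>ball 0 1. k z ^ t = h (z ^ s))"
      using gk t by (intro exI[of _ "g \<circ> h"] exI[of _ 1]) auto
  qed
qed

text \<open>Properness of \<open>z ^ t\<close> as a self-map of the disk: closed disks of radius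
  below 1 have compact preimages in the open disk.\<close>

lemma compact_power_sublevel:
  assumes "1 \<le> t" "r < 1"
  shows "compact {z::complex. norm z ^ t \<le> r}" "{z::complex. norm z ^ t \<le> r} \<subseteq> ball 0 1"
proof -
  have "norm z < 1" if "norm z ^ t \<le> r" for z :: complex
    using that assms one_le_power[of "norm z" t] by linarith
  then show "{z::complex. norm z ^ t \<le> r} \<subseteq> ball 0 1" by auto
  then have "bounded {z::complex. norm z ^ t \<le> r}" by (rule bounded_subset[OF bounded_ball])
  moreover have "closed {z::complex. norm z ^ t \<le> r}"
    by (intro closed_Collect_le continuous_intros)
  ultimately show "compact {z::complex. norm z ^ t \<le> r}" by (simp add: compact_eq_bounded_closed)
qed

section \<open>Critical points and local injectivity\<close>

text \<open>In one complex variable the derivative is nonzero exactly where the function is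
  injective nearby. Since injectivity mentions no charts, vanishing of the derivative does not
  depend on them.\<close>

lemma deriv_eq_0_iff:
  assumes U: "openin rsphere_top U" "\<And>p. p \<in> U \<Longrightarrow> hol_at f p" and c: "c \<in> U"
    and \<phi>: "\<phi> \<in> parametrizations" "\<phi> z = c" and \<psi>: "\<psi> \<in> parametrizations" "f c \<in> range \<psi>"
  shows "deriv (\<lambda>w. inv \<psi> (f (\<phi> w))) z = 0 \<longleftrightarrow>
    (\<forall>N. openin rsphere_top N \<and> c \<in> N \<longrightarrow> \<not> inj_on f N)"
proof -
  define h where "h = (\<lambda>w. inv \<psi> (f (\<phi> w)))"
  define A where "A = \<phi> -` {p \<in> U. f p \<in> range \<psi>}"
  have "openin rsphere_top {p \<in> U. f p \<in> range \<psi>}"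
    by (intro openin_cont_vimage openin_range_param U \<psi> hol_at_imp_cont_at)
  then have A: "open A" unfolding A_def by (rule open_param_vimage[OF \<phi>(1)])
  have zA: "z \<in> A" using c \<phi>(2) \<psi>(2) by (simp add: A_def)
  have fh: "f (\<phi> w) = \<psi> (h w)" if "w \<in> A" for w
    using that by (simp add: A_def h_def f_inv_into_f)
  have "h analytic_on {w}" if "w \<in> A" for w
    unfolding h_def by (rule hol_at_chart) (use that \<phi> \<psi> U in \<open>auto simp: A_def\<close>)
  then have h: "h holomorphic_on A"
    using A by (metis analytic_on_analytic_at analytic_on_open)
  have inj\<phi>: "inj \<phi>" and inj\<psi>: "inj \<psi>" using \<phi> \<psi> inj_parametrization by auto
  show ?thesis
  proof
    assume d: "deriv (\<lambda>w. inv \<psi> (f (\<phi> w))) z = 0"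
    show "\<forall>N. openin rsphere_top N \<and> c \<in> N \<longrightarrow> \<not> inj_on f N"
    proof (intro allI impI notI)
      fix N assume N: "openin rsphere_top N \<and> c \<in> N" "inj_on f N"
      have "inj_on h (A \<inter> \<phi> -` N)"
      proof (rule inj_onI)
        fix u v assume uv: "u \<in> A \<inter> \<phi> -` N" "v \<in> A \<inter> \<phi> -` N" "h u = h v"
        then have "f (\<phi> u) = f (\<phi> v)" using fh by simp
        then have "\<phi> u = \<phi> v" using inj_onD[OF N(2)] uv by auto
        then show "u = v" using inj\<phi> by (simp add: inj_eq)
      qed
      moreover have "open (A \<inter> \<phi> -` N)" using A N \<phi> by (intro open_Int open_param_vimage) auto
      ultimately have "deriv h z \<noteq> 0"
        using holomorphic_injective_imp_regular[of h "A \<inter> \<phi> -` N" z] h A zA N \<phi>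
        by (auto intro: holomorphic_on_subset)
      with d show False by (simp add: h_def)
    qed
  next
    assume N: "\<forall>N. openin rsphere_top N \<and> c \<in> N \<longrightarrow> \<not> inj_on f N"
    show "deriv (\<lambda>w. inv \<psi> (f (\<phi> w))) z = 0"
    proof (rule ccontr)
      assume "deriv (\<lambda>w. inv \<psi> (f (\<phi> w))) z \<noteq> 0"
      then have "deriv h z \<noteq> 0" by (simp add: h_def)
      then obtain r where r: "0 < r" "ball z r \<subseteq> A" "inj_on h (ball z r)"
        by (rule has_complex_derivative_locally_injective[OF h zA A])
      have "inj_on f (\<phi> ` ball z r)"
      proof (rule inj_onI)
        fix p q assume pq: "p \<in> \<phi> ` ball z r" "q \<in> \<phi> ` ball z r" "f p = f q"
        obtain u where u: "u \<in> ball z r" "p = \<phi> u" using pq(1) by (rule imageE)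
        obtain v where v: "v \<in> ball z r" "q = \<phi> v" using pq(2) by (rule imageE)
        have "u \<in> A" "v \<in> A" using u(1) v(1) r(2) by blast+
        then have "\<psi> (h u) = \<psi> (h v)" using fh[of u] fh[of v] pq(3) u v by simp
        then have "h u = h v" using inj\<psi> by (simp add: inj_eq)
        then have "u = v" using inj_onD[OF r(3) _ u(1) v(1)] by simp
        then show "p = q" using u v by simp
      qed
      moreover have "openin rsphere_top (\<phi> ` ball z r)" by (intro openin_param_image \<phi>) auto
      moreover have "c \<in> \<phi> ` ball z r" using r \<phi> by auto
      ultimately show False using N by blast
    qed
  qed
qed

text \<open>This form allows critical points to be detected in the coordinates of a power model,
  which are not standard charts.\<close>

lemma critical_point_iff:
  assumes "openin rsphere_top U" "\<And>p. p \<in> U \<Longrightarrow> hol_at f p" "c \<in> U"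
  shows "critical_point f c \<longleftrightarrow> (\<forall>N. openin rsphere_top N \<and> c \<in> N \<longrightarrow> \<not> inj_on f N)"
proof
  assume "critical_point f c"
  then show "\<forall>N. openin rsphere_top N \<and> c \<in> N \<longrightarrow> \<not> inj_on f N"
    unfolding critical_point_def using deriv_eq_0_iff[OF assms] by metis
next
  assume N: "\<forall>N. openin rsphere_top N \<and> c \<in> N \<longrightarrow> \<not> inj_on f N"
  obtain \<phi> z where \<phi>: "\<phi> \<in> parametrizations" "\<phi> z = c" by (rule param_cover)
  obtain \<psi> y where \<psi>: "\<psi> \<in> parametrizations" "\<psi> y = f c" by (rule param_cover)
  then have "f c \<in> range \<psi>" by (metis rangeI)
  then show "critical_point f c"
    unfolding critical_point_def using deriv_eq_0_iff[OF assms \<phi> \<psi>(1)] N \<phi> \<psi>(1) by metis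
qed

section \<open>Conformal disks\<close>

lemma disc_continuous:
  assumes "conformal_iso \<phi> unit_disk W"
  shows "continuous_map (top_of_set (ball 0 1)) rsphere_top (\<lambda>z. \<phi> (Some z))"
proof -
  have "continuous_map euclidean rsphere_top Some"
    by (simp add: rsphere_top_def continuous_map_Some)
  then have "continuous_map (top_of_set (ball 0 1)) (subtopology rsphere_top unit_disk) Some"
    by (auto simp: continuous_map_in_subtopology intro: continuous_map_from_subtopology)
  moreover have "continuous_map (subtopology rsphere_top unit_disk) rsphere_top \<phi>"
    using assms by (simp add: conformal_iso_def holo_on_def)
  ultimately show ?thesis by (metis (no_types, lifting) continuous_map_compose continuous_map_eq comp_apply)
qed

lemma disc_vimage_open:
  assumes "conformal_iso \<phi> unit_disk W" "openin rsphere_top N"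
  shows "open {z \<in> ball 0 1. \<phi> (Some z) \<in> N}"
  using openin_continuous_map_preimage[OF disc_continuous[OF assms(1)] assms(2)]
  by (simp add: openin_open_eq)

lemma disc_image_compact:
  assumes "conformal_iso \<phi> unit_disk W" "compact K" "K \<subseteq> ball 0 1"
  shows "compactin rsphere_top ((\<lambda>z. \<phi> (Some z)) ` K)"
  using assms by (intro image_compactin[OF _ disc_continuous[OF assms(1)]])
    (auto simp: compactin_subtopology)

lemma disc_image_connected:
  assumes "conformal_iso \<phi> unit_disk W"
  shows "connectedin rsphere_top W"
proof -
  have "connectedin rsphere_top ((\<lambda>z. \<phi> (Some z)) ` ball 0 1)"
    by (intro connectedin_continuous_map_image[OF disc_continuous[OF assms]])
      (auto simp: connectedin_subtopology)
  moreover have "(\<lambda>z. \<phi> (Some z)) ` ball 0 1 = W"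
    using conformal_isoD(2)[OF assms openin_unit_disk] by (simp add: image_image)
  ultimately show ?thesis by simp
qed

lemma disc_eq_iff:
  assumes "conformal_iso \<phi> unit_disk W" "z \<in> ball 0 1" "w \<in> ball 0 1"
  shows "\<phi> (Some z) = \<phi> (Some w) \<longleftrightarrow> z = w"
  using inj_onD[OF conformal_isoD(1)[OF assms(1) openin_unit_disk], of "Some z" "Some w"] assms by blast

lemma disc_cases:
  assumes "conformal_iso \<phi> unit_disk W" "p \<in> W"
  obtains z where "z \<in> ball 0 1" "p = \<phi> (Some z)"
  using conformal_isoD(2)[OF assms(1) openin_unit_disk] assms(2) that by blast

lemma disc_mem:
  assumes "conformal_iso \<phi> unit_disk W" "z \<in> ball 0 1"
  shows "\<phi> (Some z) \<in> W"
  using conformal_isoD(2)[OF assms(1) openin_unit_disk] assms(2) by blast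

lemma hol_at_Some: "k analytic_on {z} \<Longrightarrow> hol_at (\<lambda>p. Some (k (inv Some p))) (Some z)"
  by (rule hol_at_param) (auto simp: Some_param)

lemma disc_compose:
  assumes \<phi>: "conformal_iso \<phi> unit_disk W"
    and k: "k holomorphic_on ball 0 1" "inj_on k (ball 0 1)" "k ` ball 0 1 \<subseteq> ball 0 1"
  shows "conformal_iso (\<lambda>p. \<phi> (Some (k (inv Some p)))) unit_disk ((\<lambda>z. \<phi> (Some (k z))) ` ball 0 1)"
proof -
  have "conformal_iso (\<lambda>p. \<phi> (Some (k (inv Some p)))) unit_disk
      ((\<lambda>p. \<phi> (Some (k (inv Some p)))) ` unit_disk)"
  proof (rule conformal_iso_image[OF openin_unit_disk])
    fix p assume "p \<in> unit_disk"
    then obtain z where z: "p = Some z" "z \<in> ball 0 1" by blast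
    have "k analytic_on {z}" using k(1) z by (metis analytic_at open_ball)
    then have "hol_at (\<lambda>p. Some (k (inv Some p))) p" using hol_at_Some z by simp
    moreover have "Some (k (inv Some p)) \<in> unit_disk" using z k(3) by (auto simp: image_subset_iff)
    ultimately show "hol_at (\<lambda>p. \<phi> (Some (k (inv Some p)))) p"
      by (rule hol_at_compose[where g = \<phi>, OF _ conformal_isoD(4)[OF \<phi> openin_unit_disk]])
  next
    show "inj_on (\<lambda>p. \<phi> (Some (k (inv Some p)))) unit_disk"
    proof (rule inj_onI)
      fix p q assume pq: "p \<in> unit_disk" "q \<in> unit_disk"
        "\<phi> (Some (k (inv Some p))) = \<phi> (Some (k (inv Some q)))"
      then obtain z w where zw: "p = Some z" "q = Some w" "z \<in> ball 0 1" "w \<in> ball 0 1" by blast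
      then have "k z = k w" using pq(3) disc_eq_iff[OF \<phi>] k(3) by (auto simp: image_subset_iff)
      then show "p = q" using zw inj_onD[OF k(2)] by blast
    qed
  qed
  then show ?thesis by (simp add: image_image)
qed

text \<open>Expressing a smaller disk in the coordinate of a larger one turns lifting problems on
  the sphere into problems about functions on the planar unit disk.\<close>

lemma disc_coordinate:
  assumes \<psi>: "conformal_iso \<psi> unit_disk V" and \<rho>: "conformal_iso \<rho> unit_disk V'" and "V' \<subseteq> V"
  obtains h where "h holomorphic_on ball 0 1" "inj_on h (ball 0 1)" "h ` ball 0 1 \<subseteq> ball 0 1"
    "\<And>z. z \<in> ball 0 1 \<Longrightarrow> \<psi> (Some (h z)) = \<rho> (Some z)"
proof -
  define H where "H = (\<lambda>p. the_inv_into unit_disk \<psi> (\<rho> p))"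
  define h where "h z = inv Some (H (Some z))" for z
  have H: "H (Some z) \<in> unit_disk \<and> \<psi> (H (Some z)) = \<rho> (Some z) \<and> hol_at H (Some z)"
    if z: "z \<in> ball 0 1" for z
  proof -
    have \<rho>V: "\<rho> (Some z) \<in> V" using disc_mem[OF \<rho> z] assms(3) by blast
    then have "\<rho> (Some z) \<in> \<psi> ` unit_disk" using conformal_isoD(2)[OF \<psi> openin_unit_disk] by simp
    then have "H (Some z) \<in> unit_disk \<and> \<psi> (H (Some z)) = \<rho> (Some z)"
      unfolding H_def using conformal_isoD(1)[OF \<psi> openin_unit_disk]
      by (simp add: the_inv_into_into f_the_inv_into_f del: image_eqI)
    moreover have "hol_at H (Some z)"
      unfolding H_def
      by (rule hol_at_compose) (use conformal_isoD[OF \<rho> openin_unit_disk] conformal_isoD[OF \<psi> openin_unit_disk] z \<rho>V in auto)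
    ultimately show ?thesis by blast
  qed
  then have Hh: "H (Some z) = Some (h z)" "h z \<in> ball 0 1" if "z \<in> ball 0 1" for z
    using that unfolding h_def by force+
  have "h analytic_on {z}" if "z \<in> ball 0 1" for z
    unfolding h_def by (rule hol_at_chart) (use H that Some_param in auto)
  then have "h holomorphic_on ball 0 1"
    by (metis analytic_on_analytic_at analytic_imp_holomorphic)
  moreover have "\<psi> (Some (h z)) = \<rho> (Some z)" if "z \<in> ball 0 1" for z
    using H Hh that by metis
  moreover have "inj_on h (ball 0 1)"
    using disc_eq_iff[OF \<rho>] calculation(2) by (metis inj_onI)
  ultimately show ?thesis using that Hh by blast
qed

lemma disc_image_open:
  assumes \<psi>: "conformal_iso \<psi> unit_disk V" and "open A" "A \<subseteq> ball 0 1"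
  shows "openin rsphere_top ((\<lambda>z. \<psi> (Some z)) ` A)"
proof -
  have "openin rsphere_top (\<psi> ` (Some ` A))"
    using assms conformal_isoD[OF \<psi> openin_unit_disk]
    by (intro inj_hol_open_image openin_param_image Some_param) (auto intro: inj_on_subset)
  then show ?thesis by (simp add: image_image)
qed

section \<open>Lifting small disks\<close>

text \<open>This is \<open>power_lift\<close> transported to the sphere. It matters that the disk is
  centred at \<open>f p\<close>: if \<open>p\<close> is the branch point, the lift is again a disk
  with a power map only because the branch value sits at the centre. The neighbourhood
  \<open>N\<close> is chosen before the disk, so that the step can be iterated.\<close>

lemma power_model_lift:
  assumes pm: "power_model f t \<phi> W \<psi> V" and t: "1 \<le> t" and p: "p \<in> W"
    and N': "openin rsphere_top N'" "p \<in> N'"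
  obtains N where "openin rsphere_top N" "f p \<in> N"
    "\<And>\<rho> V'. conformal_iso \<rho> unit_disk V' \<Longrightarrow> \<rho> (Some 0) = f p \<Longrightarrow> V' \<subseteq> N \<Longrightarrow>
      \<exists>\<sigma> W' s. conformal_iso \<sigma> unit_disk W' \<and> \<sigma> (Some 0) = p \<and> W' \<subseteq> N' \<inter> W \<and> 1 \<le> s \<and> s \<le> t \<and>
        (\<forall>z\<in>ball 0 1. f (\<sigma> (Some z)) = \<rho> (Some (z ^ s)))"
proof -
  have \<phi>: "conformal_iso \<phi> unit_disk W" and \<psi>: "conformal_iso \<psi> unit_disk V"
    and f: "\<And>z. z \<in> ball 0 1 \<Longrightarrow> f (\<phi> (Some z)) = \<psi> (Some (z ^ t))"
    using pm by (auto simp: power_model_def)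
  obtain q where q: "q \<in> ball 0 1" "p = \<phi> (Some q)" using disc_cases[OF \<phi> p] .
  define A where "A = {z \<in> ball 0 1. \<phi> (Some z) \<in> N'}"
  have A: "open A" "q \<in> A" using disc_vimage_open[OF \<phi> N'(1)] q N'(2) by (auto simp: A_def)
  obtain B where B: "open B" "q ^ t \<in> B"
    "\<And>h. h holomorphic_on ball 0 1 \<Longrightarrow> inj_on h (ball 0 1) \<Longrightarrow> h 0 = q ^ t \<Longrightarrow> h ` ball 0 1 \<subseteq> B \<Longrightarrow>
      \<exists>k s. k holomorphic_on ball 0 1 \<and> inj_on k (ball 0 1) \<and> k 0 = q \<and> k ` ball 0 1 \<subseteq> A \<and>
        1 \<le> s \<and> s \<le> t \<and> (\<forall>z\<in>ball 0 1. k z ^ t = h (z ^ s))"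
    using power_lift[OF A(2) t A(1)] by metis
  have qt: "z ^ t \<in> ball 0 1" if "z \<in> ball 0 1" for z :: complex
    using power_image_disc[OF t] that by blast
  show ?thesis
  proof (rule that[of "(\<lambda>z. \<psi> (Some z)) ` (B \<inter> ball 0 1)"])
    show "openin rsphere_top ((\<lambda>z. \<psi> (Some z)) ` (B \<inter> ball 0 1))"
      using B by (intro disc_image_open[OF \<psi>]) auto
    show "f p \<in> (\<lambda>z. \<psi> (Some z)) ` (B \<inter> ball 0 1)" using f q qt B by simp
    fix \<rho> V' assume \<rho>: "conformal_iso \<rho> unit_disk V'" "\<rho> (Some 0) = f p"
      "V' \<subseteq> (\<lambda>z. \<psi> (Some z)) ` (B \<inter> ball 0 1)"
    have "V' \<subseteq> V" using \<rho>(3) disc_mem[OF \<psi>] by blast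
    then obtain h where h: "h holomorphic_on ball 0 1" "inj_on h (ball 0 1)" "h ` ball 0 1 \<subseteq> ball 0 1"
      "\<And>z. z \<in> ball 0 1 \<Longrightarrow> \<psi> (Some (h z)) = \<rho> (Some z)"
      using disc_coordinate[OF \<psi> \<rho>(1)] by metis
    have "\<psi> (Some (h 0)) = \<psi> (Some (q ^ t))" using h(4)[of 0] \<rho>(2) f q by simp
    then have "h 0 = q ^ t"
      using disc_eq_iff[OF \<psi>] h(3) qt[OF q(1)] by (metis centre_in_ball image_subset_iff zero_less_one)
    moreover have "h ` ball 0 1 \<subseteq> B"
    proof
      fix y assume "y \<in> h ` ball 0 1"
      then obtain z where z: "z \<in> ball 0 1" "y = h z" by blast
      then have "\<psi> (Some (h z)) \<in> (\<lambda>z. \<psi> (Some z)) ` (B \<inter> ball 0 1)"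
        using h(4) \<rho>(3) disc_mem[OF \<rho>(1)] by auto
      then obtain b where b: "b \<in> B" "b \<in> ball 0 1" "\<psi> (Some (h z)) = \<psi> (Some b)" by blast
      then have "h z = b" using disc_eq_iff[OF \<psi>, of "h z" b] h(3) z by blast
      then show "y \<in> B" using b z by simp
    qed
    ultimately obtain k s where k: "k holomorphic_on ball 0 1" "inj_on k (ball 0 1)" "k 0 = q"
      "k ` ball 0 1 \<subseteq> A" "1 \<le> s" "s \<le> t" "\<And>z. z \<in> ball 0 1 \<Longrightarrow> k z ^ t = h (z ^ s)"
      using B(3)[OF h(1,2)] by metis
    have kA: "k z \<in> ball 0 1" "\<phi> (Some (k z)) \<in> N'" if "z \<in> ball 0 1" for z
      using k(4) that unfolding A_def by blast+
    have zs: "z ^ s \<in> ball 0 1" if "z \<in> ball 0 1" for z :: complex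
      using power_image_disc[OF k(5)] that by blast
    have "conformal_iso (\<lambda>p. \<phi> (Some (k (inv Some p)))) unit_disk ((\<lambda>z. \<phi> (Some (k z))) ` ball 0 1)"
      by (rule disc_compose[OF \<phi> k(1,2)]) (use kA in auto)
    moreover have "(\<lambda>z. \<phi> (Some (k z))) ` ball 0 1 \<subseteq> N' \<inter> W"
      using kA disc_mem[OF \<phi>] by blast
    moreover have "f (\<phi> (Some (k (inv Some (Some z))))) = \<rho> (Some (z ^ s))" if "z \<in> ball 0 1" for z
      using f[OF kA(1)[OF that]] k(7)[OF that] h(4)[OF zs[OF that]] by simp
    moreover have "\<phi> (Some (k (inv Some (Some 0)))) = p" using k(3) q by simp
    ultimately show "\<exists>\<sigma> W' s. conformal_iso \<sigma> unit_disk W' \<and> \<sigma> (Some 0) = p \<and> W' \<subseteq> N' \<inter> W \<and>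
        1 \<le> s \<and> s \<le> t \<and> (\<forall>z\<in>ball 0 1. f (\<sigma> (Some z)) = \<rho> (Some (z ^ s)))"
      using k(5,6) by blast
  qed
qed

lemma exists_small_disc:
  assumes "openin rsphere_top N" "p \<in> N"
  obtains \<rho> V where "conformal_iso \<rho> unit_disk V" "\<rho> (Some 0) = p" "V \<subseteq> N"
proof -
  obtain \<phi> z where \<phi>: "\<phi> \<in> parametrizations" "\<phi> z = p" by (rule param_cover)
  have "open (\<phi> -` N)" "z \<in> \<phi> -` N" using assms \<phi> open_param_vimage by auto
  then obtain r where r: "r > 0" "ball z r \<subseteq> \<phi> -` N" by (meson openE)
  \<comment> \<open>The affine map of the unit disk onto a small disk in a chart.\<close>
  define k where "k w = z + of_real r * w" for w :: complex
  have k: "k w \<in> ball z r" if "w \<in> ball 0 1" for w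
    using that r(1) by (simp add: k_def dist_norm norm_mult)
  have "conformal_iso (\<lambda>p. \<phi> (k (inv Some p))) unit_disk ((\<lambda>p. \<phi> (k (inv Some p))) ` unit_disk)"
  proof (rule conformal_iso_image[OF openin_unit_disk])
    fix p assume "p \<in> unit_disk"
    then obtain w where w: "p = Some w" by blast
    have "k analytic_on {w}" unfolding k_def by (intro analytic_intros)
    then show "hol_at (\<lambda>p. \<phi> (k (inv Some p))) p"
      unfolding w by (rule hol_at_param) (auto simp: \<phi> Some_param)
  next
    show "inj_on (\<lambda>p. \<phi> (k (inv Some p))) unit_disk"
    proof (rule inj_onI)
      fix p q assume pq: "p \<in> unit_disk" "q \<in> unit_disk" "\<phi> (k (inv Some p)) = \<phi> (k (inv Some q))"
      then have "k (inv Some p) = k (inv Some q)"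
        using inj_parametrization[OF \<phi>(1)] by (simp add: inj_eq)
      then show "p = q" using pq r(1) by (auto simp: k_def)
    qed
  qed
  moreover have "(\<lambda>p. \<phi> (k (inv Some p))) ` unit_disk \<subseteq> N"
  proof (rule image_subsetI)
    fix p assume "p \<in> unit_disk"
    then have "k (inv Some p) \<in> ball z r" using k by auto
    then show "\<phi> (k (inv Some p)) \<in> N" using r(2) by blast
  qed
  moreover have "\<phi> (k (inv Some (Some 0))) = p" using \<phi> by (simp add: k_def)
  ultimately show ?thesis using that by blast
qed

section \<open>Plaque neighbourhoods\<close>

text \<open>A plaque with coherent coordinates centred at the entries of \<open>x\<close>: the same
  \<open>\<rho> k\<close> serves as target coordinate of one step and as source coordinate of the
  preceding one. A \<open>plaque\<close> may change its coordinates between steps.\<close>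

definition disc_tower ::
  "rsphere set \<Rightarrow> (rsphere \<Rightarrow> rsphere) \<Rightarrow> nat \<Rightarrow> (nat \<Rightarrow> rsphere) \<Rightarrow> (nat \<Rightarrow> rsphere \<Rightarrow> rsphere) \<Rightarrow> bool" where
  "disc_tower S f d x \<rho> \<longleftrightarrow> (\<forall>k. conformal_iso (\<rho> k) unit_disk (\<rho> k ` unit_disk) \<and>
     \<rho> k ` unit_disk \<subseteq> S \<and> \<rho> k (Some 0) = x k \<and>
     (\<exists>s. 1 \<le> s \<and> s \<le> d \<and> (\<forall>z\<in>ball 0 1. f (\<rho> (Suc k) (Some z)) = \<rho> k (Some (z ^ s)))))"

lemma disc_tower_nhd:
  assumes \<rho>: "disc_tower S f d x \<rho>" and x: "x \<in> plaque_limit S f"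
  shows "nhd S f d x (\<lambda>k. \<rho> k ` unit_disk)"
proof -
  have c: "conformal_iso (\<rho> k) unit_disk (\<rho> k ` unit_disk)" "\<rho> k ` unit_disk \<subseteq> S" "\<rho> k (Some 0) = x k"
    and s: "\<exists>s. 1 \<le> s \<and> s \<le> d \<and> (\<forall>z\<in>ball 0 1. f (\<rho> (Suc k) (Some z)) = \<rho> k (Some (z ^ s)))" for k
    using \<rho> unfolding disc_tower_def by blast+
  have o: "openin rsphere_top (\<rho> k ` unit_disk)" for k
    by (rule conformal_isoD(3)[OF c(1) openin_unit_disk])
  have im: "f ` (\<rho> (Suc k) ` unit_disk) = \<rho> k ` unit_disk" for k
  proof -
    obtain s where s: "1 \<le> s" "\<And>z. z \<in> ball 0 1 \<Longrightarrow> f (\<rho> (Suc k) (Some z)) = \<rho> k (Some (z ^ s))"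
      using s[of k] by blast
    have "f ` (\<rho> (Suc k) ` unit_disk) = (\<lambda>z. f (\<rho> (Suc k) (Some z))) ` ball 0 1"
      by (simp add: image_image)
    also have "\<dots> = (\<lambda>z. \<rho> k (Some (z ^ s))) ` ball 0 1"
      by (intro image_cong refl s(2))
    also have "\<dots> = \<rho> k ` Some ` ((\<lambda>z. z ^ s) ` ball 0 1)" by (simp add: image_image)
    also have "\<dots> = \<rho> k ` unit_disk" by (simp add: power_image_disc[OF s(1)])
    finally show ?thesis .
  qed
  have "open_seq S f (\<lambda>k. \<rho> k ` unit_disk)"
    unfolding open_seq_def by (intro allI conjI o c(2) im)
  moreover have "\<exists>t \<phi> \<psi>. 1 \<le> t \<and> t \<le> d \<and> power_model f t \<phi> (\<rho> (Suc k) ` unit_disk) \<psi> (\<rho> k ` unit_disk)" for k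
  proof -
    obtain s where "1 \<le> s" "s \<le> d" "\<forall>z\<in>ball 0 1. f (\<rho> (Suc k) (Some z)) = \<rho> k (Some (z ^ s))"
      using s[of k] by (elim exE conjE)
    then show ?thesis
      unfolding power_model_def
      by (intro exI[of _ s] exI[of _ "\<rho> (Suc k)"] exI[of _ "\<rho> k"] conjI c(1))
  qed
  moreover have "x k \<in> \<rho> k ` unit_disk" for k
    by (rule image_eqI[of _ _ "Some 0"]) (simp_all add: c(3))
  moreover have "\<exists>h. conformal_iso h unit_disk (\<rho> k ` unit_disk)" for k
    by (rule exI, rule c(1))
  ultimately show ?thesis
    unfolding nhd_def plaque_def seq_points_def using x by simp
qed

lemma bij_tail_tower:
  assumes hol: "\<And>p. p \<in> S \<Longrightarrow> hol_at f p" and U: "open_seq S f U"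
    and bij: "\<And>k. bij_betw f (U (Suc k)) (U k)" and d: "1 \<le> d"
    and x: "\<And>k. x k \<in> U k" "\<And>k. f (x (Suc k)) = x k"
    and \<rho>0: "conformal_iso \<rho>0 unit_disk V" "\<rho>0 (Some 0) = x 0" "V \<subseteq> U 0"
  shows "\<exists>\<rho>. disc_tower S f d x \<rho> \<and> \<rho> 0 = \<rho>0"
proof -
  have oU: "openin rsphere_top (U k)" and US: "U k \<subseteq> S" for k
    using U by (auto simp: open_seq_def)
  \<comment> \<open>The disk is carried upwards by the inverses of the bijections; in these
    coordinates \<open>f\<close> is the identity, that is, \<open>z ^ 1\<close>.\<close>
  define \<rho> where "\<rho> = rec_nat \<rho>0 (\<lambda>k r p. the_inv_into (U (Suc k)) f (r p))"
  have [simp]: "\<rho> 0 = \<rho>0" "\<rho> (Suc k) p = the_inv_into (U (Suc k)) f (\<rho> k p)" for k p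
    by (simp_all add: \<rho>_def)
  have iso: "conformal_iso f (U (Suc k)) (U k)" for k
    using conformal_iso_image[OF oU, of "Suc k" f] bij[of k] hol US
    by (metis bij_betw_def subsetD)
  have *: "conformal_iso (\<rho> k) unit_disk (\<rho> k ` unit_disk) \<and> \<rho> k ` unit_disk \<subseteq> U k \<and> \<rho> k (Some 0) = x k" for k
  proof (induction k)
    case 0
    then show ?case using \<rho>0 conformal_isoD(2)[OF \<rho>0(1) openin_unit_disk] by simp
  next
    case (Suc k)
    note injf = bij_betw_imp_inj_on[OF bij[of k]]
    have fU: "f ` U (Suc k) = U k" using bij[of k] by (simp add: bij_betw_def)
    have sub: "\<rho> k p \<in> U k" if "p \<in> unit_disk" for p using Suc that by blast
    have "conformal_iso (\<rho> (Suc k)) unit_disk (\<rho> (Suc k) ` unit_disk)"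
    proof (rule conformal_iso_image[OF openin_unit_disk])
      fix p assume p: "p \<in> unit_disk"
      have "hol_at (\<lambda>p. the_inv_into (U (Suc k)) f (\<rho> k p)) p"
        by (rule hol_at_compose[of "\<rho> k",
              OF conformal_isoD(4)[OF Suc[THEN conjunct1] openin_unit_disk p]
                conformal_isoD(5)[OF iso oU sub[OF p]]])
      then show "hol_at (\<rho> (Suc k)) p" by (simp add: \<rho>_def)
    next
      have inj\<rho>: "inj_on (\<rho> k) unit_disk" using Suc conformal_isoD(1)[OF _ openin_unit_disk] by blast
      show "inj_on (\<rho> (Suc k)) unit_disk"
      proof (rule inj_onI)
        fix p q assume pq: "p \<in> unit_disk" "q \<in> unit_disk" "\<rho> (Suc k) p = \<rho> (Suc k) q"
        have "f (\<rho> (Suc k) p) = \<rho> k p" if "p \<in> unit_disk" for p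
          using f_the_inv_into_f[OF injf, of "\<rho> k p"] sub[OF that] fU by simp
        then have "\<rho> k p = \<rho> k q" using pq by metis
        then show "p = q" using inj_onD[OF inj\<rho>] pq(1,2) by blast
      qed
    qed
    moreover have "\<rho> (Suc k) ` unit_disk \<subseteq> U (Suc k)"
    proof (rule image_subsetI)
      fix p assume "p \<in> unit_disk"
      then show "\<rho> (Suc k) p \<in> U (Suc k)"
        using the_inv_into_into[OF injf, of "\<rho> k p" "U (Suc k)"] sub fU by simp
    qed
    moreover have "\<rho> (Suc k) (Some 0) = x (Suc k)"
      using Suc x(2)[of k] the_inv_into_f_f[OF injf x(1)] by simp
    ultimately show ?case by blast
  qed
  have "f (\<rho> (Suc k) (Some z)) = \<rho> k (Some (z ^ 1))" if "z \<in> ball 0 1" for k z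
  proof -
    have "\<rho> k (Some z) \<in> U k" using *[of k] that by blast
    then have "\<rho> k (Some z) \<in> f ` U (Suc k)" using bij[of k] by (simp add: bij_betw_def)
    then show ?thesis using f_the_inv_into_f[OF bij_betw_imp_inj_on[OF bij[of k]]] by simp
  qed
  then have "\<exists>s. 1 \<le> s \<and> s \<le> d \<and> (\<forall>z\<in>ball 0 1. f (\<rho> (Suc k) (Some z)) = \<rho> k (Some (z ^ s)))" for k
    using d by (intro exI[of _ 1]) blast
  moreover have "\<rho> k ` unit_disk \<subseteq> S" for k using * US by (meson order_trans)
  ultimately have "disc_tower S f d x \<rho>" using * unfolding disc_tower_def by blast
  then show ?thesis by auto
qed

lemma disc_tower_Suc:
  assumes "disc_tower S f d (\<lambda>k. x (Suc k)) \<rho>" "conformal_iso \<rho>0 unit_disk V" "V \<subseteq> S" "\<rho>0 (Some 0) = x 0"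
    "1 \<le> s" "s \<le> d" "\<And>z. z \<in> ball 0 1 \<Longrightarrow> f (\<rho> 0 (Some z)) = \<rho>0 (Some (z ^ s))"
  shows "disc_tower S f d x (case_nat \<rho>0 \<rho>)"
  unfolding disc_tower_def
proof
  fix k
  show "conformal_iso (case_nat \<rho>0 \<rho> k) unit_disk (case_nat \<rho>0 \<rho> k ` unit_disk) \<and>
     case_nat \<rho>0 \<rho> k ` unit_disk \<subseteq> S \<and> case_nat \<rho>0 \<rho> k (Some 0) = x k \<and>
     (\<exists>s. 1 \<le> s \<and> s \<le> d \<and> (\<forall>z\<in>ball 0 1. f (case_nat \<rho>0 \<rho> (Suc k) (Some z)) = case_nat \<rho>0 \<rho> k (Some (z ^ s))))"
  proof (cases k)
    case 0
    then show ?thesis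
      using assms conformal_isoD(2)[OF assms(2) openin_unit_disk] by auto
  next
    case (Suc m)
    then show ?thesis using assms(1) unfolding disc_tower_def by simp
  qed
qed

text \<open>The neighbourhood must be found before the disk is given, so the induction descends from
  level \<open>n\<close> to 0: what works at level \<open>Suc m\<close> is the neighbourhood into
  which disks at level \<open>m\<close> have to be lifted. Only \<open>n\<close> shrinkings occur,
  so an open set remains.\<close>

lemma regular_point_small_discs:
  assumes hol: "\<And>p. p \<in> S \<Longrightarrow> hol_at f p" and d: "1 \<le> d"
    and reg: "regular_point S f d x"
  obtains N where "openin rsphere_top N" "x 0 \<in> N"
    "\<And>\<rho>0 V. conformal_iso \<rho>0 unit_disk V \<Longrightarrow> \<rho>0 (Some 0) = x 0 \<Longrightarrow> V \<subseteq> N \<Longrightarrow>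
      \<exists>\<rho>. disc_tower S f d x \<rho> \<and> \<rho> 0 = \<rho>0"
proof -
  obtain U n where U: "nhd S f d x U" and bij: "\<And>i. i \<ge> n \<Longrightarrow> bij_betw f (U (Suc i)) (U i)"
    using reg unfolding regular_point_def by blast
  have os: "open_seq S f U" and xU: "x i \<in> U i" and fx: "f (x (Suc i)) = x i"
    and pm: "\<exists>t \<phi> \<psi>. 1 \<le> t \<and> t \<le> d \<and> power_model f t \<phi> (U (Suc i)) \<psi> (U i)" for i
    using U by (auto simp: nhd_def plaque_def seq_points_def plaque_limit_def)
  have oU: "openin rsphere_top (U k)" and US: "U k \<subseteq> S" for k
    using os by (auto simp: open_seq_def)
  have "\<exists>N. openin rsphere_top N \<and> x m \<in> N \<and> (\<forall>\<rho>0 V. conformal_iso \<rho>0 unit_disk V \<longrightarrow>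
      \<rho>0 (Some 0) = x m \<longrightarrow> V \<subseteq> N \<longrightarrow> (\<exists>\<rho>. disc_tower S f d (\<lambda>k. x (m + k)) \<rho> \<and> \<rho> 0 = \<rho>0))"
    if "m \<le> n" for m
    using that
  proof (induction m rule: inc_induct)
    case base
    show ?case
    proof (intro exI[of _ "U n"] conjI allI impI)
      fix \<rho>0 V assume *: "conformal_iso \<rho>0 unit_disk V" "\<rho>0 (Some 0) = x n" "V \<subseteq> U n"
      show "\<exists>\<rho>. disc_tower S f d (\<lambda>k. x (n + k)) \<rho> \<and> \<rho> 0 = \<rho>0"
        by (rule bij_tail_tower[where U = "\<lambda>k. U (n + k)" and V = V])
          (use * os bij d xU fx hol in \<open>auto simp: open_seq_def\<close>)
    qed (use oU xU in auto)
  next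
    case (step m)
    then obtain N' where N': "openin rsphere_top N'" "x (Suc m) \<in> N'"
      "\<And>\<rho>0 V. conformal_iso \<rho>0 unit_disk V \<Longrightarrow> \<rho>0 (Some 0) = x (Suc m) \<Longrightarrow> V \<subseteq> N' \<Longrightarrow>
        \<exists>\<rho>. disc_tower S f d (\<lambda>k. x (Suc m + k)) \<rho> \<and> \<rho> 0 = \<rho>0"
      by blast
    obtain t \<phi> \<psi> where t: "1 \<le> t" "t \<le> d" "power_model f t \<phi> (U (Suc m)) \<psi> (U m)"
      using pm by blast
    obtain N where N: "openin rsphere_top N" "x m \<in> N"
      "\<And>\<rho> V'. conformal_iso \<rho> unit_disk V' \<Longrightarrow> \<rho> (Some 0) = x m \<Longrightarrow> V' \<subseteq> N \<Longrightarrow>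
      \<exists>\<sigma> W' s. conformal_iso \<sigma> unit_disk W' \<and> \<sigma> (Some 0) = x (Suc m) \<and> W' \<subseteq> N' \<inter> U (Suc m) \<and>
        1 \<le> s \<and> s \<le> t \<and> (\<forall>z\<in>ball 0 1. f (\<sigma> (Some z)) = \<rho> (Some (z ^ s)))"
      using power_model_lift[OF t(3,1) xU N'(1,2)] unfolding fx by metis
    show ?case
    \<comment> \<open>The intersection with \<open>U m\<close> keeps the disk inside
      \<open>S\<close>.\<close>
    proof (intro exI[of _ "N \<inter> U m"] conjI allI impI)
      fix \<rho>0 V assume *: "conformal_iso \<rho>0 unit_disk V" "\<rho>0 (Some 0) = x m" "V \<subseteq> N \<inter> U m"
      then obtain \<sigma> W' s where \<sigma>: "conformal_iso \<sigma> unit_disk W'" "\<sigma> (Some 0) = x (Suc m)" "W' \<subseteq> N'"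
        "1 \<le> s" "s \<le> t" "\<And>z. z \<in> ball 0 1 \<Longrightarrow> f (\<sigma> (Some z)) = \<rho>0 (Some (z ^ s))"
        using N(3)[OF *(1,2)] by blast
      then obtain \<rho> where \<rho>: "disc_tower S f d (\<lambda>k. x (Suc m + k)) \<rho>" "\<rho> 0 = \<sigma>"
        using N'(3) by blast
      have "V \<subseteq> S" using *(3) US[of m] by blast
      then have "disc_tower S f d (\<lambda>k. x (m + k)) (case_nat \<rho>0 \<rho>)"
        by (intro disc_tower_Suc[of _ _ _ _ _ _ V s]) (use * \<sigma> \<rho> t in auto)
      then show "\<exists>\<rho>. disc_tower S f d (\<lambda>k. x (m + k)) \<rho> \<and> \<rho> 0 = \<rho>0" by force
    qed (use N oU xU in auto)
  qed
  from this[of 0] show ?thesis using that by auto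
qed

section \<open>Comparison of plaque neighbourhoods and shrinking sequences\<close>

text \<open>
  A power map is proper, so \<open>W\<close> is relatively closed in the preimage of \<open>V\<close>.
\<close>

lemma power_model_connected_subset:
  assumes S: "openin rsphere_top S" and hol: "\<And>p. p \<in> S \<Longrightarrow> hol_at f p"
    and pm: "power_model f t \<phi> W \<psi> V" and t: "1 \<le> t"
    and C: "connectedin rsphere_top C" "C \<subseteq> S" "f ` C \<subseteq> V" "p \<in> C" "p \<in> W"
  shows "C \<subseteq> W"
proof (rule ccontr)
  assume nC: "\<not> C \<subseteq> W"
  have \<phi>: "conformal_iso \<phi> unit_disk W" and \<psi>: "conformal_iso \<psi> unit_disk V"
    and f: "\<And>z. z \<in> ball 0 1 \<Longrightarrow> f (\<phi> (Some z)) = \<psi> (Some (z ^ t))"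
    using pm by (auto simp: power_model_def)
  have oW: "openin rsphere_top W" using conformal_isoD(3)[OF \<phi> openin_unit_disk] .
  \<comment> \<open>For \<open>r < 1\<close>, the part of \<open>W\<close> over the closed disk of
    radius \<open>r\<close> is the compact set \<open>K r\<close>. Hence \<open>O' r\<close> is open
    and consists exactly of the points over the open disk of radius \<open>r\<close> that lie
    outside \<open>W\<close>; the union of these sets and \<open>W\<close> separate
    \<open>C\<close>.\<close>
  define K where "K r = (\<lambda>z. \<phi> (Some z)) ` {z. norm z ^ t \<le> r}" for r :: real
  define O' where "O' r = {c \<in> S. f c \<in> (\<lambda>z. \<psi> (Some z)) ` ball 0 r} - K r" for r
  have K: "closedin rsphere_top (K r)" if "r < 1" for r
  proof -
    have "compactin rsphere_top (K r)"
      unfolding K_def by (rule disc_image_compact[OF \<phi> compact_power_sublevel[OF t that]])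
    then show ?thesis using Hausdorff_rsphere compactin_imp_closedin by blast
  qed
  have oO: "openin rsphere_top (O' r)" if "r < 1" for r
    unfolding O'_def
    by (intro openin_diff K that openin_cont_vimage S hol_at_imp_cont_at hol disc_image_open[OF \<psi>])
      (use that in auto)
  define E where "E = (\<Union>r\<in>{..<1}. O' r)"
  have "openin rsphere_top E" unfolding E_def by (intro openin_clauses) (auto intro: oO)
  moreover have cov: "C \<subseteq> W \<union> E"
  proof
    fix c assume c: "c \<in> C"
    show "c \<in> W \<union> E"
    proof (cases "c \<in> W")
      case False
      have "f c \<in> V" using C c by blast
      then obtain v where v: "v \<in> ball 0 1" "f c = \<psi> (Some v)" using disc_cases[OF \<psi>] by metis
      obtain r where r: "norm v < r" "r < 1" using dense[of "norm v" 1] v by auto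
      have "K r \<subseteq> W"
      proof
        fix y assume "y \<in> K r"
        then obtain z where z: "norm z ^ t \<le> r" "y = \<phi> (Some z)" by (auto simp: K_def)
        then have "norm z < 1"
          using r t by (metis not_less one_le_power order.strict_trans1 less_le_not_le)
        then show "y \<in> W" using z disc_mem[OF \<phi>] by auto
      qed
      then have "c \<in> O' r" unfolding O'_def using c C v r False by auto
      then show ?thesis using r by (auto simp: E_def)
    qed simp
  qed
  moreover have "W \<inter> E \<inter> C = {}"
  proof -
    have False if c: "c \<in> W" "c \<in> O' r" "r < 1" for c r
    proof -
      obtain z where z: "z \<in> ball 0 1" "c = \<phi> (Some z)" using disc_cases[OF \<phi> c(1)] .
      obtain v where v: "v \<in> ball 0 r" "f c = \<psi> (Some v)" using c(2) by (auto simp: O'_def)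
      have "z ^ t = v"
        using disc_eq_iff[OF \<psi>, of "z ^ t" v] power_image_disc[OF t] z v f[of z] c(3) by fastforce
      then have "norm z ^ t \<le> r" using v by (auto simp: norm_power[symmetric])
      then have "c \<in> K r" using z by (auto simp: K_def)
      then show False using c(2) by (auto simp: O'_def)
    qed
    then show ?thesis unfolding E_def by blast
  qed
  moreover have "W \<inter> C \<noteq> {}" "E \<inter> C \<noteq> {}" using C(4,5) nC cov by auto
  ultimately show False using C(1) oW unfolding connectedin by blast
qed

text \<open>Going up one level, \<open>U (Suc i)\<close> is connected, maps into \<open>V i\<close>
  and meets the sheet \<open>V (Suc i)\<close> in \<open>x (Suc i)\<close>, so it cannot leave that
  sheet. This reduces the comparison of plaques to their bottom levels.\<close>

lemma nhd_mono:
  assumes S: "openin rsphere_top S" and hol: "\<And>p. p \<in> S \<Longrightarrow> hol_at f p"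
    and U: "nhd S f d x U" and V: "nhd S f d x V" and 0: "U 0 \<subseteq> V 0"
  shows "U i \<subseteq> V i"
proof (induction i)
  case (Suc i)
  obtain t \<phi> \<psi> where t: "1 \<le> t" "power_model f t \<phi> (V (Suc i)) \<psi> (V i)"
    using V unfolding nhd_def plaque_def by blast
  show ?case
  proof (rule power_model_connected_subset[OF S hol t(2,1)])
    show "connectedin rsphere_top (U (Suc i))"
      using U disc_image_connected unfolding nhd_def plaque_def by blast
    show "U (Suc i) \<subseteq> S" "f ` U (Suc i) \<subseteq> V i"
      using U Suc unfolding nhd_def plaque_def open_seq_def by auto
    show "x (Suc i) \<in> U (Suc i)" "x (Suc i) \<in> V (Suc i)"
      using U V unfolding nhd_def seq_points_def by auto
  qed
qed (rule 0)

lemma seq_points_mono: "(\<And>i. U i \<subseteq> V i) \<Longrightarrow> seq_points S f U \<subseteq> seq_points S f V"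
  unfolding seq_points_def by blast

lemma exists_shrinking:
  assumes S: "openin rsphere_top S" and hol: "\<And>p. p \<in> S \<Longrightarrow> hol_at f p"
    and small: "\<And>N. openin rsphere_top N \<Longrightarrow> x 0 \<in> N \<Longrightarrow> \<exists>U. nhd S f d x U \<and> U 0 \<subseteq> N"
  obtains U where "shrinks_to S f d U x"
proof -
  obtain \<phi> z where \<phi>: "\<phi> \<in> parametrizations" "\<phi> z = x 0" by (rule param_cover)
  \<comment> \<open>A countable neighbourhood base at \<open>x 0\<close>; the plaques are chosen
    with bottom levels inside these sets and inside the previous bottom level.\<close>
  define B where "B j = \<phi> ` ball z (inverse (real (Suc j)))" for j
  have B: "openin rsphere_top (B j)" "x 0 \<in> B j" for j
    using openin_param_image[OF \<phi>(1)] \<phi>(2) by (auto simp: B_def intro: image_eqI[of _ _ z])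
  have Bbase: "\<exists>j. B j \<subseteq> N" if N: "openin rsphere_top N" "x 0 \<in> N" for N
  proof -
    have "open (\<phi> -` N)" "z \<in> \<phi> -` N" using N \<phi> open_param_vimage by auto
    then obtain e where e: "e > 0" "ball z e \<subseteq> \<phi> -` N" by (meson openE)
    obtain j where "inverse (real (Suc j)) < e" using reals_Archimedean[OF e(1)] by blast
    then have "ball z (inverse (real (Suc j))) \<subseteq> \<phi> -` N" using e(2) by (auto simp: subset_iff)
    then show ?thesis unfolding B_def by blast
  qed
  have "\<exists>U. \<forall>j. (nhd S f d x (U j) \<and> U j 0 \<subseteq> B j) \<and> U (Suc j) 0 \<subseteq> U j 0"
  proof (rule dependent_nat_choice)
    show "\<exists>U. nhd S f d x U \<and> U 0 \<subseteq> B 0" using small B by blast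
    fix U j assume U: "nhd S f d x U \<and> U 0 \<subseteq> B j"
    then have "openin rsphere_top (U 0)" "x 0 \<in> U 0"
      by (auto simp: nhd_def plaque_def open_seq_def seq_points_def)
    then have "openin rsphere_top (B (Suc j) \<inter> U 0)" "x 0 \<in> B (Suc j) \<inter> U 0"
      using B by (simp_all add: openin_Int)
    from small[OF this] show "\<exists>V. (nhd S f d x V \<and> V 0 \<subseteq> B (Suc j)) \<and> V 0 \<subseteq> U 0"
      by (simp add: conj_assoc)
  qed
  then obtain U where U: "\<And>j. nhd S f d x (U j)" "\<And>j. U j 0 \<subseteq> B j" "\<And>j. U (Suc j) 0 \<subseteq> U j 0" by blast
  have "shrinks_to S f d U x"
    unfolding shrinks_to_def
  proof (intro conjI allI impI)
    show "nhd S f d x (U j)" for j by (rule U)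
    show "seq_points S f (U (Suc j)) \<subseteq> seq_points S f (U j)" for j
      by (rule seq_points_mono, rule nhd_mono[OF S hol U(1) U(1) U(3)])
    fix V assume V: "nhd S f d x V"
    then have "openin rsphere_top (V 0)" "x 0 \<in> V 0"
      by (auto simp: nhd_def plaque_def open_seq_def seq_points_def)
    then obtain j where "U j 0 \<subseteq> V 0" using Bbase U(2) by (meson order_trans)
    then show "\<exists>m. seq_points S f (U m) \<subseteq> seq_points S f V"
      using seq_points_mono nhd_mono[OF S hol U(1) V] by metis
  qed
  then show ?thesis using that by blast
qed

lemma regular_point_shrinking:
  assumes S: "openin rsphere_top S" and hol: "\<And>p. p \<in> S \<Longrightarrow> hol_at f p" and d: "1 \<le> d"
    and reg: "regular_point S f d x"
  obtains U where "shrinks_to S f d U x"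
proof (rule exists_shrinking[OF S hol])
  have x: "x \<in> plaque_limit S f"
    using reg by (auto simp: regular_point_def nhd_def seq_points_def)
  obtain N where N: "openin rsphere_top N" "x 0 \<in> N"
    "\<And>\<rho>0 V. conformal_iso \<rho>0 unit_disk V \<Longrightarrow> \<rho>0 (Some 0) = x 0 \<Longrightarrow> V \<subseteq> N \<Longrightarrow>
      \<exists>\<rho>. disc_tower S f d x \<rho> \<and> \<rho> 0 = \<rho>0"
    using regular_point_small_discs[OF hol d reg] by metis
  fix M assume M: "openin rsphere_top M" "x 0 \<in> M"
  obtain \<rho>0 V where \<rho>0: "conformal_iso \<rho>0 unit_disk V" "\<rho>0 (Some 0) = x 0" "V \<subseteq> N \<inter> M"
    using exists_small_disc[of "N \<inter> M" "x 0"] N M by blast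
  then obtain \<rho> where \<rho>: "disc_tower S f d x \<rho>" "\<rho> 0 = \<rho>0" using N(3)[OF \<rho>0(1,2)] by blast
  have "\<rho> 0 ` unit_disk \<subseteq> M" using \<rho> \<rho>0 conformal_isoD(2)[OF \<rho>0(1) openin_unit_disk] by blast
  then show "\<exists>U. nhd S f d x U \<and> U 0 \<subseteq> M"
    using disc_tower_nhd[OF \<rho>(1) x] by blast
qed (use that in auto)

section \<open>Power maps and branched coverings\<close>

text \<open>Points near the centre that differ by a root of unity have the same image, so the centre
  of a sheet with exponent at least 2 is a critical point. The next lemma shows that no other point
  of a sheet is critical.\<close>

lemma power_model_not_inj:
  assumes pm: "power_model f t \<phi> W \<psi> V" and t: "2 \<le> t"
    and N: "openin rsphere_top N" "\<phi> (Some 0) \<in> N"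
  shows "\<not> inj_on f N"
proof
  assume inj: "inj_on f N"
  have \<phi>: "conformal_iso \<phi> unit_disk W" and f: "\<And>z. z \<in> ball 0 1 \<Longrightarrow> f (\<phi> (Some z)) = \<psi> (Some (z ^ t))"
    using pm by (auto simp: power_model_def)
  have "open {z \<in> ball 0 1. \<phi> (Some z) \<in> N}" "0 \<in> {z \<in> ball 0 1. \<phi> (Some z) \<in> N}"
    using disc_vimage_open[OF \<phi> N(1)] N(2) by auto
  then obtain r where r: "r > 0" "ball 0 r \<subseteq> {z \<in> ball 0 1. \<phi> (Some z) \<in> N}" by (meson openE)
  obtain u v :: complex where uv: "u \<in> ball 0 r" "v \<in> ball 0 r" "u \<noteq> v" "u ^ t = v ^ t"
    using power_not_inj_near_0[OF t r(1)] .
  have m: "u \<in> ball 0 1" "v \<in> ball 0 1" "\<phi> (Some u) \<in> N" "\<phi> (Some v) \<in> N"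
    using uv(1,2) r(2) by blast+
  have "f (\<phi> (Some u)) = f (\<phi> (Some v))" using f[OF m(1)] f[OF m(2)] uv(4) by simp
  then have "\<phi> (Some u) = \<phi> (Some v)" using inj_onD[OF inj _ m(3,4)] by simp
  then show False using disc_eq_iff[OF \<phi> m(1,2)] uv(3) by simp
qed

lemma power_model_locally_inj:
  assumes pm: "power_model f t \<phi> W \<psi> V" and t: "1 \<le> t" and z: "z \<in> ball 0 1" "z \<noteq> 0"
  obtains N where "openin rsphere_top N" "\<phi> (Some z) \<in> N" "inj_on f N"
proof -
  have \<phi>: "conformal_iso \<phi> unit_disk W" and \<psi>: "conformal_iso \<psi> unit_disk V"
    and f: "\<And>z. z \<in> ball 0 1 \<Longrightarrow> f (\<phi> (Some z)) = \<psi> (Some (z ^ t))"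
    using pm by (auto simp: power_model_def)
  obtain r where r: "0 < r" "ball z r \<subseteq> ball 0 1" "inj_on (\<lambda>z. z ^ t) (ball z r)"
    using power_locally_inj[OF z(2) t open_ball z(1)] .
  show ?thesis
  proof (rule that[of "(\<lambda>z. \<phi> (Some z)) ` ball z r"])
    show "openin rsphere_top ((\<lambda>z. \<phi> (Some z)) ` ball z r)"
      by (rule disc_image_open[OF \<phi> open_ball r(2)])
    show "\<phi> (Some z) \<in> (\<lambda>z. \<phi> (Some z)) ` ball z r" using r(1) by simp
    have "u = v" if uv: "u \<in> ball z r" "v \<in> ball z r" and e: "f (\<phi> (Some u)) = f (\<phi> (Some v))" for u v
    proof -
      have m: "u \<in> ball 0 1" "v \<in> ball 0 1" using uv r(2) by blast+
      have "u ^ t \<in> ball 0 1" "v ^ t \<in> ball 0 1" using power_image_disc[OF t] m by blast+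
      then have "u ^ t = v ^ t" using e f[OF m(1)] f[OF m(2)] disc_eq_iff[OF \<psi>] by simp
      then show ?thesis using inj_onD[OF r(3) _ uv] by simp
    qed
    then show "inj_on f ((\<lambda>z. \<phi> (Some z)) ` ball z r)"
      by (intro inj_onI) (elim imageE, metis)
  qed
qed

lemma power_model_1_bij:
  assumes "power_model f 1 \<phi> W \<psi> V"
  shows "bij_betw f W V"
proof -
  have \<phi>: "conformal_iso \<phi> unit_disk W" and \<psi>: "conformal_iso \<psi> unit_disk V"
    and f: "\<And>z. z \<in> ball 0 1 \<Longrightarrow> f (\<phi> (Some z)) = \<psi> (Some z)"
    using assms by (auto simp: power_model_def)
  have "bij_betw \<phi> unit_disk W" "bij_betw \<psi> unit_disk V"
    using \<phi> \<psi> by (auto simp: conformal_iso_def)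
  then show ?thesis
    using bij_betw_comp_iff[of \<phi> unit_disk W f V] bij_betw_cong[of unit_disk "f \<circ> \<phi>" \<psi> V] f
    by fastforce
qed

lemma branched_covering_nbhd:
  assumes bc: "holo_branched_covering S f d" and y: "y \<in> S" and d: "0 < d"
  obtains V \<psi> \<W> t \<phi> where "openin rsphere_top V" "V \<subseteq> S" "y \<in> V" "\<psi> (Some 0) = y"
    "conformal_iso \<psi> unit_disk V" "finite \<W>" "disjoint \<W>"
    "\<Union>\<W> = {p \<in> S. f p \<in> V}" "\<forall>W\<in>\<W>. openin rsphere_top W" "\<forall>W\<in>\<W>. 1 \<le> t W"
    "\<forall>W\<in>\<W>. power_model f (t W) (\<phi> W) W \<psi> V" "(\<Sum>W\<in>\<W>. t W) = d"
proof -
  have "\<exists>V \<psi> \<W> t. openin rsphere_top V \<and> V \<subseteq> S \<and> \<psi> (Some 0) = y \<and>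
        finite \<W> \<and> disjoint \<W> \<and> \<Union>\<W> = {p \<in> S. f p \<in> V} \<and>
        (\<forall>W\<in>\<W>. openin rsphere_top W \<and> 1 \<le> t W \<and> (\<exists>\<phi>. power_model f (t W) \<phi> W \<psi> V)) \<and>
        (\<Sum>W\<in>\<W>. t W) = d"
    using bc y unfolding holo_branched_covering_def by (elim conjE) (drule bspec)
  then obtain V \<psi> \<W> t where *: "openin rsphere_top V" "V \<subseteq> S" "\<psi> (Some 0) = y" "finite \<W>" "disjoint \<W>"
    "\<Union>\<W> = {p \<in> S. f p \<in> V}"
    "\<forall>W\<in>\<W>. openin rsphere_top W \<and> 1 \<le> t W \<and> (\<exists>\<phi>. power_model f (t W) \<phi> W \<psi> V)" "(\<Sum>W\<in>\<W>. t W) = d"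
    by (elim exE conjE)
  then have "\<forall>W\<in>\<W>. \<exists>\<phi>. power_model f (t W) \<phi> W \<psi> V" by blast
  then obtain \<phi> where \<phi>: "\<forall>W\<in>\<W>. power_model f (t W) (\<phi> W) W \<psi> V" by (rule bchoice[THEN exE])
  \<comment> \<open>A positive degree forces at least one sheet, and the power model on it certifies
    \<open>\<psi>\<close> as a conformal coordinate centred at \<open>y\<close>.\<close>
  obtain W where "W \<in> \<W>" using *(8) d by fastforce
  then have \<psi>: "conformal_iso \<psi> unit_disk V" using \<phi> by (auto simp: power_model_def)
  from disc_mem[OF this, of 0] have "y \<in> V" using *(3) by simp
  then show ?thesis using that[of V \<psi> \<W> t \<phi>] * \<phi> \<psi> by simp
qed

lemma branched_covering_hol:
  assumes "openin rsphere_top S" "holo_branched_covering S f d" "p \<in> S"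
  shows "hol_at f p"
  using assms holo_on_iff by (simp add: holo_branched_covering_def)

text \<open>Each of the finitely many sheets over \<open>V\<close> contributes at most its
  centre.\<close>

lemma finite_critical_fibre_nbhd:
  assumes S: "openin rsphere_top S" and bc: "holo_branched_covering S f d" and d: "0 < d" and y: "y \<in> S"
  obtains V where "openin rsphere_top V" "y \<in> V" "finite {c \<in> S. critical_point f c \<and> f c \<in> V}"
proof -
  obtain V \<psi> \<W> t \<phi> where V: "openin rsphere_top V" "V \<subseteq> S" "y \<in> V" "\<psi> (Some 0) = y"
    "conformal_iso \<psi> unit_disk V" "finite \<W>" "disjoint \<W>"
    "\<Union>\<W> = {p \<in> S. f p \<in> V}" "\<forall>W\<in>\<W>. openin rsphere_top W" "\<forall>W\<in>\<W>. 1 \<le> t W"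
    "\<forall>W\<in>\<W>. power_model f (t W) (\<phi> W) W \<psi> V" "(\<Sum>W\<in>\<W>. t W) = d"
    using branched_covering_nbhd[OF bc y d] .
  have "{c \<in> S. critical_point f c \<and> f c \<in> V} \<subseteq> (\<lambda>W. \<phi> W (Some 0)) ` \<W>"
  proof
    fix c assume c: "c \<in> {c \<in> S. critical_point f c \<and> f c \<in> V}"
    then obtain W where W: "W \<in> \<W>" "c \<in> W" using V(8) by blast
    then have "conformal_iso (\<phi> W) unit_disk W" using V(11) by (simp add: power_model_def)
    then obtain z where z: "z \<in> ball 0 1" "c = \<phi> W (Some z)" using disc_cases W(2) by metis
    have "z = 0"
    proof (rule ccontr)
      assume "z \<noteq> 0"
      then obtain N where "openin rsphere_top N" "c \<in> N" "inj_on f N"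
        using power_model_locally_inj[OF V(11)[rule_format, OF W(1)] V(10)[rule_format, OF W(1)] z(1)] z(2) by metis
      then show False
        using c critical_point_iff[OF S branched_covering_hol[OF S bc], of c] by blast
    qed
    then show "c \<in> (\<lambda>W. \<phi> W (Some 0)) ` \<W>" using z W by blast
  qed
  then show ?thesis using that[OF V(1,3)] V(6) finite_subset by blast
qed

text \<open>Power maps are proper on each of the finitely many sheets over a small disk, and
  finitely many such disks, taken with half the radius, cover \<open>C\<close>.\<close>

lemma branched_covering_proper:
  assumes bc: "holo_branched_covering S f d" and d: "0 < d" and C: "compactin rsphere_top C" "C \<subseteq> S"
  obtains K where "compactin rsphere_top K" "K \<subseteq> S" "{p \<in> S. f p \<in> C} \<subseteq> K"
proof -
  have "\<exists>V K. openin rsphere_top V \<and> y \<in> V \<and> compactin rsphere_top K \<and> K \<subseteq> S \<and> {p \<in> S. f p \<in> V} \<subseteq> K"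
    if y: "y \<in> S" for y
  proof -
    obtain V \<psi> \<W> t \<phi> where V: "openin rsphere_top V" "V \<subseteq> S" "y \<in> V" "\<psi> (Some 0) = y"
      "conformal_iso \<psi> unit_disk V" "finite \<W>" "disjoint \<W>"
      "\<Union>\<W> = {p \<in> S. f p \<in> V}" "\<forall>W\<in>\<W>. openin rsphere_top W" "\<forall>W\<in>\<W>. 1 \<le> t W"
      "\<forall>W\<in>\<W>. power_model f (t W) (\<phi> W) W \<psi> V" "(\<Sum>W\<in>\<W>. t W) = d"
      using branched_covering_nbhd[OF bc y d] .
    \<comment> \<open>Any radius strictly between 0 and 1 would serve: the preimage then stays in a
      compact part of each sheet.\<close>
    define V' where "V' = (\<lambda>z. \<psi> (Some z)) ` ball 0 (1/2)"
    define K where "K W = (\<lambda>z. \<phi> W (Some z)) ` {z. norm z ^ t W \<le> 1/2}" for W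
    have V': "openin rsphere_top V'" "y \<in> V'" "V' \<subseteq> V"
    proof -
      have b: "ball 0 (1/2) \<subseteq> ball (0::complex) 1" by (rule subset_ball) simp
      show "openin rsphere_top V'" unfolding V'_def by (rule disc_image_open[OF V(5) open_ball b])
      show "y \<in> V'" unfolding V'_def by (rule image_eqI[of _ _ 0]) (simp_all add: V(4))
      show "V' \<subseteq> V" unfolding V'_def using disc_mem[OF V(5)] b by blast
    qed
    have K: "compactin rsphere_top (K W)" "K W \<subseteq> W" if "W \<in> \<W>" for W
    proof -
      have *: "conformal_iso (\<phi> W) unit_disk W" using V(11)[rule_format, OF that] by (simp add: power_model_def)
      have **: "compact {z::complex. norm z ^ t W \<le> 1/2}" "{z::complex. norm z ^ t W \<le> 1/2} \<subseteq> ball 0 1"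
        by (rule compact_power_sublevel; use V(10)[rule_format, OF that] in simp)+
      show "compactin rsphere_top (K W)" unfolding K_def by (rule disc_image_compact[OF * **])
      show "K W \<subseteq> W" unfolding K_def using disc_mem[OF *] **(2) by blast
    qed
    have "{p \<in> S. f p \<in> V'} \<subseteq> (\<Union>W\<in>\<W>. K W)"
    proof
      fix p assume p: "p \<in> {p \<in> S. f p \<in> V'}"
      then obtain W where W: "W \<in> \<W>" "p \<in> W" using V(8) V'(3) by blast
      have pm: "conformal_iso (\<phi> W) unit_disk W"
        "\<And>z. z \<in> ball 0 1 \<Longrightarrow> f (\<phi> W (Some z)) = \<psi> (Some (z ^ t W))"
        using V(11)[rule_format, OF W(1)] by (auto simp: power_model_def)
      obtain z where z: "z \<in> ball 0 1" "p = \<phi> W (Some z)" using disc_cases[OF pm(1) W(2)] .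
      obtain v where v: "v \<in> ball 0 (1/2)" "f p = \<psi> (Some v)" using p by (auto simp: V'_def)
      have "z ^ t W \<in> ball 0 1" using power_image_disc[OF V(10)[rule_format, OF W(1)]] z(1) by blast
      moreover have "v \<in> ball 0 1" using v(1) by simp
      ultimately have "z ^ t W = v" using disc_eq_iff[OF V(5)] pm(2)[OF z(1)] v(2) z(2) by metis
      then have "norm z ^ t W \<le> 1/2" using v(1) by (auto simp: norm_power[symmetric])
      then show "p \<in> (\<Union>W\<in>\<W>. K W)" using W(1) z(2) by (auto simp: K_def)
    qed
    moreover have "compactin rsphere_top (\<Union>W\<in>\<W>. K W)"
      using K(1) V(6) by (intro compactin_Union) auto
    moreover have "(\<Union>W\<in>\<W>. K W) \<subseteq> S" using K(2) V(8) by blast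
    ultimately show ?thesis using V' by blast
  qed
  then have "\<forall>y\<in>S. \<exists>V. \<exists>K. openin rsphere_top V \<and> y \<in> V \<and> compactin rsphere_top K \<and> K \<subseteq> S \<and> {p \<in> S. f p \<in> V} \<subseteq> K"
    by blast
  then obtain V where "\<forall>y\<in>S. \<exists>K. openin rsphere_top (V y) \<and> y \<in> V y \<and> compactin rsphere_top K \<and> K \<subseteq> S \<and> {p \<in> S. f p \<in> V y} \<subseteq> K"
    by (rule bchoice[THEN exE])
  then obtain K where VK: "\<forall>y\<in>S. openin rsphere_top (V y) \<and> y \<in> V y \<and> compactin rsphere_top (K y) \<and> K y \<subseteq> S \<and> {p \<in> S. f p \<in> V y} \<subseteq> K y"
    by (rule bchoice[THEN exE])
  have "\<exists>\<F>. finite \<F> \<and> \<F> \<subseteq> V ` C \<and> C \<subseteq> \<Union>\<F>"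
    by (rule compactinD[OF C(1)]) (use VK C(2) in auto)
  then obtain F where F: "finite F" "F \<subseteq> C" "C \<subseteq> \<Union> (V ` F)"
    by (metis finite_subset_image)
  show ?thesis
  proof (rule that)
    show "compactin rsphere_top (\<Union> (K ` F))"
      using F VK C(2) by (intro compactin_Union) auto
    show "\<Union> (K ` F) \<subseteq> S" "{p \<in> S. f p \<in> C} \<subseteq> \<Union> (K ` F)"
      using F VK C(2) by blast+
  qed
qed

section \<open>Proper holomorphic self-maps of the disk\<close>

text \<open>The filter describes approach to the unit circle from inside, uniformly in all
  directions, so boundary behaviour can be handled with the usual limit rules.\<close>

lemma eventually_near_frontier:
  "eventually P (filtercomap norm (at_left 1)) \<longleftrightarrow> (\<exists>b<1. \<forall>z::complex. b < norm z \<and> norm z < 1 \<longrightarrow> P z)"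
proof
  assume "eventually P (filtercomap norm (at_left 1))"
  then obtain Q where Q: "eventually Q (at_left (1::real))" "\<And>z. Q (norm z) \<Longrightarrow> P z"
    by (auto simp: eventually_filtercomap)
  then obtain b where "b < 1" "\<And>r. b < r \<Longrightarrow> r < 1 \<Longrightarrow> Q r"
    using eventually_at_left[of 0 "1::real"] by auto
  with Q show "\<exists>b<1. \<forall>z. b < norm z \<and> norm z < 1 \<longrightarrow> P z" by blast
next
  assume "\<exists>b<1. \<forall>z. b < norm z \<and> norm z < 1 \<longrightarrow> P z"
  then obtain b where b: "b < 1" "\<And>z. b < norm z \<Longrightarrow> norm z < 1 \<Longrightarrow> P z" by blast
  have "eventually (\<lambda>r. b < r \<and> r < 1) (at_left (1::real))"
    using b(1) eventually_at_left[of 0 "1::real"] by auto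
  then show "eventually P (filtercomap norm (at_left 1))"
    unfolding eventually_filtercomap using b by blast
qed

text \<open>The maximum principle, applied to \<open>F\<close> and to its reciprocal, squeezes the
  modulus of \<open>F\<close> to 1 everywhere; a holomorphic function of constant modulus is
  constant.\<close>

lemma norm_near_frontier_imp_constant:
  fixes F :: "complex \<Rightarrow> complex"
  assumes F: "F holomorphic_on ball 0 1"
    and lim: "((\<lambda>z. norm (F z)) \<longlongrightarrow> 1) (filtercomap norm (at_left 1))"
    and nz: "\<And>z. z \<in> ball 0 1 \<Longrightarrow> F z \<noteq> 0"
  shows "F constant_on ball 0 1"
proof -
  have le: "norm (G z) \<le> 1"
    if G: "G holomorphic_on ball 0 1"
      and lim: "((\<lambda>z. norm (G z)) \<longlongrightarrow> 1) (filtercomap norm (at_left 1))"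
      and z: "z \<in> ball 0 1" for G :: "complex \<Rightarrow> complex" and z
  proof (rule field_le_epsilon)
    fix e :: real assume "e > 0"
    then have "eventually (\<lambda>z. norm (G z) < 1 + e) (filtercomap norm (at_left 1))"
      using lim by (intro order_tendstoD) auto
    then obtain b where b: "b < 1" "\<And>z. b < norm z \<Longrightarrow> norm z < 1 \<Longrightarrow> norm (G z) < 1 + e"
      by (auto simp: eventually_near_frontier)
    \<comment> \<open>The circle of radius \<open>r\<close> encloses \<open>z\<close> and lies in
      the zone where the bound is known.\<close>
    define r where "r = (max b (norm z) + 1) / 2"
    have r: "b < r" "norm z < r" "r < 1" using b z by (auto simp: r_def)
    have cb: "cball 0 r \<subseteq> ball (0::complex) 1" using r by auto
    show "norm (G z) \<le> 1 + e"
    proof (rule maximum_modulus_frontier[of G "cball 0 r"])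
      show "G holomorphic_on interior (cball 0 r)" "continuous_on (closure (cball 0 r)) G"
        using G cb interior_subset[of "cball 0 r"]
        by (auto intro!: holomorphic_on_imp_continuous_on intro: holomorphic_on_subset simp del: interior_cball)
      fix w :: complex assume "w \<in> frontier (cball 0 r)"
      then have "norm w = r" using r norm_ge_zero[of z] by (auto simp: frontier_cball)
      then show "norm (G w) \<le> 1 + e" using b(2)[of w] r by simp
    qed (use r in auto)
  qed
  have 1: "norm (F z) \<le> 1" if "z \<in> ball 0 1" for z by (rule le[OF F lim that])
  have 2: "norm (inverse (F z)) \<le> 1" if "z \<in> ball 0 1" for z
  proof (rule le[OF _ _ that])
    show "(\<lambda>z. inverse (F z)) holomorphic_on ball 0 1" using F nz by (intro holomorphic_intros)
    have "((\<lambda>z. inverse (norm (F z))) \<longlongrightarrow> inverse 1) (filtercomap norm (at_left 1))"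
      by (intro tendsto_intros lim) auto
    then show "((\<lambda>z. norm (inverse (F z))) \<longlongrightarrow> 1) (filtercomap norm (at_left 1))"
      by (simp add: norm_inverse)
  qed
  have "norm (F z) = 1" if "z \<in> ball 0 1" for z
    using 1[OF that] 2[OF that] nz[OF that]
    by (metis antisym_conv2 inverse_le_1_iff norm_inverse not_less zero_less_norm_iff less_le_not_le)
  then show ?thesis
    by (intro maximum_modulus_principle[OF F open_ball connected_ball open_ball subset_refl, of 0]) auto
qed

text \<open>Writing \<open>B\<close> for the Blaschke factor,
  \<open>1 - |B|^2 = (1 - |a|^2) (1 - |z|^2) / |1 - cnj a * z|^2\<close>. The denominator is bounded
  below by \<open>(1 - |a|)^2\<close>, so the right side is at most \<open>c * (1 - |z|^2)\<close>
  and tends to 0.\<close>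

lemma norm_blaschke_tendsto:
  fixes a :: complex
  assumes a: "norm a < 1"
  shows "((\<lambda>z. norm ((z - a) / (1 - cnj a * z))) \<longlongrightarrow> 1) (filtercomap norm (at_left 1))"
proof -
  define c where "c = (1 - norm a ^ 2) / (1 - norm a) ^ 2"
  have lim: "((\<lambda>z::complex. norm z) \<longlongrightarrow> 1) (filtercomap norm (at_left 1))"
    using filterlim_compose[OF tendsto_ident_at filterlim_filtercomap] by blast
  have ev: "eventually (\<lambda>z::complex. norm z < 1) (filtercomap norm (at_left 1))"
    unfolding eventually_near_frontier by (intro exI[of _ 0]) auto
  have id: "1 - (norm ((z - a) / (1 - cnj a * z)))\<^sup>2 = (1 - norm a ^ 2) * (1 - norm z ^ 2) / norm (1 - cnj a * z) ^ 2"
    and ge: "1 - norm a \<le> norm (1 - cnj a * z)" if "norm z < 1" for z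
  proof -
    have "norm (cnj a * z) \<le> norm a" using that by (simp add: norm_mult mult_left_le)
    then show ge: "1 - norm a \<le> norm (1 - cnj a * z)"
      using norm_triangle_ineq2[of 1 "cnj a * z"] by simp
    then have nz: "norm (1 - cnj a * z) ^ 2 \<noteq> 0" using a by auto
    have "norm (1 - cnj a * z) ^ 2 - norm (z - a) ^ 2 = (1 - norm a ^ 2) * (1 - norm z ^ 2)"
      unfolding cmod_power2 by (simp add: algebra_simps power2_eq_square)
    then show "1 - (norm ((z - a) / (1 - cnj a * z)))\<^sup>2 = (1 - norm a ^ 2) * (1 - norm z ^ 2) / norm (1 - cnj a * z) ^ 2"
      using nz by (simp add: norm_divide power_divide field_simps)
  qed
  have up: "((\<lambda>z. c * (1 - norm (z::complex) ^ 2)) \<longlongrightarrow> c * (1 - 1 ^ 2)) (filtercomap norm (at_left 1))"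
    by (intro tendsto_intros lim)
  have "((\<lambda>z. 1 - (norm ((z - a) / (1 - cnj a * z)))\<^sup>2) \<longlongrightarrow> 0) (filtercomap norm (at_left 1))"
  proof (rule tendsto_sandwich[OF _ _ tendsto_const])
    show "((\<lambda>z. c * (1 - norm (z::complex) ^ 2)) \<longlongrightarrow> 0) (filtercomap norm (at_left 1))"
      using up by simp
    have a2: "0 \<le> 1 - norm a ^ 2" and z2: "norm z < 1 \<Longrightarrow> 0 \<le> 1 - norm z ^ 2" for z :: complex
      using a by (auto simp: power_le_one)
    show "eventually (\<lambda>z. 0 \<le> 1 - (norm ((z - a) / (1 - cnj a * z)))\<^sup>2) (filtercomap norm (at_left 1))"
      using ev by eventually_elim (use a2 z2 in \<open>simp add: id\<close>)
    show "eventually (\<lambda>z. 1 - (norm ((z - a) / (1 - cnj a * z)))\<^sup>2 \<le> c * (1 - norm z ^ 2)) (filtercomap norm (at_left 1))"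
      using ev
    proof eventually_elim
      case (elim z)
      have "(1 - norm a ^ 2) * (1 - norm z ^ 2) / norm (1 - cnj a * z) ^ 2
          \<le> (1 - norm a ^ 2) * (1 - norm z ^ 2) / (1 - norm a) ^ 2"
        by (intro divide_left_mono power_mono ge elim mult_nonneg_nonneg a2 z2 mult_pos_pos)
          (use a ge[OF elim] in auto)
      then show ?case using elim by (simp add: id c_def)
    qed
  qed
  then have "((\<lambda>z. sqrt (1 - (1 - (norm ((z - a) / (1 - cnj a * z)))\<^sup>2))) \<longlongrightarrow> sqrt (1 - 0)) (filtercomap norm (at_left 1))"
    by (intro tendsto_intros)
  then show ?thesis by simp
qed

text \<open>Dividing out the zeros by Blaschke factors leaves a constant.\<close>

lemma proper_disc_map_rational:
  fixes F :: "complex \<Rightarrow> complex"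
  assumes "F holomorphic_on ball 0 1"
    and "((\<lambda>z. norm (F z)) \<longlongrightarrow> 1) (filtercomap norm (at_left 1))"
  shows "\<exists>P Q. \<forall>z\<in>ball 0 1. poly Q z \<noteq> 0 \<and> F z * poly Q z = poly P z"
proof -
  \<comment> \<open>Induction on the set of zeros without multiplicity: each step divides out the
    full order \<open>n\<close> of one zero.\<close>
  have "finite Z \<Longrightarrow> F holomorphic_on ball 0 1 \<Longrightarrow>
      ((\<lambda>z. norm (F z)) \<longlongrightarrow> 1) (filtercomap norm (at_left 1)) \<Longrightarrow> {z \<in> ball 0 1. F z = 0} = Z \<Longrightarrow>
      \<exists>P Q. \<forall>z\<in>ball 0 1. poly Q z \<noteq> 0 \<and> F z * poly Q z = poly P z" for Z
  proof (induction Z arbitrary: F rule: finite_induct)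
    case empty
    then have "F constant_on ball 0 1" by (intro norm_near_frontier_imp_constant) auto
    then obtain c where "\<And>z. z \<in> ball 0 1 \<Longrightarrow> F z = c" by (auto simp: constant_on_def)
    then show ?case by (intro exI[of _ "[:c:]"] exI[of _ 1]) auto
  next
    case (insert a Z)
    have a: "a \<in> ball 0 1" "F a = 0" using insert.prems(3) by auto
    have "\<exists>w\<in>ball 0 1. F w \<noteq> 0"
    proof -
      have "eventually (\<lambda>z. norm (F z) > 0) (filtercomap norm (at_left 1))"
        using insert.prems(2) by (intro order_tendstoD) auto
      then obtain b where b: "b < 1" "\<And>z. b < norm z \<Longrightarrow> norm z < 1 \<Longrightarrow> F z \<noteq> 0"
        by (auto simp: eventually_near_frontier)
      obtain r where "max b 0 < r" "r < 1" using dense[of "max b 0" 1] b by auto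
      then show ?thesis using b by (intro bexI[of _ "of_real r"]) auto
    qed
    then obtain n g r where gr: "r > 0" "cball a r \<subseteq> ball 0 1" "g holomorphic_on cball a r"
      "\<And>w. w \<in> cball a r \<Longrightarrow> F w = g w * (w - a) ^ n \<and> g w \<noteq> 0"
      using zorder_exist_zero[OF insert.prems(1) open_ball connected_ball a(1)] by metis
    \<comment> \<open>\<open>G\<close> is \<open>F\<close> divided by \<open>(z - a) ^ n\<close>,
      with the singularity at \<open>a\<close> removed.\<close>
    define G where "G z = (if z = a then g a else F z / (z - a) ^ n)" for z
    have FG: "F z = (z - a) ^ n * G z" if "z \<in> ball 0 1" for z
      using gr(4)[of a] gr(1) by (auto simp: G_def)
    have Ga: "G a \<noteq> 0" using gr by (auto simp: G_def)
    have "G holomorphic_on ball a r"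
      by (rule holomorphic_transform[of g]) (use gr in \<open>auto simp: G_def intro: holomorphic_on_subset\<close>)
    moreover have "(\<lambda>z. F z / (z - a) ^ n) holomorphic_on (ball 0 1 - {a})"
      using insert.prems(1) by (intro holomorphic_intros) (auto intro: holomorphic_on_subset)
    then have "G holomorphic_on (ball 0 1 - {a})"
      by (rule holomorphic_transform) (auto simp: G_def)
    ultimately have "G holomorphic_on (ball a r \<union> (ball 0 1 - {a}))"
      by (intro holomorphic_on_Un) auto
    moreover have "ball a r \<union> (ball 0 1 - {a}) = ball 0 1" using gr by auto
    ultimately have G: "G holomorphic_on ball 0 1" by simp
    \<comment> \<open>Away from \<open>a\<close>, \<open>H\<close> is \<open>F\<close> divided by
      the \<open>n\<close>-th power of the Blaschke factor at \<open>a\<close>, so it has the same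
      boundary behaviour and one zero fewer.\<close>
    define H where "H z = G z * (1 - cnj a * z) ^ n" for z
    have na: "norm a < 1" using a by simp
    have nz: "1 - cnj a * z \<noteq> 0" if "z \<in> ball 0 1" for z
    proof
      assume "1 - cnj a * z = 0"
      then have "norm (cnj a * z) = 1" by simp
      moreover have "norm (cnj a * z) < 1 * 1"
        unfolding norm_mult complex_mod_cnj by (intro mult_strict_mono') (use na that in auto)
      ultimately show False by simp
    qed
    have H: "H holomorphic_on ball 0 1" unfolding H_def by (intro holomorphic_intros G)
    have "((\<lambda>z. norm (F z) / norm ((z - a) / (1 - cnj a * z)) ^ n) \<longlongrightarrow> 1 / 1 ^ n) (filtercomap norm (at_left 1))"
      by (intro tendsto_intros insert.prems norm_blaschke_tendsto na) auto
    moreover have "eventually (\<lambda>z::complex. norm (F z) / norm ((z - a) / (1 - cnj a * z)) ^ n = norm (H z)) (filtercomap norm (at_left 1))"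
      unfolding eventually_near_frontier
    proof (intro exI[of _ "norm a"] conjI na allI impI)
      fix z :: complex assume z: "norm a < norm z \<and> norm z < 1"
      then have "norm (z - a) \<noteq> 0" by auto
      then show "norm (F z) / norm ((z - a) / (1 - cnj a * z)) ^ n = norm (H z)"
        using FG[of z] z by (simp add: H_def norm_mult norm_power norm_divide power_divide)
    qed
    ultimately have "((\<lambda>z. norm (H z)) \<longlongrightarrow> 1) (filtercomap norm (at_left 1))"
      by (simp add: tendsto_cong)
    moreover have "{z \<in> ball 0 1. H z = 0} = Z"
    proof -
      have "H z = 0 \<longleftrightarrow> z \<noteq> a \<and> F z = 0" if "z \<in> ball 0 1" for z
        using Ga FG[OF that] nz[OF that] a by (cases "z = a") (auto simp: H_def)
      then show ?thesis using insert.prems(3) insert.hyps(2) by blast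
    qed
    ultimately obtain P Q where PQ: "\<And>z. z \<in> ball 0 1 \<Longrightarrow> poly Q z \<noteq> 0 \<and> H z * poly Q z = poly P z"
      using insert.IH[OF H] by blast
    show ?case
    proof (intro exI ballI conjI)
      fix z :: complex assume z: "z \<in> ball 0 1"
      \<comment> \<open>The two linear polynomials are the denominator and the numerator of the
        Blaschke factor.\<close>
      show "poly (Q * [:1, - cnj a:] ^ n) z \<noteq> 0" using PQ[OF z] nz[OF z] by (simp add: algebra_simps)
      show "F z * poly (Q * [:1, - cnj a:] ^ n) z = poly (P * [:- a, 1:] ^ n) z"
        using PQ[OF z, THEN conjunct2, symmetric]
        by (simp add: FG[OF z] H_def algebra_simps)
    qed
  qed
  \<comment> \<open>Near the circle \<open>F\<close> has modulus close to 1, which confines the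
    zeros to a smaller closed disk; there a nonconstant function has finitely many.\<close>
  moreover have "finite {z \<in> ball 0 1. F z = 0}" if nc: "\<not> F constant_on ball 0 1"
  proof -
    have "eventually (\<lambda>z. norm (F z) > 0) (filtercomap norm (at_left 1))"
      using assms(2) by (intro order_tendstoD) auto
    then obtain b where b: "b < 1" "\<And>z. b < norm z \<Longrightarrow> norm z < 1 \<Longrightarrow> F z \<noteq> 0"
      by (auto simp: eventually_near_frontier)
    have "finite {z \<in> cball 0 b. F z = 0}"
      by (rule holomorphic_compact_finite_zeros[OF assms(1) _ _ _ _ nc]) (use b in auto)
    then show ?thesis by (rule rev_finite_subset) (use b in force)
  qed
  ultimately show ?thesis
  proof (cases "F constant_on ball 0 1")
    case True
    then obtain c where "\<And>z. z \<in> ball 0 1 \<Longrightarrow> F z = c" by (auto simp: constant_on_def)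
    then show ?thesis by (intro exI[of _ "[:c:]"] exI[of _ 1]) auto
  qed (use assms in blast)
qed

text \<open>By the quotient rule the zeros of the derivative are roots of the polynomial
  \<open>R\<close>. If \<open>R\<close> vanished identically, \<open>F\<close> would be constant on
  the connected set.\<close>

lemma finite_zeros_deriv_quotient:
  fixes F :: "complex \<Rightarrow> complex"
  assumes F: "F holomorphic_on S" and S: "open S" "connected S" and nc: "\<not> F constant_on S"
    and PQ: "\<And>z. z \<in> S \<Longrightarrow> poly Q z \<noteq> 0" "\<And>z. z \<in> S \<Longrightarrow> F z * poly Q z = poly P z"
  shows "finite {z \<in> S. deriv F z = 0}"
proof -
  define R where "R = pderiv P * Q - P * pderiv Q"
  have R: "deriv F z * poly Q z ^ 2 = poly R z" if "z \<in> S" for z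
  proof -
    have d: "(F has_field_derivative deriv F z) (at z)" using F S that by (simp add: holomorphic_derivI)
    have "((\<lambda>w. F w * poly Q w) has_field_derivative (deriv F z * poly Q z + F z * poly (pderiv Q) z)) (at z)"
      by (auto intro!: derivative_eq_intros d poly_DERIV simp: algebra_simps)
    moreover have "((\<lambda>w. F w * poly Q w) has_field_derivative poly (pderiv P) z) (at z)"
      by (rule has_field_derivative_transform_within_open[where f = "poly P" and S = S, OF _ S(1) that]) (use PQ in \<open>auto intro: poly_DERIV\<close>)
    ultimately have "deriv F z * poly Q z + F z * poly (pderiv Q) z = poly (pderiv P) z"
      by (rule DERIV_unique)
    then have "poly R z = (deriv F z * poly Q z + F z * poly (pderiv Q) z) * poly Q z
        - (F z * poly Q z) * poly (pderiv Q) z"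
      using PQ that by (simp add: R_def)
    then show ?thesis by (simp add: algebra_simps power2_eq_square)
  qed
  have "R \<noteq> 0"
  proof
    assume "R = 0"
    then have "deriv F z = 0" if "z \<in> S" for z using R[OF that] PQ that by simp
    then have "\<forall>z\<in>S - {}. (F has_field_derivative 0) (at z)"
      using F S by (metis Diff_empty holomorphic_derivI)
    then obtain c where "\<And>z. z \<in> S \<Longrightarrow> F z = c"
      using DERIV_zero_connected_constant[OF S(2,1) finite.emptyI holomorphic_on_imp_continuous_on[OF F]]
      by blast
    then have "F constant_on S" unfolding constant_on_def by blast
    with nc show False by simp
  qed
  then have "finite {z. poly R z = 0}" by (rule poly_roots_finite)
  then show ?thesis by (rule rev_finite_subset) (auto simp: R[symmetric])
qed

section \<open>Finiteness of the critical set\<close>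

lemma compact_Some_vimage:
  assumes "compactin rsphere_top K" "K \<subseteq> range Some"
  shows "compact (Some -` K)"
proof -
  have "closedin rsphere_top K" using assms(1) Hausdorff_rsphere compactin_imp_closedin by blast
  moreover have "K = Some ` (Some -` K)" using assms(2) by auto
  ultimately have "closedin rsphere_top (Some ` (Some -` K))" by simp
  then show ?thesis
    unfolding rsphere_top_def closedin_Alexandroff_compactification_image_Some by simp
qed

lemma compactin_Some_image: "compact C \<Longrightarrow> compactin rsphere_top (Some ` C)"
  by (rule image_compactin[where X = euclidean]) (auto simp: rsphere_top_def continuous_map_Some)

lemma plane_map_coordinate:
  assumes S: "openin rsphere_top S" "S \<subseteq> range Some"
    and bc: "holo_branched_covering S f d" and d: "0 < d" and infinite: "infinite S"
    and con: "connected (Some -` S)"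
  obtains F where "F holomorphic_on (Some -` S)" "\<forall>z\<in>Some -` S. f (Some z) = Some (F z)"
    "\<forall>z\<in>Some -` S. F z \<in> Some -` S"
    "\<forall>z\<in>Some -` S. critical_point f (Some z) \<longleftrightarrow> deriv F z = 0"
    "\<not> F constant_on (Some -` S)"
proof -
  define F where "F z = inv Some (f (Some z))" for z
  have hol: "hol_at f p" if "p \<in> S" for p by (rule branched_covering_hol[OF S(1) bc that])
  have fS: "f p \<in> S" if "p \<in> S" for p using bc that by (auto simp: holo_branched_covering_def)
  have fF: "f (Some z) = Some (F z)" if z: "z \<in> Some -` S" for z
  proof -
    have "f (Some z) \<in> range Some" using fS[of "Some z"] z S(2) by blast
    then show ?thesis by (simp add: F_def f_inv_into_f)
  qed
  have op: "open (Some -` S)" using S(1) open_param_vimage Some_param by blast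
  have "F analytic_on {z}" if z: "z \<in> Some -` S" for z
    unfolding F_def
    by (rule hol_at_chart[OF _ Some_param Some_param]) (use hol z fF in auto)
  then have F: "F holomorphic_on (Some -` S)"
    using op by (metis analytic_on_analytic_at analytic_on_open)
  have crit: "critical_point f (Some z) \<longleftrightarrow> deriv F z = 0" if z: "z \<in> Some -` S" for z
  proof -
    have zS: "Some z \<in> S" using z by simp
    have "f (Some z) \<in> range Some" using fF[OF z] by simp
    from deriv_eq_0_iff[OF S(1) hol zS Some_param refl Some_param this]
    show ?thesis using critical_point_iff[OF S(1) hol zS] unfolding F_def by blast
  qed
  \<comment> \<open>If \<open>F\<close> had a single value \<open>v\<close>, all points of the
    infinite set \<open>S\<close> would be critical and lie over \<open>v\<close>, against the
    finiteness of critical points over a neighbourhood of \<open>v\<close>.\<close>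
  have nc: "\<not> F constant_on (Some -` S)"
  proof
    assume "F constant_on (Some -` S)"
    then obtain v where v: "\<And>z. z \<in> Some -` S \<Longrightarrow> F z = v" unfolding constant_on_def by blast
    have "S \<noteq> {}" using infinite by auto
    then obtain z0 where z0: "Some z0 \<in> S" using S(2) by blast
    have "Some v \<in> S" using fS[OF z0] fF[of z0] v[of z0] z0 by simp
    then obtain V where V: "openin rsphere_top V" "Some v \<in> V" "finite {c \<in> S. critical_point f c \<and> f c \<in> V}"
      using finite_critical_fibre_nbhd[OF S(1) bc d] by metis
    have "c \<in> {c \<in> S. critical_point f c \<and> f c \<in> V}" if c: "c \<in> S" for c
    proof -
      obtain z where z: "c = Some z" using c S(2) by blast
      then have zS: "z \<in> Some -` S" using c by simp
      have "(F has_field_derivative 0) (at z)"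
        by (rule has_field_derivative_transform_within_open[OF DERIV_const op zS, of v]) (use v in auto)
      then have "deriv F z = 0" by (rule DERIV_imp_deriv)
      then show ?thesis using crit[OF zS] z c fF[OF zS] v[OF zS] V(2) by simp
    qed
    then have "finite S" by (intro finite_subset[OF subsetI V(3)])
    with infinite show False by simp
  qed
  show ?thesis
  proof (rule that[OF F _ _ _ nc])
    show "\<forall>z\<in>Some -` S. f (Some z) = Some (F z)" using fF by blast
    show "\<forall>z\<in>Some -` S. F z \<in> Some -` S" using fS fF by force
    show "\<forall>z\<in>Some -` S. critical_point f (Some z) \<longleftrightarrow> deriv F z = 0" using crit by blast
  qed
qed

lemma finite_critical_from_quotient:
  assumes "S \<subseteq> range Some" "F holomorphic_on (Some -` S)" "open (Some -` S)" "connected (Some -` S)"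
    "\<not> F constant_on (Some -` S)"
    "\<And>z. z \<in> Some -` S \<Longrightarrow> critical_point f (Some z) \<longleftrightarrow> deriv F z = 0"
    "\<And>z. z \<in> Some -` S \<Longrightarrow> poly Q z \<noteq> 0 \<and> F z * poly Q z = poly P z"
  shows "finite {c \<in> S. critical_point f c}"
proof -
  have fin: "finite {z \<in> Some -` S. deriv F z = 0}"
    by (rule finite_zeros_deriv_quotient[OF assms(2-5)]) (use assms(7) in blast)+
  have sub: "{c \<in> S. critical_point f c} \<subseteq> Some ` {z \<in> Some -` S. deriv F z = 0}"
    using assms(1,6) by auto
  show ?thesis by (rule finite_subset[OF sub finite_imageI[OF fin]])
qed

lemma finite_critical_points:
  assumes S: "S = unit_disk \<or> S = range Some \<or> S = UNIV"
    and bc: "holo_branched_covering S f d" and d: "0 < d"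
  shows "finite {c \<in> S. critical_point f c}"
proof -
  consider "S = unit_disk" | "S = range Some" | "S = UNIV" using S by blast
  then show ?thesis
  proof cases
    case 1
    have vS: "Some -` S = ball 0 1" unfolding 1 by auto
    have oS: "openin rsphere_top S" unfolding 1 by (rule openin_unit_disk)
    have sub: "S \<subseteq> range Some" unfolding 1 by auto
    have inf: "infinite S" unfolding 1 by (simp add: finite_image_iff uncountable_infinite uncountable_ball)
    obtain F where F': "F holomorphic_on ball 0 1" "\<forall>z\<in>ball 0 1. f (Some z) = Some (F z)"
      "\<forall>z\<in>ball 0 1. F z \<in> ball 0 1"
      "\<forall>z\<in>ball 0 1. critical_point f (Some z) \<longleftrightarrow> deriv F z = 0" "\<not> F constant_on ball 0 1"
      using plane_map_coordinate[OF oS sub bc d inf, unfolded vS, OF connected_ball] .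
    note F = F'[rule_format]
    \<comment> \<open>Properness as a boundary condition: points with
      \<open>norm (F z) \<le> 1 - e\<close> lie in a compact part of the disk, hence away from the
      circle.\<close>
    have "((\<lambda>z. norm (F z)) \<longlongrightarrow> 1) (filtercomap norm (at_left 1))"
    proof (rule tendstoI)
      fix e :: real assume e: "e > 0"
      have cb: "cball 0 (1 - e) \<subseteq> ball (0::complex) 1" using e by auto
      have "Some ` cball 0 (1 - e) \<subseteq> S" unfolding 1 by (rule image_mono[OF cb])
      then obtain K where K: "compactin rsphere_top K" "K \<subseteq> S" "{p \<in> S. f p \<in> Some ` cball 0 (1 - e)} \<subseteq> K"
        by (rule branched_covering_proper[OF bc d compactin_Some_image[OF compact_cball]])
      have "compact (Some -` K)" using compact_Some_vimage K(1,2) sub by (meson order_trans)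
      \<comment> \<open>The point 0 is added to make the set nonempty, so that the largest norm is
        attained.\<close>
      then have cK: "compact (insert 0 (Some -` K))" by (rule compact_insert)
      have "insert 0 (Some -` K) \<subseteq> ball 0 1" using K(2) vS by auto
      moreover obtain w :: complex where "w \<in> insert 0 (Some -` K)" "\<forall>z\<in>insert 0 (Some -` K). norm z \<le> norm w"
        using continuous_attains_sup[OF cK insert_not_empty continuous_on_norm_id] by blast
      ultimately have w: "norm w < 1" "\<And>z. z \<in> Some -` K \<Longrightarrow> norm z \<le> norm w"
        by (auto simp: subset_iff)
      show "eventually (\<lambda>z. dist (norm (F z)) 1 < e) (filtercomap norm (at_left 1))"
        unfolding eventually_near_frontier
      proof (intro exI[of _ "norm w"] conjI w(1) allI impI)
        fix z :: complex assume z: "norm w < norm z \<and> norm z < 1"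
        then have zb: "z \<in> ball 0 1" by simp
        have "Some z \<notin> K" using w(2)[of z] z by auto
        moreover have "Some z \<in> {p \<in> S. f p \<in> Some ` cball 0 (1 - e)}" if "norm (F z) \<le> 1 - e"
          using that zb F(2)[OF zb] by (simp add: 1 inj_image_mem_iff)
        ultimately have "\<not> norm (F z) \<le> 1 - e" using K(3) by blast
        moreover have "norm (F z) < 1" using F(3)[OF zb] by simp
        ultimately show "dist (norm (F z)) 1 < e" by (simp add: dist_real_def)
      qed
    qed
    then obtain P Q where PQ: "\<forall>z\<in>ball 0 1. poly Q z \<noteq> 0 \<and> F z * poly Q z = poly P z"
      using proper_disc_map_rational[OF F(1)] by blast
    show ?thesis
      by (rule finite_critical_from_quotient[OF sub, of F f Q P]) (use F PQ in \<open>simp_all add: vS\<close>)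
  next
    case 2
    have vS: "Some -` S = UNIV" unfolding 2 by auto
    have oS: "openin rsphere_top S" unfolding 2 by (rule openin_range_param[OF Some_param])
    have sub: "S \<subseteq> range Some" unfolding 2 by auto
    have inf: "infinite S" unfolding 2 by (simp add: finite_image_iff infinite_UNIV_char_0)
    obtain F where F': "F holomorphic_on UNIV" "\<forall>z. f (Some z) = Some (F z)" "\<forall>z. F z \<in> UNIV"
      "\<forall>z. critical_point f (Some z) \<longleftrightarrow> deriv F z = 0" "\<not> F constant_on UNIV"
      using plane_map_coordinate[OF oS sub bc d inf, unfolded vS ball_UNIV, OF connected_UNIV] .
    note F = F'[rule_format]
    \<comment> \<open>Properness on the plane: preimages of bounded sets are bounded. An entire
      function with this property has a pole at infinity and is a polynomial.\<close>
    have "filterlim F at_infinity at_infinity"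
      unfolding filterlim_at_infinity[OF order_refl]
    proof (intro allI impI)
      fix r :: real assume "r > 0"
      have "Some ` cball 0 r \<subseteq> S" unfolding 2 by blast
      then obtain K where K: "compactin rsphere_top K" "K \<subseteq> S" "{p \<in> S. f p \<in> Some ` cball 0 r} \<subseteq> K"
        by (rule branched_covering_proper[OF bc d compactin_Some_image[OF compact_cball]])
      have "compact (Some -` K)" using compact_Some_vimage K(1,2) sub by (meson order_trans)
      then obtain B where B: "\<And>z. z \<in> Some -` K \<Longrightarrow> norm z \<le> B"
        using compact_imp_bounded[of "Some -` K"] unfolding bounded_iff by blast
      have "r \<le> norm (F z)" if "B + 1 \<le> norm z" for z
      proof (rule ccontr)
        assume "\<not> r \<le> norm (F z)"
        then have "Some z \<in> {p \<in> S. f p \<in> Some ` cball 0 r}"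
          using F(2)[of z] by (simp add: 2 inj_image_mem_iff)
        then have "z \<in> Some -` K" using K(3) by blast
        then show False using B[of z] that by simp
      qed
      then show "eventually (\<lambda>z. r \<le> norm (F z)) at_infinity"
        unfolding eventually_at_infinity by blast
    qed
    then have "((inverse \<circ> F) \<longlongrightarrow> 0) at_infinity"
      unfolding o_def by (rule filterlim_compose[OF tendsto_inverse_0])
    then obtain a n where an: "\<And>z. F z = (\<Sum>i\<le>n. a i * z ^ i)"
      using pole_at_infinity[OF F(1)] by blast
    define P where "P = (\<Sum>i\<le>n. monom (a i) i)"
    have "F z = poly P z" for z by (simp add: an P_def poly_sum poly_monom)
    then show ?thesis
      by (intro finite_critical_from_quotient[OF sub, of F f 1 P]) (use F connected_UNIV in \<open>simp_all add: vS\<close>)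
  next
    case 3
    have oS: "openin rsphere_top S" unfolding 3 using openin_topspace[of rsphere_top] by simp
    have "\<forall>y. \<exists>V. openin rsphere_top V \<and> y \<in> V \<and> finite {c \<in> S. critical_point f c \<and> f c \<in> V}"
      using finite_critical_fibre_nbhd[OF oS bc d] unfolding 3 by blast
    then obtain V where V: "\<And>y. openin rsphere_top (V y)" "\<And>y. y \<in> V y"
      "\<And>y. finite {c \<in> S. critical_point f c \<and> f c \<in> V y}" by metis
    have "\<exists>\<F>. finite \<F> \<and> \<F> \<subseteq> range V \<and> UNIV \<subseteq> \<Union>\<F>"
      by (rule compactinD[of rsphere_top])
        (use V compact_rsphere in \<open>auto simp: compact_space_def\<close>)
    then obtain \<F> where \<F>: "finite \<F>" "\<F> \<subseteq> V ` UNIV" "UNIV \<subseteq> \<Union>\<F>" by blast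
    obtain F where "finite F" "\<F> = V ` F" using finite_subset_image[OF \<F>(1,2)] by blast
    then have F: "finite F" "UNIV \<subseteq> \<Union> (V ` F)" using \<F>(3) by auto
    have "finite (\<Union>y\<in>F. {c \<in> S. critical_point f c \<and> f c \<in> V y})" using F(1) V(3) by simp
    moreover have "{c \<in> S. critical_point f c} \<subseteq> (\<Union>y\<in>F. {c \<in> S. critical_point f c \<and> f c \<in> V y})"
      using F(2) by blast
    ultimately show ?thesis by (rule rev_finite_subset)
  qed
qed

section \<open>Existence of critical points\<close>

text \<open>A path between two points of one fibre projects to a loop, which is null-homotopic. By
  monodromy its lift ends where the constant lift ends, namely at its starting point.\<close>

lemma covering_space_simply_connected_inj:
  fixes p :: "'a::real_normed_vector \<Rightarrow> 'b::real_normed_vector"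
  assumes cov: "covering_space C p S" and C: "path_connected C" and S: "simply_connected S"
  shows "inj_on p C"
proof (rule inj_onI)
  fix a b assume ab: "a \<in> C" "b \<in> C" "p a = p b"
  then obtain h where h: "path h" "path_image h \<subseteq> C" "pathstart h = a" "pathfinish h = b"
    using C unfolding path_connected_def by metis
  have pc: "path (p \<circ> h)"
    using h covering_space_imp_continuous[OF cov] by (meson path_continuous_image continuous_on_subset)
  have pi: "path_image (p \<circ> h) \<subseteq> S"
    using h covering_space_imp_surjective[OF cov] by (auto simp: path_image_compose)
  have hom: "homotopic_paths S (p \<circ> h) (linepath (p a) (p a))"
    using S pc pi h ab unfolding simply_connected_eq_contractible_path
    by (metis pathfinish_compose pathstart_compose)
  have "pathfinish h = pathfinish (linepath a a)"
  proof (rule covering_space_monodromy[OF cov pc pi _ _ hom h(1,2)])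
    show "path_image (linepath (p a) (p a)) \<subseteq> S" "path_image (linepath a a) \<subseteq> C"
      using ab covering_space_imp_surjective[OF cov] by auto
    show "p (linepath a a t) = linepath (p a) (p a) t" for t by (simp add: linepath_refl)
  qed (use h in auto)
  then show "a = b" using h by simp
qed

lemma no_critical_exponent_1:
  assumes S: "openin rsphere_top S" and hol: "\<And>p. p \<in> S \<Longrightarrow> hol_at f p"
    and nocrit: "\<And>c. c \<in> S \<Longrightarrow> \<not> critical_point f c"
    and pm: "power_model f t \<phi> W \<psi> V" and W: "W \<subseteq> S" and t: "1 \<le> t"
  shows "t = 1"
proof (rule ccontr)
  assume "t \<noteq> 1"
  then have t2: "2 \<le> t" using t by simp
  have "conformal_iso \<phi> unit_disk W" using pm by (simp add: power_model_def)
  then have "\<phi> (Some 0) \<in> S" using disc_mem[of \<phi> W 0] W by auto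
  then show False
    using nocrit critical_point_iff[OF S hol] power_model_not_inj[OF pm t2] by blast
qed

text \<open>
  Without critical points the map is a covering; here it is read in the coordinate \<open>\<beta>\<close> on a simply
  connected part of the target whose preimage avoids infinity.
\<close>

lemma unbranched_covering_degree:
  fixes \<beta> :: "complex \<Rightarrow> rsphere"
  assumes S: "openin rsphere_top S" and bc: "holo_branched_covering S f d" and d: "0 < d"
    and nocrit: "\<And>c. c \<in> S \<Longrightarrow> \<not> critical_point f c"
    and B: "open B" "simply_connected B" "B \<noteq> {}"
    and \<beta>: "inj_on \<beta> B" "\<And>w. w \<in> B \<Longrightarrow> hol_at (\<lambda>p. \<beta> (inv Some p)) (Some w)" "\<beta> ` B \<subseteq> S"
    and nNone: "None \<in> S \<Longrightarrow> f None \<notin> \<beta> ` B"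
    and con: "connected {z. Some z \<in> S \<and> f (Some z) \<in> \<beta> ` B}"
  shows "d = 1"
proof (rule ccontr)
  assume "d \<noteq> 1"
  have hol: "hol_at f p" if "p \<in> S" for p by (rule branched_covering_hol[OF S bc that])
  define D where "D = \<beta> ` B"
  define E where "E = {z. Some z \<in> S \<and> f (Some z) \<in> D}"
  \<comment> \<open>The map \<open>f\<close> from the planar coordinate on \<open>E\<close> to the
    coordinate \<open>\<beta>\<close> on the target; it is shown to be a covering of
    \<open>B\<close>.\<close>
  define p where "p z = the_inv_into B \<beta> (f (Some z))" for z
  have \<beta>op: "openin rsphere_top (\<beta> ` A)" if A: "open A" "A \<subseteq> B" for A
  proof -
    have "openin rsphere_top ((\<lambda>p. \<beta> (inv Some p)) ` (Some ` A))"
    proof (rule inj_hol_open_image)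
      show "openin rsphere_top (Some ` A)" by (rule openin_param_image[OF Some_param A(1)])
      show "hol_at (\<lambda>p. \<beta> (inv Some p)) q" if "q \<in> Some ` A" for q
        using that A(2) \<beta>(2) by blast
      show "inj_on (\<lambda>p. \<beta> (inv Some p)) (Some ` A)"
        using inj_on_subset[OF \<beta>(1) A(2)] by (auto simp: inj_on_def)
    qed
    then show ?thesis by (simp add: image_image)
  qed
  have \<beta>vi: "open {w \<in> B. \<beta> w \<in> N}" if N: "openin rsphere_top N" for N
  proof -
    have "openin rsphere_top {p \<in> Some ` B. \<beta> (inv Some p) \<in> N}"
      by (rule openin_cont_vimage[OF openin_param_image[OF Some_param B(1)] _ N])
        (use \<beta>(2) hol_at_imp_cont_at in blast)
    then have "open (Some -` {p \<in> Some ` B. \<beta> (inv Some p) \<in> N})"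
      by (rule open_param_vimage[OF Some_param])
    moreover have "Some -` {p \<in> Some ` B. \<beta> (inv Some p) \<in> N} = {w \<in> B. \<beta> w \<in> N}" by auto
    ultimately show ?thesis by simp
  qed
  have ne: "q \<noteq> None" if "q \<in> S" "f q = \<beta> b" "b \<in> B" for q b
  proof
    assume "q = None"
    with that nNone show False by simp
  qed
  have DS: "D \<subseteq> S" using \<beta>(3) by (simp add: D_def)
  have fvi: "open {z. Some z \<in> S \<and> f (Some z) \<in> N}" if N: "openin rsphere_top N" for N
  proof -
    have "openin rsphere_top {q \<in> S. f q \<in> N}"
      by (rule openin_cont_vimage[OF S hol_at_imp_cont_at[OF hol] N])
    from open_param_vimage[OF Some_param this] show ?thesis by (simp add: vimage_def)
  qed
  have oE: "open E" unfolding E_def D_def by (rule fvi[OF \<beta>op[OF B(1) order_refl]])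
  have pE: "p z \<in> B" "\<beta> (p z) = f (Some z)" if "z \<in> E" for z
  proof -
    have "f (Some z) \<in> \<beta> ` B" using that by (simp add: E_def D_def)
    then show "p z \<in> B" "\<beta> (p z) = f (Some z)"
      unfolding p_def by (rule the_inv_into_into[OF \<beta>(1) _ order_refl], rule f_the_inv_into_f[OF \<beta>(1)])
  qed
  have cp: "continuous_on E p"
    unfolding continuous_on_open_vimage[OF oE]
  proof (intro allI impI)
    fix A :: "complex set" assume "open A"
    then have "open {z. Some z \<in> S \<and> f (Some z) \<in> \<beta> ` (A \<inter> B)}"
      using B(1) by (intro fvi \<beta>op) auto
    moreover have "p -` A \<inter> E = {z. Some z \<in> S \<and> f (Some z) \<in> \<beta> ` (A \<inter> B)}"
    proof (intro set_eqI iffI)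
      fix z assume "z \<in> p -` A \<inter> E"
      then show "z \<in> {z. Some z \<in> S \<and> f (Some z) \<in> \<beta> ` (A \<inter> B)}"
        using pE[of z] by (auto simp: E_def intro: image_eqI[of _ _ "p z"])
    next
      fix z assume z: "z \<in> {z. Some z \<in> S \<and> f (Some z) \<in> \<beta> ` (A \<inter> B)}"
      then obtain w where w: "w \<in> A" "w \<in> B" "f (Some z) = \<beta> w" by blast
      then have "p z = w" by (simp add: p_def the_inv_into_f_f[OF \<beta>(1)])
      then show "z \<in> p -` A \<inter> E" using z w by (auto simp: E_def D_def)
    qed
    ultimately show "open (p -` A \<inter> E)" by simp
  qed
  \<comment> \<open>With no critical points every exponent is 1, so each sheet maps bijectively and
    the sum of the exponents counts the sheets.\<close>
  have sheets: "\<exists>V \<W>. openin rsphere_top V \<and> \<beta> b \<in> V \<and> V \<subseteq> S \<and> finite \<W> \<and> disjoint \<W> \<and> \<Union>\<W> = {p \<in> S. f p \<in> V} \<and>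
      (\<forall>W\<in>\<W>. openin rsphere_top W) \<and> (\<forall>W\<in>\<W>. bij_betw f W V) \<and> card \<W> = d" if b: "b \<in> B" for b
  proof -
    have bS: "\<beta> b \<in> S" using b \<beta>(3) by blast
    obtain V \<psi> \<W> t \<phi> where V: "openin rsphere_top V" "V \<subseteq> S" "\<beta> b \<in> V" "\<psi> (Some 0) = \<beta> b"
      "conformal_iso \<psi> unit_disk V" "finite \<W>" "disjoint \<W>"
      "\<Union>\<W> = {p \<in> S. f p \<in> V}" "\<forall>W\<in>\<W>. openin rsphere_top W" "\<forall>W\<in>\<W>. 1 \<le> t W"
      "\<forall>W\<in>\<W>. power_model f (t W) (\<phi> W) W \<psi> V" "(\<Sum>W\<in>\<W>. t W) = d"
      using branched_covering_nbhd[OF bc bS d] .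
    have t1: "t W = 1" if W: "W \<in> \<W>" for W
    proof (rule no_critical_exponent_1[OF S hol nocrit V(11)[rule_format, OF W]])
      show "W \<subseteq> S" using W V(8) by blast
      show "1 \<le> t W" using V(10) W by blast
    qed
    have "bij_betw f W V" if "W \<in> \<W>" for W
      using V(11)[rule_format, OF that] unfolding t1[OF that] by (rule power_model_1_bij)
    moreover have "card \<W> = d" using V(12) t1 by simp
    ultimately show ?thesis
      using V(1-3,6-9) by (intro exI[of _ V] exI[of _ \<W>] conjI ballI) auto
  qed
  have cov: "covering_space E p B"
  proof
    show "continuous_on E p" by (rule cp)
    have preim: "\<exists>z\<in>E. Some z \<in> W \<and> p z = w"
      if hw: "w \<in> B" "\<beta> w \<in> V" "bij_betw f W V" "W \<subseteq> S" for w W V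
    proof -
      obtain q where q: "q \<in> W" "f q = \<beta> w" using hw(2,3) by (metis bij_betw_imp_surj_on imageE)
      have "q \<noteq> None" using ne[of q w] q hw(1,4) by blast
      then obtain z where z: "q = Some z" by blast
      have "z \<in> E" using q z hw(1,4) by (auto simp: E_def D_def)
      moreover have "p z = w" using q z hw(1) by (simp add: p_def the_inv_into_f_f[OF \<beta>(1)])
      ultimately show ?thesis using q z by blast
    qed
    show "p ` E = B"
    proof
      show "p ` E \<subseteq> B" using pE by blast
      show "B \<subseteq> p ` E"
      proof
        fix b assume b: "b \<in> B"
        obtain V \<W> where V: "openin rsphere_top V" "\<beta> b \<in> V" "V \<subseteq> S" "finite \<W>" "disjoint \<W>"
      "\<Union>\<W> = {p \<in> S. f p \<in> V}" "\<forall>W\<in>\<W>. openin rsphere_top W" "\<forall>W\<in>\<W>. bij_betw f W V" "card \<W> = d"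
      using sheets[OF b] by (elim exE conjE)
        obtain W where W: "W \<in> \<W>" using V(9) d by fastforce
        then have "W \<subseteq> S" using V(6) by blast
        then show "b \<in> p ` E" using preim[OF b V(2) V(8)[rule_format, OF W]] by blast
      qed
    qed
    fix b assume b: "b \<in> B"
    obtain V \<W> where V: "openin rsphere_top V" "\<beta> b \<in> V" "V \<subseteq> S" "finite \<W>" "disjoint \<W>"
      "\<Union>\<W> = {p \<in> S. f p \<in> V}" "\<forall>W\<in>\<W>. openin rsphere_top W" "\<forall>W\<in>\<W>. bij_betw f W V" "card \<W> = d"
      using sheets[OF b] by (elim exE conjE)
    \<comment> \<open>The disk \<open>V\<close> may stick out of the image of
      \<open>\<beta>\<close>, so both it and its sheets are cut down to the parts over
      \<open>B\<close>.\<close>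
    define T where "T = {w \<in> B. \<beta> w \<in> V}"
    define u where "u W = {z \<in> E. Some z \<in> W}" for W
    show "\<exists>T. b \<in> T \<and> openin (top_of_set B) T \<and>
         (\<exists>v. \<Union>v = E \<inter> p -` T \<and> (\<forall>u\<in>v. openin (top_of_set E) u) \<and>
          pairwise disjnt v \<and> (\<forall>u\<in>v. \<exists>q. homeomorphism u T p q))"
    proof (intro exI[of _ T] exI[of _ "u ` \<W>"] conjI ballI)
      show "b \<in> T" using b V(2) by (simp add: T_def)
      show "openin (top_of_set B) T"
        unfolding openin_open_eq[OF B(1)] using \<beta>vi[OF V(1)] by (auto simp: T_def)
      show "\<Union>(u ` \<W>) = E \<inter> p -` T"
      proof -
        have 1: "z \<in> \<Union>(u ` \<W>) \<longleftrightarrow> z \<in> E \<and> Some z \<in> \<Union>\<W>" for z by (auto simp: u_def)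
        have 2: "Some z \<in> \<Union>\<W> \<longleftrightarrow> p z \<in> T" if "z \<in> E" for z
          unfolding V(6) using pE[OF that] that by (simp add: T_def E_def)
        show ?thesis
        proof (rule set_eqI)
          fix z
          show "z \<in> \<Union>(u ` \<W>) \<longleftrightarrow> z \<in> E \<inter> p -` T" unfolding 1 using 2[of z] by auto
        qed
      qed
      show "pairwise disjnt (u ` \<W>)"
      proof (rule pairwiseI)
        fix X Y assume XY: "X \<in> u ` \<W>" "Y \<in> u ` \<W>" "X \<noteq> Y"
        then obtain W W' where W: "W \<in> \<W>" "W' \<in> \<W>" "X = u W" "Y = u W'" by blast
        then have "W \<noteq> W'" using XY(3) by blast
        then have "W \<inter> W' = {}" using V(5) W(1,2) by (auto simp: disjoint_def)
        then show "disjnt X Y" unfolding W by (auto simp: u_def disjnt_def)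
      qed
      fix X assume "X \<in> u ` \<W>"
      then obtain W where W: "W \<in> \<W>" "X = u W" by blast
      have "open (Some -` W)" using open_param_vimage[OF Some_param] V(7) W(1) by blast
      then have oX: "open X"
      proof -
        have "X = E \<inter> Some -` W" unfolding W(2) by (auto simp: u_def)
        then show ?thesis using oE \<open>open (Some -` W)\<close> by (simp add: open_Int)
      qed
      have XE: "X \<subseteq> E" unfolding W(2) by (auto simp: u_def)
      then show "openin (top_of_set E) X" using oX oE by (simp add: openin_open_eq)
      have bW: "bij_betw f W V" using V(8) W(1) by blast
      have WS: "W \<subseteq> S" using V(6) W(1) by blast
      have "inj_on p X"
      proof (rule inj_onI)
        fix y z assume yz: "y \<in> X" "z \<in> X" "p y = p z"
        then have "f (Some y) = f (Some z)" using pE(2) XE by (metis subsetD)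
        moreover have "Some y \<in> W" "Some z \<in> W" using yz(1,2) unfolding W(2) u_def by auto
        ultimately have "Some y = Some z" using inj_onD[OF bij_betw_imp_inj_on[OF bW]] by blast
        then show "y = z" by simp
      qed
      \<comment> \<open>Invariance of domain: a continuous injection on an open planar set is a
        homeomorphism onto its image.\<close>
      then obtain q where q: "homeomorphism X (p ` X) p q"
        using invariance_of_domain_homeomorphism[OF oX continuous_on_subset[OF cp XE] order_refl] by blast
      have "p ` X = T"
      proof
        show "p ` X \<subseteq> T"
        proof (rule image_subsetI)
          fix z assume z: "z \<in> X"
          then have "Some z \<in> W" unfolding W(2) u_def by auto
          then have "f (Some z) \<in> V" using bW by (auto simp: bij_betw_def)
          then show "p z \<in> T" using pE[of z] z XE by (auto simp: T_def)
        qed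
        show "T \<subseteq> p ` X"
        proof
          fix w assume "w \<in> T"
          then show "w \<in> p ` X" using preim[OF _ _ bW WS, of w] unfolding W(2) u_def T_def by blast
        qed
      qed
      then show "\<exists>q. homeomorphism X T p q" using q by blast
    qed
  qed
  have "connected E" using con by (simp add: E_def D_def)
  then have "path_connected E" using oE by (simp add: connected_open_path_connected)
  then have injp: "inj_on p E" by (rule covering_space_simply_connected_inj[OF cov _ B(2)])
  obtain b where b: "b \<in> B" using B(3) by blast
  obtain V \<W> where V: "openin rsphere_top V" "\<beta> b \<in> V" "V \<subseteq> S" "finite \<W>" "disjoint \<W>"
      "\<Union>\<W> = {p \<in> S. f p \<in> V}" "\<forall>W\<in>\<W>. openin rsphere_top W" "\<forall>W\<in>\<W>. bij_betw f W V" "card \<W> = d"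
      using sheets[OF b] by (elim exE conjE)
  \<comment> \<open>Two disjoint sheets contain two different points over \<open>b\<close>,
    contradicting injectivity.\<close>
  have "\<not> card \<W> \<le> 1" using V(9) d \<open>d \<noteq> 1\<close> by simp
  then obtain W1 W2 where W: "W1 \<in> \<W>" "W2 \<in> \<W>" "W1 \<noteq> W2"
    using card_le_Suc0_iff_eq[OF V(4)] by auto
  have "\<exists>z\<in>E. Some z \<in> W \<and> p z = b" if "W \<in> \<W>" for W
  proof -
    have "bij_betw f W V" using V(8) that by blast
    then obtain q where q: "q \<in> W" "f q = \<beta> b" using V(2) by (metis bij_betw_imp_surj_on imageE)
    have qS: "q \<in> S" using q(1) that V(6) by blast
    have "q \<noteq> None" using ne[of q b] q qS b by blast
    then obtain z where z: "q = Some z" by blast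
    have "z \<in> E" using q z qS b by (auto simp: E_def D_def)
    moreover have "p z = b" using q z b by (simp add: p_def the_inv_into_f_f[OF \<beta>(1)])
    ultimately show ?thesis using q z by blast
  qed
  then obtain z1 z2 where z: "z1 \<in> E" "z2 \<in> E" "Some z1 \<in> W1" "Some z2 \<in> W2" "p z1 = b" "p z2 = b"
    using W(1,2) by meson
  then have "z1 = z2" using inj_onD[OF injp] by metis
  then show False using z(3,4) W V(5) by (auto simp: disjoint_def)
qed

text \<open>Over the centre \<open>y\<close> of the disk, a sheet has only its own centre, because
  \<open>z ^ t = 0\<close> forces \<open>z = 0\<close>.\<close>

lemma finite_fibre:
  assumes bc: "holo_branched_covering S f d" and d: "0 < d" and y: "y \<in> S"
  shows "finite {p \<in> S. f p = y}"
proof -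
  obtain V \<psi> \<W> t \<phi> where V: "openin rsphere_top V" "V \<subseteq> S" "y \<in> V" "\<psi> (Some 0) = y"
    "conformal_iso \<psi> unit_disk V" "finite \<W>" "disjoint \<W>"
    "\<Union>\<W> = {p \<in> S. f p \<in> V}" "\<forall>W\<in>\<W>. openin rsphere_top W" "\<forall>W\<in>\<W>. 1 \<le> t W"
    "\<forall>W\<in>\<W>. power_model f (t W) (\<phi> W) W \<psi> V" "(\<Sum>W\<in>\<W>. t W) = d"
    using branched_covering_nbhd[OF bc y d] .
  have "{p \<in> S. f p = y} \<subseteq> (\<lambda>W. \<phi> W (Some 0)) ` \<W>"
  proof
    fix p assume p: "p \<in> {p \<in> S. f p = y}"
    then obtain W where W: "W \<in> \<W>" "p \<in> W" using V(3,8) by blast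
    have pm: "conformal_iso (\<phi> W) unit_disk W"
      "\<And>z. z \<in> ball 0 1 \<Longrightarrow> f (\<phi> W (Some z)) = \<psi> (Some (z ^ t W))"
      using V(11) W(1) by (auto simp: power_model_def)
    obtain z where z: "z \<in> ball 0 1" "p = \<phi> W (Some z)" using disc_cases[OF pm(1) W(2)] .
    have "z ^ t W \<in> ball 0 1" using power_image_disc[of "t W"] V(10) W(1) z(1) by blast
    moreover have "\<psi> (Some (z ^ t W)) = \<psi> (Some 0)" using pm(2)[OF z(1)] z(2) p V(4) by simp
    ultimately have "z ^ t W = 0" using disc_eq_iff[OF V(5), of "z ^ t W" 0] by simp
    then have "z = 0" by simp
    then show "p \<in> (\<lambda>W. \<phi> W (Some 0)) ` \<W>" using z W by blast
  qed
  then show ?thesis using V(6) finite_subset by blast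
qed

text \<open>Disk and plane are simply connected coordinates for themselves. On the sphere the value
  \<open>f None\<close> is deleted: the rest of the target is a copy of the plane, and its preimage
  is the plane without finitely many points, hence connected.\<close>

lemma exists_critical_point:
  assumes S: "S = unit_disk \<or> S = range Some \<or> S = UNIV"
    and bc: "holo_branched_covering S f d" and d: "1 < d"
  obtains c where "c \<in> S" "critical_point f c"
proof (rule ccontr)
  assume "\<not> thesis"
  then have nc: "\<And>c. c \<in> S \<Longrightarrow> \<not> critical_point f c" using that by blast
  have d0: "0 < d" using d by simp
  have fS: "f p \<in> S" if "p \<in> S" for p using bc that by (auto simp: holo_branched_covering_def)
  have hS: "hol_at (\<lambda>p. Some (inv Some p)) (Some w)" for w
    using hol_at_Some[OF analytic_on_ident, of w] by simp
  have sphere: "connected {z. f (Some z) \<noteq> y}" if "S = UNIV" for y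
  proof -
    have "finite {p. f p = y}" using finite_fibre[OF bc d0, of y] that by simp
    then have "finite (Some -` {p. f p = y})" by (rule finite_vimageI) simp
    then have "connected (UNIV - Some -` {p. f p = y})"
      by (intro connected_open_delete_finite) auto
    moreover have "UNIV - Some -` {p. f p = y} = {z. f (Some z) \<noteq> y}" by auto
    ultimately show ?thesis by simp
  qed
  consider "S = unit_disk" | "S = range Some" | "S = UNIV" "f None = None" | v where "S = UNIV" "f None = Some v"
    using S by (metis option.exhaust)
  then have "d = 1"
  proof cases
    case 1
    have e: "{z. Some z \<in> S \<and> f (Some z) \<in> Some ` ball 0 1} = ball 0 1"
      using fS unfolding 1 by auto
    show ?thesis
    proof (rule unbranched_covering_degree[OF _ bc d0 nc, where B = "ball 0 1" and \<beta> = Some])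
      show "openin rsphere_top S" unfolding 1 by (rule openin_unit_disk)
      show "connected {z. Some z \<in> S \<and> f (Some z) \<in> Some ` ball 0 1}" unfolding e by simp
    qed (use 1 hS in \<open>auto simp: convex_imp_simply_connected\<close>)
  next
    case 2
    have e: "{z. Some z \<in> S \<and> f (Some z) \<in> range Some} = UNIV"
      using fS unfolding 2 by auto
    show ?thesis
    proof (rule unbranched_covering_degree[OF _ bc d0 nc, where B = UNIV and \<beta> = Some])
      show "openin rsphere_top S" unfolding 2 by (rule openin_range_param[OF Some_param])
      show "connected {z. Some z \<in> S \<and> f (Some z) \<in> range Some}" unfolding e by (rule connected_UNIV)
    qed (use 2 hS in \<open>auto simp: convex_imp_simply_connected\<close>)
  next
    case 3
    have e: "{z. Some z \<in> S \<and> f (Some z) \<in> range Some} = {z. f (Some z) \<noteq> None}"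
      using 3 by auto
    show ?thesis
    proof (rule unbranched_covering_degree[OF _ bc d0 nc, where B = UNIV and \<beta> = Some])
      show "openin rsphere_top S" unfolding 3 using openin_topspace[of rsphere_top] by simp
      show "connected {z. Some z \<in> S \<and> f (Some z) \<in> range Some}"
        unfolding e by (rule sphere[OF 3(1)])
    qed (use 3 hS in \<open>auto simp: convex_imp_simply_connected\<close>)
  next
    case (4 v)
    \<comment> \<open>The inverse of the coordinate \<open>1 / (z - v)\<close>, which parametrizes
      the sphere without \<open>v\<close> by the plane and sends 0 to infinity.\<close>
    define \<beta> where "\<beta> w = (if w = 0 then None else Some (v + inverse w))" for w
    have r: "range \<beta> = - {Some v}"
    proof (intro set_eqI iffI)
      fix y assume y: "y \<in> - {Some v}"
      show "y \<in> range \<beta>"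
      proof (cases y)
        case None
        then show ?thesis by (intro image_eqI[of _ _ 0]) (auto simp: \<beta>_def)
      next
        case (Some a)
        then show ?thesis using y by (intro image_eqI[of _ _ "inverse (a - v)"]) (auto simp: \<beta>_def)
      qed
    qed (auto simp: \<beta>_def split: if_splits)
    have e: "{z. Some z \<in> S \<and> f (Some z) \<in> range \<beta>} = {z. f (Some z) \<noteq> Some v}"
      using 4 r by auto
    have hol: "hol_at (\<lambda>p. \<beta> (inv Some p)) (Some w)" for w
    proof (cases "w = 0")
      case False
      have "(\<lambda>w. v + inverse w) analytic_on {w}"
        using False by (intro analytic_intros) auto
      then have h: "hol_at (\<lambda>p. Some (v + inverse (inv Some p))) (Some w)"
        by (rule hol_at_Some)
      show ?thesis
      proof (rule hol_at_cong[OF h])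
        show "openin rsphere_top (Some ` (- {0}))" by (rule openin_param_image[OF Some_param]) auto
      qed (use False in \<open>auto simp: \<beta>_def\<close>)
    next
      case True
      have "open ((\<lambda>w. 1 + v * w) -` (- {0}))"
        by (intro open_vimage continuous_intros)
      then have o: "openin rsphere_top (Some ` {w. 1 + v * w \<noteq> 0})"
        using openin_param_image[OF Some_param] by (simp add: vimage_def)
      \<comment> \<open>This is \<open>\<beta>\<close> in the chart at infinity: the reciprocal of
        \<open>v + 1 / w\<close>, extended by 0 at \<open>w = 0\<close>.\<close>
      have "(\<lambda>w. w / (1 + v * w)) analytic_on {0}"
        by (intro analytic_intros) auto
      then have h: "hol_at (\<lambda>p. at_inf ((\<lambda>w. w / (1 + v * w)) (inv Some p))) (Some 0)"
        by (rule hol_at_param) (auto simp: parametrizations_def)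
      show ?thesis
        unfolding True
      proof (rule hol_at_cong[OF h o])
        fix p assume "p \<in> Some ` {w. 1 + v * w \<noteq> 0}"
        then obtain w where "p = Some w" "1 + v * w \<noteq> 0" by blast
        then show "at_inf ((\<lambda>w. w / (1 + v * w)) (inv Some p)) = \<beta> (inv Some p)"
          by (cases "w = 0") (auto simp: at_inf_def \<beta>_def field_simps)
      qed auto
    qed
    show ?thesis
    proof (rule unbranched_covering_degree[OF _ bc d0 nc, where B = UNIV and \<beta> = \<beta>])
      show "openin rsphere_top S" unfolding 4 using openin_topspace[of rsphere_top] by simp
      show "connected {z. Some z \<in> S \<and> f (Some z) \<in> range \<beta>}"
        unfolding e by (rule sphere[OF 4(1)])
      show "inj \<beta>" by (auto simp: inj_def \<beta>_def)
      show "hol_at (\<lambda>p. \<beta> (inv Some p)) (Some w)" for w by (rule hol)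
    qed (use 4 r in \<open>auto simp: convex_imp_simply_connected\<close>)
  qed
  then show False using d by simp
qed

section \<open>Regularity and signatures\<close>

lemma binclass_eq_bot_iff: "binclass a = bot \<longleftrightarrow> (\<forall>\<^sub>\<infinity>n. \<not> a n)"
  by (simp add: bot_binclass_def binclass.abs_eq_iff)

lemma binclass_le_iff: "binclass a \<le> binclass b \<longleftrightarrow> (\<forall>\<^sub>\<infinity>n. a n \<longrightarrow> b n)"
  by (simp add: less_eq_binclass.abs_eq)

lemma binclass_bot_neq_top: "(bot :: binclass) \<noteq> top"
proof -
  have "binclass (\<lambda>_. True) \<noteq> bot" unfolding binclass_eq_bot_iff by simp
  then show ?thesis by (simp add: top_binclass_def)
qed

lemma regular_point_imp_ind_bot:
  assumes S: "openin rsphere_top S" and hol: "\<And>p. p \<in> S \<Longrightarrow> hol_at f p"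
    and U: "open_seq S f U" and bij: "\<And>i. i \<ge> n \<Longrightarrow> bij_betw f (U (Suc i)) (U i)"
    and c: "c \<in> S" "critical_point f c"
  shows "ind U c = bot"
proof -
  \<comment> \<open>The inequality is strict because bijectivity from level \<open>Suc j\<close> to
    level \<open>j\<close> is injectivity on the upper level.\<close>
  have "c \<notin> U i" if i: "i > n" for i
  proof
    assume "c \<in> U i"
    obtain j where j: "i = Suc j" "j \<ge> n" using i by (cases i) auto
    have "openin rsphere_top (U i)" using U by (simp add: open_seq_def)
    moreover have "inj_on f (U i)" using bij[OF j(2)] j(1) by (simp add: bij_betw_def)
    ultimately show False
      using critical_point_iff[OF S hol c(1)] c(2) \<open>c \<in> U i\<close> by blast
  qed
  then show ?thesis unfolding ind_def binclass_eq_bot_iff MOST_nat by blast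
qed

text \<open>An exponent of 1 would make the map bijective, so the exponent is at least 2 and the
  centre of the upper disk is critical.\<close>

lemma not_bij_imp_critical:
  assumes S: "openin rsphere_top S" and hol: "\<And>p. p \<in> S \<Longrightarrow> hol_at f p"
    and U: "plaque S f d U" and nb: "\<not> bij_betw f (U (Suc i)) (U i)"
  obtains c where "c \<in> U (Suc i)" "c \<in> S" "critical_point f c"
proof -
  obtain t \<phi> \<psi> where t: "1 \<le> t" "power_model f t \<phi> (U (Suc i)) \<psi> (U i)"
    using U unfolding plaque_def by blast
  have "t \<noteq> 1" using nb power_model_1_bij t(2) by blast
  then have t2: "2 \<le> t" using t(1) by simp
  have "conformal_iso \<phi> unit_disk (U (Suc i))" using t(2) by (simp add: power_model_def)
  then have c: "\<phi> (Some 0) \<in> U (Suc i)" using disc_mem[of \<phi> _ 0] by simp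
  moreover have cS: "\<phi> (Some 0) \<in> S" using c U by (auto simp: plaque_def open_seq_def)
  moreover have "critical_point f (\<phi> (Some 0))"
    using critical_point_iff[OF S hol cS] power_model_not_inj[OF t(2) t2] by blast
  ultimately show ?thesis using that by blast
qed

text \<open>This is needed twice below: over the levels of one neighbourhood, and over the
  neighbourhoods of a shrinking sequence.\<close>

lemma pigeonhole_frequently:
  assumes "finite C" "frequently (\<lambda>i. \<exists>c\<in>C. P c i) F"
  shows "\<exists>c\<in>C. frequently (P c) F"
proof (rule ccontr)
  assume "\<not> (\<exists>c\<in>C. frequently (P c) F)"
  then have "\<forall>c\<in>C. eventually (\<lambda>i. \<not> P c i) F" by (simp add: not_frequently)
  then have "eventually (\<lambda>i. \<forall>c\<in>C. \<not> P c i) F" using assms(1) by (rule eventually_ball_finite[rotated])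
  then show False using assms(2) by (simp add: frequently_def)
qed

text \<open>A decreasing sequence of infinite sets of naturals may have empty intersection, but it
  has an infinite pseudo-intersection, almost contained in each of them. In the algebra of classes
  this is a nonzero lower bound.\<close>

lemma diagonal_lower_bound:
  assumes dec: "\<And>j n. A (Suc j) n \<Longrightarrow> A j n" and inf: "\<And>j. \<exists>\<^sub>\<infinity>n. A j n"
  obtains b where "b \<noteq> bot" "\<And>j. b \<le> binclass (A j)"
proof -
  have mono: "A j n" if "j \<le> k" "A k n" for j k n
    using that by (induction k rule: dec_induct) (use dec in auto)
  have "\<forall>j. \<exists>n. j \<le> n \<and> A j n" using inf by (auto simp: INFM_nat_le)
  \<comment> \<open>The diagonal choice: \<open>j \<le> m j\<close> makes the set of chosen indices
    infinite, and by monotonicity only the \<open>m k\<close> with \<open>k < j\<close> can miss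
    \<open>A j\<close>.\<close>
  then obtain m where m: "\<And>j. j \<le> m j" "\<And>j. A j (m j)" by metis
  define b where "b n \<longleftrightarrow> (\<exists>k. n = m k)" for n
  have "\<exists>\<^sub>\<infinity>n. b n" unfolding INFM_nat_le b_def using m(1) by blast
  then have "binclass b \<noteq> bot"
    unfolding binclass_eq_bot_iff by (simp add: not_eventually)
  moreover have "binclass b \<le> binclass (A j)" for j
  proof -
    have "finite (m ` {..<j})" by simp
    then obtain N where N: "\<And>k. k < j \<Longrightarrow> m k \<le> N" unfolding finite_nat_set_iff_bounded_le by blast
    have "A j n" if n: "n > N" "b n" for n
    proof -
      obtain k where k: "n = m k" using n(2) by (auto simp: b_def)
      then have "j \<le> k" using N[of k] n(1) by (cases "k < j") auto
      then show ?thesis using mono m(2)[of k] k by blast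
    qed
    then show ?thesis unfolding binclass_le_iff MOST_nat by blast
  qed
  ultimately show ?thesis using that by blast
qed

theorem lemma19:
  fixes S :: "rsphere set" and f :: "rsphere \<Rightarrow> rsphere" and d :: nat
    and x :: "nat \<Rightarrow> rsphere"
  assumes "S = unit_disk \<or> S = range Some \<or> S = UNIV"
    and "holo_branched_covering S f d"
    and "1 < d"
    and "x \<in> plaque_limit S f"
  shows "regular_point S f d x \<longleftrightarrow>
    (\<forall>c\<in>S. critical_point f c \<longrightarrow> signature S f d x c = {binclass (\<lambda>_. False)})"
proof -
  have S: "openin rsphere_top S"
    using assms(1) openin_unit_disk openin_range_param[OF Some_param] openin_topspace[of rsphere_top]
    by auto
  have hol: "hol_at f p" if "p \<in> S" for p by (rule branched_covering_hol[OF S assms(2) that])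
  have "regular_point S f d x \<longleftrightarrow> (\<forall>c\<in>S. critical_point f c \<longrightarrow> signature S f d x c = {bot})"
  proof
    assume reg: "regular_point S f d x"
    obtain U n where U: "nhd S f d x U" and bij: "\<And>i. i \<ge> n \<Longrightarrow> bij_betw f (U (Suc i)) (U i)"
      using reg unfolding regular_point_def by blast
    have oU: "open_seq S f U" using U by (simp add: nhd_def plaque_def)
    have "1 \<le> d" using assms(3) by simp
    then obtain V where V: "shrinks_to S f d V x" using regular_point_shrinking[OF S hol _ reg] by blast
    \<comment> \<open>One member of the sequence inside the eventually bijective plaque is enough,
      since the index of that plaque at every critical point is already the zero class.\<close>
    then obtain m where m: "seq_points S f (V m) \<subseteq> seq_points S f U"
      using U unfolding shrinks_to_def by blast
    have oV: "open_seq S f (V m)" using V by (auto simp: shrinks_to_def nhd_def plaque_def)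
    show "\<forall>c\<in>S. critical_point f c \<longrightarrow> signature S f d x c = {bot}"
    proof (intro ballI impI)
      fix c assume c: "c \<in> S" "critical_point f c"
      have "ind (V m) c = bot"
        using ind_mono[OF oV m, of c] regular_point_imp_ind_bot[OF S hol oU bij c] by (simp add: bot_unique)
      then have "(\<Inter>j. lower (ind (V j) c)) \<subseteq> {bot}"
        by (auto simp: lower_def dest!: spec[of _ m] simp: bot_unique)
      moreover have "bot \<in> (\<Inter>j. lower (ind (V j) c))" by (simp add: lower_def)
      ultimately show "signature S f d x c = {bot}" using signature_eq[OF V] by blast
    qed
  next
    assume sig: "\<forall>c\<in>S. critical_point f c \<longrightarrow> signature S f d x c = {bot}"
    obtain c0 where c0: "c0 \<in> S" "critical_point f c0"
      using exists_critical_point[OF assms(1-3)] .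
    have "\<exists>U. shrinks_to S f d U x"
    proof (rule ccontr)
      assume "\<not> (\<exists>U. shrinks_to S f d U x)"
      then have "signature S f d x c0 = UNIV" by (simp add: signature_def)
      then have "top \<in> {bot :: binclass}" using sig c0 by (metis UNIV_I)
      then show False using binclass_bot_neq_top by simp
    qed
    then obtain U where U: "shrinks_to S f d U x" by blast
    have pl: "plaque S f d (U j)" and nU: "nhd S f d x (U j)" for j
      using U by (auto simp: shrinks_to_def nhd_def)
    \<comment> \<open>Containment of thread sets becomes containment of levels because every point
      of a level lies on a thread.\<close>
    have dec: "U (Suc j) n \<subseteq> U j n" for j n
    proof
      fix p assume "p \<in> U (Suc j) n"
      moreover have "open_seq S f (U (Suc j))" using pl by (simp add: plaque_def)
      ultimately obtain y where "y \<in> seq_points S f (U (Suc j))" "y n = p"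
        using open_seq_point by metis
      moreover have "seq_points S f (U (Suc j)) \<subseteq> seq_points S f (U j)"
        using U by (simp add: shrinks_to_def)
      ultimately show "p \<in> U j n" by (auto simp: seq_points_def)
    qed
    show "regular_point S f d x"
    proof (rule ccontr)
      assume irr: "\<not> regular_point S f d x"
      define C where "C = {c \<in> S. critical_point f c}"
      have finC: "finite C"
        unfolding C_def using finite_critical_points[OF assms(1,2)] assms(3) by simp
      have "\<exists>\<^sub>\<infinity>i. \<exists>c\<in>C. c \<in> U j i" for j
        unfolding INFM_nat_le
      proof
        fix n
        \<comment> \<open>The critical point found here lies in level \<open>Suc i\<close>, the
          upper of the two levels.\<close>
        obtain i where i: "i \<ge> n" "\<not> bij_betw f (U j (Suc i)) (U j i)"
          using irr nU[of j] unfolding regular_point_def by blast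
        obtain c where "c \<in> U j (Suc i)" "c \<in> S" "critical_point f c"
          using not_bij_imp_critical[OF S hol pl i(2)] .
        then show "\<exists>i\<ge>n. \<exists>c\<in>C. c \<in> U j i" using i(1) by (intro exI[of _ "Suc i"]) (auto simp: C_def)
      qed
      then have "\<exists>c\<in>C. \<exists>\<^sub>\<infinity>i. c \<in> U j i" for j
        using pigeonhole_frequently[OF finC, of "\<lambda>c i. c \<in> U j i"] by simp
      \<comment> \<open>The critical point may still depend on \<open>j\<close>. A second pigeonhole
        fixes one that works for infinitely many \<open>j\<close>, and since the neighbourhoods
        decrease it works for all of them.\<close>
      then have "\<exists>\<^sub>\<infinity>j. \<exists>c\<in>C. \<exists>\<^sub>\<infinity>i. c \<in> U j i" by (auto simp: INFM_nat_le)
      then obtain c where c: "c \<in> C" "\<exists>\<^sub>\<infinity>j. \<exists>\<^sub>\<infinity>i. c \<in> U j i"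
        using pigeonhole_frequently[OF finC, of "\<lambda>c j. \<exists>\<^sub>\<infinity>i. c \<in> U j i"] by blast
      have mono: "U k n \<subseteq> U j n" if "j \<le> k" for j k n
        using that by (induction k rule: dec_induct) (use dec in blast)+
      have "\<exists>\<^sub>\<infinity>i. c \<in> U j i" for j
      proof -
        obtain k where k: "k \<ge> j" "\<exists>\<^sub>\<infinity>i. c \<in> U k i"
          using c(2) unfolding INFM_nat_le[of "\<lambda>j. \<exists>\<^sub>\<infinity>i. c \<in> U j i"] by blast
        then show ?thesis using mono[OF k(1)] by (elim INFM_mono) blast
      qed
      then obtain b where b: "b \<noteq> bot" "\<And>j. b \<le> binclass (\<lambda>i. c \<in> U j i)"
        using diagonal_lower_bound[of "\<lambda>j i. c \<in> U j i"] dec by blast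
      have "b \<in> signature S f d x c"
        unfolding signature_eq[OF U] using b(2) by (simp add: lower_def ind_def)
      then show False using sig c(1) b(1) by (auto simp: C_def)
    qed
  qed
  then show ?thesis by (simp add: bot_binclass_def)
qed

end
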